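(* Let $T=\sum_{k=M}^N Q_k(z)D^k$, with $Q_k\in\mathbb{R}[z]$ and $Q_MQ_N\not\equiv 0$, be a non-degenerate hyperbolicity preserver with nonnegative Fuchs index $r$, let $n\ge M$ be an integer, and let $B\in\binom{[n+r]}{n}$ and $C\in\binom{[n+1+r]}{n+1}$. If $B\rightarrow C$ then $f_{B,n}\ll f_{C,n+1}$. Moreover, if there is no $\theta\in\mathbb{R}$ for which $Q_1(\theta)=\cdots=Q_n(\theta)=0$, then $f_{B,n}$ and $f_{C,n+1}$ (with $B\rightarrow C$) are co-prime, i.e., their zeros strictly interlace.
   Context: $D=d/dz$, $[m]=\{1,\dots,m\}$, $\binom{[m]}{n}$ is the set of $n$-element subsets of $[m]$, and $Q_k\equiv 0$ for $k<M$ or $k>N$. A nonzero polynomial in $\mathbb{R}[z]$ is hyperbolic if all its zeros are real. A linear operator $T:\mathbb{R}[z]\to\mathbb{R}[z]$ preserves hyperbolicity (is a hyperbolicity preserver) if $T(f)$ is hyperbolic or identically zero whenever $f$ is hyperbolic. The Fuchs index of $T$ is $r=\max_k(\deg Q_k-k)$ (over $k$ with $Q_k\not\equiv0$); $T$ is non-degenerate if $\deg Q_N=N+r$. Proper position of polynomials: the zeros $\alpha_1\le\cdots\le\alpha_p$ of $f$ and $\beta_1\le\cdots\le\beta_q$ of $g$ (hyperbolic, zeros with multiplicity) interlace if $\alpha_1\le\beta_1\le\alpha_2\le\beta_2\le\cdots$ or $\beta_1\le\alpha_1\le\beta_2\le\alpha_2\le\cdots$ (so $|p-q|\le1$; zeros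 of any two polynomials of degree $0$ or $1$ interlace). Write $f\ll g$ if the zeros of $f$ and $g$ interlace and $f'g-fg'\le 0$ on all of $\mathbb{R}$. The polynomials $f_{B,n}$, $v_{A,n}$ (for any integer $n\ge M$; used here for both $n$ and $n+1$): a pair $(v,f)$ of hyperbolic polynomials of degrees $r$ and $n$ has zero pattern $(A,B)$, where $A\cup B=[n+r]$ is a disjoint union with $|A|=r$, $|B|=n$, if, with $\alpha_1\le\cdots\le\alpha_{n+r}$ the zeros of $vf$, the zeros of $v$ are $\{\alpha_i:i\in A\}$ and those of $f$ are $\{\alpha_i:i\in B\}$ (as multisets). Given $B\in\binom{[n+r]}{n}$ and $A=[n+r]\setminus B$, let $a$ be the smallest zero of $Q_e$, $e=\min(n,N)$, put $f_0=(z-a)^n$, and recursively let $T(f_i)=v_{i+1}f_{i+1}$ be the unique factorization with $f_{i+1}$ monic and $(v_{i+1},f_{i+1})$ of zero pattern $(A,B)$. It is known that the limits $f_{B,n}:=\lim_i f_i$ and $v_{A,n}:=\lim_i v_i$ exist, that $T(f_{B,n})=v_{A,n}f_{B,n}$ with $f_{B,n}$ monic of degree $n$, and that $(v_{A,n},f_{B,n})$ has zero pattern $(A,B)$. The relation $\rightarrow$: for vectors $\mathbf{x}\in\mathbb{R}^k$, $\mathbf{y}\in\mathbb{R}^{k+1}$ write $\mathbf{x}\ll\mathbf{y}$ if $y_1\le x_1\le y_2\le x_2\le\cdots\le x_k\le y_{k+1}$. For a set $S$ of indices, $\mathbf{x}_S$ denotes the vector obtained from $\mathbf{x}$ by keeping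 only the coordinates labelled by $S$, in order. For $B\in\binom{[n+r]}{n}$, $C\in\binom{[n+1+r]}{n+1}$, $B\rightarrow C$ means that $\mathbf{x}_B\ll\mathbf{y}_C$ for all $\mathbf{x}\in\mathbb{R}^{n+r}$, $\mathbf{y}\in\mathbb{R}^{n+r+1}$ (each with weakly increasing coordinates) with $\mathbf{x}\ll\mathbf{y}$; equivalently, writing $B=\{b_1<\cdots<b_n\}$ and $C=\{c_1<\cdots<c_{n+1}\}$, $c_1\le b_1<c_2\le b_2<\cdots\le b_n<c_{n+1}$. *)

theory Defs
  imports "HOL-Analysis.Analysis" "HOL-Computational_Algebra.Computational_Algebra"
begin

section \<open>Hyperbolic polynomials and differential operators\<close>

definition hyperbolic :: "real poly \<Rightarrow> bool" where
  "hyperbolic f \<longleftrightarrow>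
     f \<noteq> 0 \<and> (\<forall>z::complex. poly (map_poly complex_of_real f) z = 0 \<longrightarrow> z \<in> \<real>)"

definition hyperbolicity_preserver :: "(real poly \<Rightarrow> real poly) \<Rightarrow> bool" where
  "hyperbolicity_preserver T \<longleftrightarrow> (\<forall>f. hyperbolic f \<longrightarrow> hyperbolic (T f) \<or> T f = 0)"

definition diff_op :: "(nat \<Rightarrow> real poly) \<Rightarrow> nat \<Rightarrow> nat \<Rightarrow> real poly \<Rightarrow> real poly" where
  "diff_op Q M N f = (\<Sum>k=M..N. Q k * (pderiv ^^ k) f)"

definition fuchs_index :: "(nat \<Rightarrow> real poly) \<Rightarrow> nat \<Rightarrow> nat \<Rightarrow> int" where
  "fuchs_index Q M N = Max {int (degree (Q k)) - int k | k. k \<in> {M..N} \<and> Q k \<noteq> 0}"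

definition non_degenerate :: "(nat \<Rightarrow> real poly) \<Rightarrow> nat \<Rightarrow> nat \<Rightarrow> bool" where
  "non_degenerate Q M N \<longleftrightarrow> int (degree (Q N)) = int N + fuchs_index Q M N"


section \<open>Interlacing and proper position\<close>

text \<open>
  \<open>zeros f\<close> lists the real zeros of a nonzero \<open>f\<close> with multiplicity, in weakly increasing
  order; for hyperbolic \<open>f\<close> these are all its zeros. (On the zero polynomial it is \<open>[]\<close>.)
\<close>
definition zeros :: "real poly \<Rightarrow> real list" where
  "zeros f = sorted_list_of_multiset (proots f)"

text \<open>
  \<open>alternates R xs ys\<close> is the chain \<open>x\<^sub>1 R y\<^sub>1 R x\<^sub>2 R y\<^sub>2 R \<dots>\<close> starting with \<open>xs\<close> and using up
  both lists, so \<open>xs\<close> has as many entries as \<open>ys\<close> or one more.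
\<close>
definition alternates :: "(real \<Rightarrow> real \<Rightarrow> bool) \<Rightarrow> real list \<Rightarrow> real list \<Rightarrow> bool" where
  "alternates R xs ys \<longleftrightarrow>
     (length xs = length ys \<or> length xs = Suc (length ys)) \<and>
     (\<forall>i<length ys. R (xs ! i) (ys ! i)) \<and>
     (\<forall>i. Suc i < length xs \<longrightarrow> R (ys ! i) (xs ! Suc i))"

definition interlace :: "real poly \<Rightarrow> real poly \<Rightarrow> bool" where
  "interlace f g \<longleftrightarrow>
     alternates (\<le>) (zeros f) (zeros g) \<or> alternates (\<le>) (zeros g) (zeros f)"

definition strictly_interlace :: "real poly \<Rightarrow> real poly \<Rightarrow> bool" where
  "strictly_interlace f g \<longleftrightarrow>
     alternates (<) (zeros f) (zeros g) \<or> alternates (<) (zeros g) (zeros f)"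

definition proper_position :: "real poly \<Rightarrow> real poly \<Rightarrow> bool"  (infix "\<lless>" 50) where
  "f \<lless> g \<longleftrightarrow>
     hyperbolic f \<and> hyperbolic g \<and> interlace f g \<and>
     (\<forall>x. poly (pderiv f * g - f * pderiv g) x \<le> 0)"


section \<open>Zero patterns and the polynomials \<open>f\<^bsub>B,n\<^esub>\<close>\<close>

text \<open>Index sets are subsets of \<open>{1..n + r}\<close>, while list positions start at \<open>0\<close>.\<close>

definition zero_pattern ::
    "nat \<Rightarrow> nat \<Rightarrow> nat set \<Rightarrow> nat set \<Rightarrow> real poly \<Rightarrow> real poly \<Rightarrow> bool" where
  "zero_pattern r n A B v f \<longleftrightarrow>
     hyperbolic v \<and> degree v = r \<and> hyperbolic f \<and> degree f = n \<and>
     A \<union> B = {1..n + r} \<and> A \<inter> B = {} \<and> card A = r \<and> card B = n \<and>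
     proots v = {# zeros (v * f) ! (i - 1). i \<in># mset_set A #} \<and>
     proots f = {# zeros (v * f) ! (i - 1). i \<in># mset_set B #}"

definition pattern_factorization ::
    "nat \<Rightarrow> nat \<Rightarrow> nat set \<Rightarrow> nat set \<Rightarrow> real poly \<Rightarrow> real poly \<times> real poly" where
  "pattern_factorization r n A B p =
     (THE (v, f). p = v * f \<and> lead_coeff f = 1 \<and> zero_pattern r n A B v f)"

definition smallest_zero :: "real poly \<Rightarrow> real" where
  "smallest_zero p = Min {x. poly p x = 0}"

primrec f_iter ::
    "(nat \<Rightarrow> real poly) \<Rightarrow> nat \<Rightarrow> nat \<Rightarrow> nat \<Rightarrow> nat \<Rightarrow> nat set \<Rightarrow> nat \<Rightarrow> real poly" where
  "f_iter Q M N r n B 0 = [:- smallest_zero (Q (min n N)), 1:] ^ n"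
| "f_iter Q M N r n B (Suc i) =
     snd (pattern_factorization r n ({1..n + r} - B) B (diff_op Q M N (f_iter Q M N r n B i)))"

text \<open>
  The iterates are monic of degree \<open>n\<close>; in the finite-dimensional space of polynomials of degree at
  most \<open>n\<close>, convergence means convergence of each coefficient. When \<open>Q\<^sub>e\<close> with \<open>e = min n N\<close> is a
  nonzero constant, \<open>smallest_zero\<close> is an unspecified number; this occurs only if \<open>n = 0\<close>, where
  it plays no role, or if \<open>T\<close> is multiplication by a constant (\<open>N = r = 0\<close>), where
  \<open>Q\<^sub>e = Q\<^sub>0\<close> gives the same number for all \<open>n\<close>.
\<close>
definition f_lim ::
    "(nat \<Rightarrow> real poly) \<Rightarrow> nat \<Rightarrow> nat \<Rightarrow> nat \<Rightarrow> nat \<Rightarrow> nat set \<Rightarrow> real poly" where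
  "f_lim Q M N r n B =
     (THE f. \<forall>k. (\<lambda>i. coeff (f_iter Q M N r n B i) k) \<longlonglongrightarrow> coeff f k)"


section \<open>The relation \<open>B \<rightarrow> C\<close>\<close>

definition vec_interlace :: "real list \<Rightarrow> real list \<Rightarrow> bool" where
  "vec_interlace xs ys \<longleftrightarrow> length ys = Suc (length xs) \<and> alternates (\<le>) ys xs"

definition restrict_vec :: "real list \<Rightarrow> nat set \<Rightarrow> real list" where
  "restrict_vec xs S = nths xs {i. Suc i \<in> S}"

text \<open>Here \<open>m\<close> is the length \<open>n + r\<close> of the vectors indexed by \<open>{1..m} \<supseteq> B\<close>.\<close>
definition arrow :: "nat \<Rightarrow> nat set \<Rightarrow> nat set \<Rightarrow> bool" where
  "arrow m B C \<longleftrightarrow>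
     (\<forall>xs ys. length xs = m \<and> length ys = Suc m \<and> sorted xs \<and> sorted ys \<and> vec_interlace xs ys \<longrightarrow>
        vec_interlace (restrict_vec xs B) (restrict_vec ys C))"

end

theory Submission
  imports Defs "HOL-Complex_Analysis.Great_Picard"
begin

text \<open>
  On the upper half plane a real-rooted polynomial has a continuous argument, the sum of the arguments
  of \<open>z - x\<close> over its roots \<open>x\<close>. Two real-rooted polynomials all of whose real combinations are
  real-rooted have arguments whose difference never meets a multiple of \<open>\<pi>\<close>; letting \<open>z\<close> tend to
  the real line turns this into interlacing. As a hyperbolicity preserver \<open>T\<close> maps such pencils to
  such pencils, it preserves interlacing in consecutive degrees, and moving one root at a time it is
  monotone in the roots.

  Applying \<open>T\<close> to powers of \<open>z - c\<close> shows that the symbol \<open>\<Sum>Q\<^sub>k(x) w^k\<close> has no zero with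
  \<open>Im x > 0 > Im w\<close>. Its top homogeneous part gives that the leading coefficients of all \<open>Q\<^sub>k\<close> have
  the same sign, which fixes degrees, makes \<open>T\<close> increasing rather than decreasing, and locates the
  zeros of the image of \<open>(z - c)^n\<close> to the right of \<open>c\<close> for \<open>c\<close> up to the smallest zero of \<open>Q\<^sub>e\<close>.
  So the iteration is monotone and bounded, and its limit does not depend on the starting point
  \<open>c\<close>. Starting both iterations at the same \<open>c\<close>, interlacing propagates to the limits.

  If the limits \<open>f\<close> and \<open>g\<close> have a common zero \<open>\<theta>\<close> of multiplicity \<open>\<sigma>\<close>, then so do \<open>T f\<close> and
  \<open>T g\<close>. For \<open>i < \<sigma>\<close> the symbol \<open>P\<close> of \<open>D^i T\<close> at \<open>\<theta>\<close> is real-rooted, and \<open>P(D)\<close>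
  maps \<open>f\<close> and \<open>g\<close> to polynomials vanishing at \<open>\<theta>\<close>. Each factor of \<open>P(D)\<close> lowers the common
  multiplicity, so it exceeds the degree of \<open>P\<close>; but for suitable \<open>i\<close> this degree is at least
  \<open>\<sigma>\<close> unless \<open>Q\<^sub>1, \<dots>, Q\<^sub>n\<close> all vanish at \<open>\<theta>\<close>.
\<close>

subsection \<open>Real-rooted polynomials\<close>

text \<open>Zeros are compared through the number of them to the right of each real
  \<open>t\<close>. The boundary values of the arguments deliver exactly this count, and interlacing
  becomes a pair of inequalities valid for all \<open>t\<close>. A pencil alone does not tell on
  which side the zeros move: the difference of the arguments lies in \<open>(0, \<pi>)\<close> or in
  \<open>(-\<pi>, 0)\<close>. In consecutive degrees the degrees decide; in equal degrees, after one
  root has been moved, the common sign of the leading coefficients does. For \<open>n < N\<close>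
  the two iterations start at different points, the smallest zeros of \<open>Q n\<close> and of
  \<open>Q (n + 1)\<close>, so their iterates are not directly comparable; for
  \<open>n \<ge> N\<close> both start at the smallest zero of \<open>Q N\<close>. This is where
  independence of the start enters. Interlacing permits common zeros, so coprimality needs another
  source: at the single point \<theta> the operator may be replaced by one with constant
  coefficients, which splits into real factors \<open>D - \<alpha>\<close>. There may be too few
  factors for a contradiction. Each further derivative of \<open>T\<close> adds at least one, and
  the values at \<theta> still vanish as long as fewer than \<sigma> derivatives are taken.\<close>

abbreviation cp :: "real poly \<Rightarrow> complex poly" where
  "cp \<equiv> map_poly complex_of_real"

lemma cp_pCons [simp]: "cp (pCons a p) = pCons (of_real a) (cp p)"
  by (simp add: map_poly_pCons)

lemma coeff_cp [simp]: "coeff (cp p) k = of_real (coeff p k)"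
  by (simp add: coeff_map_poly)

lemma degree_cp [simp]: "degree (cp p) = degree p"
  by (simp add: degree_map_poly)

lemma cp_add: "cp (p + q) = cp p + cp q"
  by (rule poly_eqI) simp

lemma cp_diff: "cp (p - q) = cp p - cp q"
  by (rule poly_eqI) simp

lemma cp_smult: "cp (smult c p) = smult (of_real c) (cp p)"
  by (rule poly_eqI) simp

lemma cp_mult: "cp (p * q) = cp p * cp q"
  by (rule poly_eqI) (simp add: coeff_mult)

lemma cp_sum: "cp (sum f A) = (\<Sum>x\<in>A. cp (f x))"
  by (induction A rule: infinite_finite_induct) (simp_all add: cp_add)

lemma cp_pderiv: "cp (pderiv p) = pderiv (cp p)"
  by (rule poly_eqI) (simp add: coeff_pderiv)

lemma cp_higher_pderiv: "cp ((pderiv ^^ k) p) = (pderiv ^^ k) (cp p)"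
  by (induction k) (simp_all add: cp_pderiv)

lemma cp_eq_0_iff [simp]: "cp p = 0 \<longleftrightarrow> p = 0"
  by (simp add: poly_eq_iff)

lemma poly_cp_of_real [simp]: "poly (cp p) (of_real x) = of_real (poly p x)"
  by (induction p) simp_all

lemma poly_cp_cnj: "poly (cp p) (cnj z) = cnj (poly (cp p) z)"
  by (rule poly_cnj_real[symmetric]) simp

section \<open>Monic polynomials with a prescribed multiset of roots\<close>

definition rpoly :: "'a::comm_ring_1 multiset \<Rightarrow> 'a poly" where
  "rpoly A = (\<Prod>x\<in>#A. [:- x, 1:])"

lemma rpoly_empty [simp]: "rpoly {#} = 1"
  by (simp add: rpoly_def)

lemma rpoly_add_mset [simp]: "rpoly (add_mset x A) = [:- x, 1:] * rpoly A"
  by (simp add: rpoly_def)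

lemma rpoly_union: "rpoly (A + B) = rpoly A * rpoly B"
  by (simp add: rpoly_def)

lemma rpoly_nonzero [simp]: "rpoly (A :: 'a::idom multiset) \<noteq> 0"
  by (induction A) (auto simp del: mult_pCons_left)

lemma degree_rpoly [simp]: "degree (rpoly (A :: 'a::idom multiset)) = size A"
  by (induction A) (auto simp: degree_mult_eq simp del: mult_pCons_left)

lemma lead_coeff_rpoly [simp]: "coeff (rpoly (A :: 'a::idom multiset)) (size A) = 1"
proof -
  have "lead_coeff (rpoly A) = 1"
    by (induction A) (auto simp: lead_coeff_mult simp del: mult_pCons_left)
  then show ?thesis by simp
qed

lemma proots_rpoly [simp]: "proots (rpoly (A :: 'a::idom multiset)) = A"
  by (induction A) (auto simp: proots_mult simp del: mult_pCons_left)

lemma poly_rpoly: "poly (rpoly A) z = (\<Prod>x\<in>#A. z - x)"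
  by (induction A) (auto simp: algebra_simps)

lemma poly_rpoly_eq_0_iff [simp]: "poly (rpoly (A :: 'a::idom multiset)) z = 0 \<longleftrightarrow> z \<in># A"
  by (auto simp: poly_rpoly prod_mset_zero_iff)

lemma rpoly_replicate: "rpoly (replicate_mset n x) = [:- x, 1:] ^ n"
  by (induction n) auto

lemma cp_rpoly: "cp (rpoly A) = rpoly (image_mset of_real A)"
  by (induction A) (auto simp: cp_mult simp del: mult_pCons_left)

lemma poly_cp_rpoly: "poly (cp (rpoly A)) z = (\<Prod>x\<in>#A. z - of_real x)"
  by (simp add: cp_rpoly poly_rpoly image_mset.compositionality o_def)

lemma hyperbolic_rpoly [simp]: "c \<noteq> 0 \<Longrightarrow> hyperbolic (smult c (rpoly A))"
  by (auto simp: hyperbolic_def cp_smult cp_rpoly)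

lemma hyperbolic_rpoly_1 [simp]: "hyperbolic (rpoly A)"
  using hyperbolic_rpoly[of 1 A] by simp

lemma hyperbolic_factor:
  assumes "hyperbolic p"
  shows "p = smult (lead_coeff p) (rpoly (proots p))"
  using assms
proof (induction "degree p" arbitrary: p)
  case 0
  then obtain c where "p = [:c:]" by (metis degree_eq_zeroE)
  then show ?case by simp
next
  case (Suc d)
  then have p0: "p \<noteq> 0" by auto
  have nc: "\<not> constant (poly (cp p))"
    using Suc.hyps(2)[symmetric] by (simp add: constant_degree)
  obtain z where z: "poly (cp p) z = 0"
    using Fundamental_Theorem_Algebra.fundamental_theorem_of_algebra[OF nc] by metis
  with Suc.prems have "z \<in> \<real>" by (auto simp: hyperbolic_def)
  then obtain x where x: "z = of_real x" by (auto elim: Reals_cases)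
  with z have "poly p x = 0" by simp
  then obtain q where q: "p = [:- x, 1:] * q"
    by (meson dvdE poly_eq_0_iff_dvd)
  then have q0: "q \<noteq> 0" using p0 by auto
  have dq: "d = degree q"
    using Suc.hyps(2) q0 unfolding q by (subst (asm) degree_mult_eq) auto
  have "hyperbolic q"
    using Suc.prems q0 unfolding hyperbolic_def q by (auto simp: cp_mult simp del: mult_pCons_left)
  with Suc.hyps(1)[OF dq] have IH: "q = smult (lead_coeff q) (rpoly (proots q))" by blast
  have "lead_coeff p = lead_coeff q"
    unfolding q by (simp only: lead_coeff_mult) simp
  moreover have "proots p = add_mset x (proots q)"
    unfolding q using q0 by (subst proots_mult) auto
  ultimately have "smult (lead_coeff p) (rpoly (proots p)) = [:- x, 1:] * smult (lead_coeff q) (rpoly (proots q))"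
    by (simp only: rpoly_add_mset mult_smult_right)
  also have "\<dots> = p" by (simp only: IH[symmetric] q[symmetric])
  finally show ?case by simp
qed

lemma hyperbolic_nonzero: "hyperbolic p \<Longrightarrow> p \<noteq> 0"
  by (simp add: hyperbolic_def)

lemma size_proots_hyperbolic: "hyperbolic p \<Longrightarrow> size (proots p) = degree p"
  using arg_cong[OF hyperbolic_factor, of p degree] by (auto simp: hyperbolic_nonzero)

text \<open>Nonreal zeros of a real polynomial come in conjugate pairs, so one open half plane
  decides.\<close>

lemma hyperbolic_upper_half:
  "hyperbolic p \<longleftrightarrow> p \<noteq> 0 \<and> (\<forall>z. Im z > 0 \<longrightarrow> poly (cp p) z \<noteq> 0)"
proof -
  have "z \<in> \<real>" if "\<forall>z. Im z > 0 \<longrightarrow> poly (cp p) z \<noteq> 0" "poly (cp p) z = 0" for z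
  proof (rule ccontr)
    assume "z \<notin> \<real>"
    then have "Im z > 0 \<or> Im (cnj z) > 0" by (auto simp: complex_is_Real_iff)
    moreover have "poly (cp p) (cnj z) = 0" using that(2) by (simp add: poly_cp_cnj)
    ultimately show False using that by blast
  qed
  then show ?thesis
    by (auto simp: hyperbolic_def complex_is_Real_iff)
qed

lemma hyperbolic_smult_iff [simp]: "hyperbolic (smult c p) \<longleftrightarrow> c \<noteq> 0 \<and> hyperbolic p"
  by (auto simp: hyperbolic_def cp_smult)

lemma hyperbolic_dvd: "hyperbolic p \<Longrightarrow> q dvd p \<Longrightarrow> hyperbolic q"
  unfolding hyperbolic_def by (auto simp: cp_mult elim!: dvdE)

subsection \<open>Limits of polynomials without zeros in a region\<close>

lemma tendsto_poly_coeffs: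
  fixes P :: "nat \<Rightarrow> complex poly"
  assumes "\<And>i. (\<lambda>j. coeff (P j) i) \<longlonglongrightarrow> coeff p i" and "\<And>j. degree (P j) \<le> d" and "degree p \<le> d"
    and "compact K"
  shows "uniform_limit K (\<lambda>j z. poly (P j) z) (poly p) sequentially"
proof -
  have e: "poly q z = (\<Sum>i\<le>d. coeff q i * z ^ i)" if "degree q \<le> d" for q :: "complex poly" and z
    unfolding poly_altdef using that
    by (intro sum.mono_neutral_left) (auto simp: coeff_eq_0)
  have b: "bounded ((\<lambda>z. z ^ i) ` K)" for i
    by (intro compact_imp_bounded compact_continuous_image assms continuous_intros)
  have t: "uniform_limit K (\<lambda>j z. coeff (P j) i * z ^ i) (\<lambda>z. coeff p i * z ^ i) sequentially" for i
  proof (rule uniform_lim_mult)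
    show "uniform_limit K (\<lambda>j z. coeff (P j) i) (\<lambda>z. coeff p i) sequentially"
      using assms(1)[of i] by (auto simp: uniform_limit_iff tendsto_iff elim: eventually_mono)
    show "uniform_limit K (\<lambda>j z. z ^ i) (\<lambda>z. z ^ i) sequentially"
      by (auto simp: uniform_limit_iff)
    show "bounded ((\<lambda>z. z ^ i) ` K)" by (rule b)
    show "bounded ((\<lambda>z. coeff p i) ` K)"
      by (rule bounded_subset[of "{coeff p i}"]) auto
  qed
  have "uniform_limit K (\<lambda>j z. \<Sum>i\<le>m. coeff (P j) i * z ^ i) (\<lambda>z. \<Sum>i\<le>m. coeff p i * z ^ i) sequentially" for m
  proof (induction m)
    case 0
    then show ?case using t[of 0] by simp
  next
    case (Suc m)
    then show ?case unfolding sum.atMost_Suc by (intro uniform_limit_add t)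
  qed
  moreover have "(\<lambda>j z. poly (P j) z) = (\<lambda>j z. \<Sum>i\<le>d. coeff (P j) i * z ^ i)"
    by (intro ext e assms(2))
  moreover have "poly p = (\<lambda>z. \<Sum>i\<le>d. coeff p i * z ^ i)"
    by (intro ext e assms(3))
  ultimately show ?thesis by simp
qed

lemma poly_holomorphic_on: "poly (p :: complex poly) holomorphic_on S"
  unfolding holomorphic_on_def field_differentiable_def
  using has_field_derivative_at_within[OF poly_DERIV] by blast

lemma Hurwitz_poly:
  fixes P :: "nat \<Rightarrow> complex poly"
  assumes S: "open S" "connected S"
    and lim: "\<And>i. (\<lambda>j. coeff (P j) i) \<longlonglongrightarrow> coeff p i"
    and deg: "\<And>j. degree (P j) \<le> d"
    and nz: "eventually (\<lambda>j. P j = 0 \<or> (\<forall>z\<in>S. poly (P j) z \<noteq> 0)) sequentially"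
    and p: "p \<noteq> 0" and z: "z \<in> S"
  shows "poly p z \<noteq> 0"
proof (cases "degree p = 0")
  case True
  then obtain c where "p = [:c:]" by (rule degree_eq_zeroE)
  then show ?thesis using p by simp
next
  case False
  obtain i where "coeff p i \<noteq> 0" using p by (auto simp: poly_eq_iff)
  then have "eventually (\<lambda>j. coeff (P j) i \<noteq> 0) sequentially"
    by (rule tendsto_imp_eventually_ne[OF lim])
  then have "eventually (\<lambda>j. \<forall>z\<in>S. poly (P j) z \<noteq> 0) sequentially"
    using nz by eventually_elim auto
  then obtain J where J: "\<And>j z. j \<ge> J \<Longrightarrow> z \<in> S \<Longrightarrow> poly (P j) z \<noteq> 0"
    by (auto simp: eventually_sequentially)
  have dp: "degree p \<le> d"
  proof (rule degree_le, safe)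
    fix k assume "d < k"
    then have "(\<lambda>j. 0 :: complex) \<longlonglongrightarrow> coeff p k"
      using lim[of k] by (simp add: coeff_eq_0[OF le_less_trans[OF deg]])
    then show "coeff p k = 0" by (simp add: LIMSEQ_const_iff)
  qed
  have "\<not> poly p constant_on S"
  proof
    assume "poly p constant_on S"
    then obtain c where "\<And>x. x \<in> S \<Longrightarrow> poly p x = c" by (auto simp: constant_on_def)
    then have "S \<subseteq> {x. poly (p - [:c:]) x = 0}" by auto
    moreover have "p - [:c:] \<noteq> 0" using False by auto
    ultimately have "finite S" by (metis finite_subset poly_roots_finite)
    then show False using S z by (metis empty_iff finite_imp_not_open)
  qed
  note nconst = this
  have sh: "(\<lambda>j. coeff (P (j + J)) i) \<longlonglongrightarrow> coeff p i" for i
    using lim[of i] by (rule LIMSEQ_ignore_initial_segment)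
  have ul: "uniform_limit K (\<lambda>j. poly (P (j + J))) (poly p) sequentially" if "compact K" "K \<subseteq> S" for K
    by (rule tendsto_poly_coeffs[OF sh deg dp that(1)])
  have nz': "poly (P (j + J)) u \<noteq> 0" if "u \<in> S" for j u
    using J that by simp
  show ?thesis
  proof (rule Hurwitz_no_zeros[OF S, where \<F> = "\<lambda>j. poly (P (j + J))" and g = "poly p"])
    show "poly (P (j + J)) holomorphic_on S" for j by (rule poly_holomorphic_on)
    show "poly p holomorphic_on S" by (rule poly_holomorphic_on)
    show "uniform_limit K (\<lambda>j. poly (P (j + J))) (poly p) sequentially" if "compact K" "K \<subseteq> S" for K
      by (rule ul[OF that])
    show "\<not> poly p constant_on S" by (rule nconst)
    show "poly (P (j + J)) u \<noteq> 0" if "u \<in> S" for j u by (rule nz'[OF that])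
    show "z \<in> S" by (rule z)
  qed
qed

subsection \<open>Arguments in the upper half plane\<close>

abbreviation arg_from :: "real \<Rightarrow> complex \<Rightarrow> real" where
  "arg_from x z \<equiv> Im (Ln (z - of_real x))"

text \<open>\<open>phase A\<close> is the continuous argument of the monic polynomial with root multiset \<open>A\<close> in the
  upper half plane; near a real \<open>t\<close> outside \<open>A\<close> it tends to \<open>\<pi>\<close> times \<open>count_above A t\<close>.\<close>

definition phase :: "real multiset \<Rightarrow> complex \<Rightarrow> real" where
  "phase A z = (\<Sum>x\<in>#A. arg_from x z)"

definition count_above :: "real multiset \<Rightarrow> real \<Rightarrow> nat" where
  "count_above A t = size {#x \<in># A. t < x#}"

lemma phase_empty [simp]: "phase {#} z = 0"
  by (simp add: phase_def)

lemma phase_add_mset [simp]: "phase (add_mset x A) z = arg_from x z + phase A z"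
  by (simp add: phase_def)

lemma count_above_add_mset [simp]:
  "count_above (add_mset x A) t = (if t < x then 1 else 0) + count_above A t"
  by (simp add: count_above_def)

lemma count_above_empty [simp]: "count_above {#} t = 0"
  by (simp add: count_above_def)

lemma arg_from_bounds:
  assumes "Im z > 0"
  shows "0 < arg_from x z" "arg_from x z < pi"
  using Im_Ln_pos_lt[of "z - of_real x"] assms by (auto simp: complex_eq_iff)

lemma Im_mult_cnj_Ln:
  assumes "a \<noteq> 0" "b \<noteq> 0"
  shows "Im (a * cnj b) = cmod a * cmod b * sin (Im (Ln a) - Im (Ln b))"
proof -
  have e: "a = of_real (cmod a) * cis (Im (Ln a))" if "a \<noteq> 0" for a :: complex
    using that exp_Ln[OF that] by (simp add: exp_eq_polar)
  have "a * cnj b = of_real (cmod a * cmod b) * (cis (Im (Ln a)) * cis (- Im (Ln b)))"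
    by (subst e[OF assms(1)], subst e[OF assms(2)]) (simp add: cis_cnj)
  also have "cis (Im (Ln a)) * cis (- Im (Ln b)) = cis (Im (Ln a) - Im (Ln b))"
    by (simp add: cis_mult)
  finally have "Im (a * cnj b) = Im (of_real (cmod a * cmod b) * cis (Im (Ln a) - Im (Ln b)))"
    by (rule arg_cong)
  then show ?thesis by simp
qed

text \<open>The sine of the difference of the two arguments is positive, and the difference lies
  between \<open>-\<pi>\<close> and \<open>\<pi>\<close>, so it is positive.\<close>

lemma arg_from_strict_mono:
  assumes "Im z > 0" "x < y"
  shows "arg_from x z < arg_from y z"
proof -
  let ?a = "z - of_real y" and ?b = "z - of_real x"
  have nz: "?a \<noteq> 0" "?b \<noteq> 0" using assms by (auto simp: complex_eq_iff)
  have "Im (?a * cnj ?b) = (y - x) * Im z" by (simp add: algebra_simps)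
  also have "\<dots> > 0" using assms by simp
  finally have "0 < cmod ?a * cmod ?b * sin (Im (Ln ?a) - Im (Ln ?b))"
    unfolding Im_mult_cnj_Ln[OF nz] .
  moreover have "0 < cmod ?a * cmod ?b" using nz by simp
  ultimately have "sin (Im (Ln ?a) - Im (Ln ?b)) > 0" by (rule zero_less_mult_pos)
  then show ?thesis
    using arg_from_bounds[OF assms(1), of x] arg_from_bounds[OF assms(1), of y]
      sin_ge_zero[of "Im (Ln ?b) - Im (Ln ?a)"]
    by (smt (verit) sin_minus)
qed

lemma arg_from_mono: "Im z > 0 \<Longrightarrow> x \<le> y \<Longrightarrow> arg_from x z \<le> arg_from y z"
  using arg_from_strict_mono[of z x y] by (cases "x = y") auto

lemma poly_cp_rpoly_polar:
  assumes "Im z > 0"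
  obtains \<rho> where "\<rho> > 0" "poly (cp (rpoly A)) z = of_real \<rho> * cis (phase A z)"
proof -
  have "\<exists>\<rho>>0. poly (cp (rpoly A)) z = of_real \<rho> * cis (phase A z)"
  proof (induction A)
    case empty
    then show ?case by (auto intro!: exI[of _ 1])
  next
    case (add x A)
    then obtain \<rho> where \<rho>: "\<rho> > 0" "poly (cp (rpoly A)) z = of_real \<rho> * cis (phase A z)" by blast
    let ?b = "z - of_real x"
    have nz: "?b \<noteq> 0" using assms by (auto simp: complex_eq_iff)
    have e: "?b = of_real (cmod ?b) * cis (Im (Ln ?b))"
      using exp_Ln[OF nz] nz by (simp add: exp_eq_polar)
    have "poly (cp (rpoly (add_mset x A))) z = ?b * (of_real \<rho> * cis (phase A z))"
      by (simp only: \<rho>(2)[symmetric] poly_cp_rpoly image_mset_add_mset prod_mset.add_mset)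
    also have "\<dots> = of_real (cmod ?b * \<rho>) * (cis (Im (Ln ?b)) * cis (phase A z))"
      by (subst e) simp
    finally show ?case
      using nz \<rho>(1) by (intro exI[of _ "cmod ?b * \<rho>"]) (simp add: cis_mult)
  qed
  then show ?thesis using that by blast
qed

lemma Im_rpoly_mult_cnj:
  assumes "Im z > 0"
  obtains \<rho> where "\<rho> > 0"
    "Im (poly (cp (rpoly A)) z * cnj (poly (cp (rpoly B)) z)) = \<rho> * sin (phase A z - phase B z)"
proof -
  obtain a where a: "a > 0" "poly (cp (rpoly A)) z = of_real a * cis (phase A z)"
    using poly_cp_rpoly_polar[OF assms] by blast
  obtain b where b: "b > 0" "poly (cp (rpoly B)) z = of_real b * cis (phase B z)"
    using poly_cp_rpoly_polar[OF assms] by blast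
  have "Im (poly (cp (rpoly A)) z * cnj (poly (cp (rpoly B)) z)) = (a * b) * sin (phase A z - phase B z)"
    by (simp add: a b sin_diff algebra_simps)
  then show ?thesis using that[of "a * b"] a(1) b(1) by simp
qed

lemma continuous_on_phase: "continuous_on {z. Im z > 0} (phase A)"
proof (induction A)
  case (add x A)
  have "continuous_on {z. Im z > 0} (\<lambda>z. arg_from x z)"
    by (intro continuous_intros) (auto simp: complex_nonpos_Reals_iff)
  with add show ?case by (auto intro!: continuous_intros)
qed simp

lemma phase_boundary:
  assumes "t \<notin># A"
  shows "((\<lambda>b. phase A (Complex t b)) \<longlongrightarrow> pi * count_above A t) (at_right 0)"
  using assms
proof (induction A)
  case (add x A)
  have l0: "((\<lambda>b. Complex t b) \<longlongrightarrow> of_real t) (at_right 0)"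
    unfolding Complex_eq by (auto intro!: tendsto_eq_intros)
  have "((\<lambda>b. arg_from x (Complex t b)) \<longlongrightarrow> (if t < x then pi else 0)) (at_right 0)"
  proof (cases "t < x")
    case False
    then have "t > x" using add.prems by auto
    then have "complex_of_real t - of_real x \<notin> \<real>\<^sub>\<le>\<^sub>0"
      by (auto simp: complex_nonpos_Reals_iff)
    then have "((\<lambda>b. Ln (Complex t b - of_real x)) \<longlongrightarrow> Ln (of_real t - of_real x)) (at_right 0)"
      by (intro tendsto_intros l0)
    moreover have "Im (Ln (of_real t - of_real x)) = 0"
      using \<open>t > x\<close> by (simp flip: of_real_diff add: Ln_of_real)
    ultimately show ?thesis using False by (auto dest: tendsto_Im)
  next
    \<comment> \<open>Here the points approach the branch cut of \<open>Ln\<close> from above. There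
      \<open>Ln w = Ln (- w) + \<i> * \<pi>\<close>, and \<open>Ln (- w)\<close> is continuous at
      the limit.\<close>
    case True
    then have "- (complex_of_real t - of_real x) \<notin> \<real>\<^sub>\<le>\<^sub>0"
      by (auto simp: complex_nonpos_Reals_iff)
    then have "((\<lambda>b. Ln (- (Complex t b - of_real x))) \<longlongrightarrow> Ln (- (of_real t - of_real x))) (at_right 0)"
      by (intro tendsto_intros l0)
    moreover have "Im (Ln (- (of_real t - of_real x))) = 0"
      using True Ln_of_real[of "x - t"] by simp
    ultimately have "((\<lambda>b. Im (Ln (- (Complex t b - of_real x))) + pi) \<longlongrightarrow> 0 + pi) (at_right 0)"
      by (intro tendsto_intros) (auto dest: tendsto_Im)
    moreover have "eventually (\<lambda>b. Im (Ln (- (Complex t b - of_real x))) + pi = arg_from x (Complex t b)) (at_right 0)"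
      using eventually_at_right_less[of 0]
      by eventually_elim (subst Ln_minus, auto simp: complex_eq_iff)
    ultimately show ?thesis using True by (auto elim: Lim_transform_eventually)
  qed
  moreover have "((\<lambda>b. phase A (Complex t b)) \<longlongrightarrow> pi * count_above A t) (at_right 0)"
    using add by auto
  ultimately have "((\<lambda>b. arg_from x (Complex t b) + phase A (Complex t b)) \<longlongrightarrow>
      (if t < x then pi else 0) + pi * count_above A t) (at_right 0)"
    by (rule tendsto_add)
  then show ?case by (cases "t < x") (simp_all add: algebra_simps)
qed simp

text \<open>The counts are step functions continuous from the right, so \<open>t\<close> can be
  moved off all roots, where \<open>phase_boundary\<close> applies.\<close>

lemma count_above_right_limit:
  obtains t' where "t' \<notin># A" "t' \<notin># B" "t < t'"
    "count_above A t' = count_above A t" "count_above B t' = count_above B t"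
proof -
  define m where "m = Min (insert (t + 1) {x \<in> set_mset (A + B). t < x})"
  have m1: "m > t" unfolding m_def by (subst Min_gr_iff) auto
  have m2: "m \<le> x" if "x \<in># A + B" "t < x" for x
    unfolding m_def using that by (intro Min_le) auto
  define t' where "t' = (t + m) / 2"
  have t': "t < t'" "t' < m" using m1 by (auto simp: t'_def)
  have c: "count_above C t' = count_above C t" if "C \<subseteq># A + B" for C
  proof -
    have "t' < x \<longleftrightarrow> t < x" if "x \<in># C" for x
      using m2[OF mset_subset_eqD[OF \<open>C \<subseteq># A + B\<close> that]] t' by linarith
    then show ?thesis unfolding count_above_def by (metis (mono_tags, lifting) filter_mset_cong)
  qed
  have "t' \<notin># A + B" using m2 t' by (meson linorder_not_less order_less_le_trans)
  then show ?thesis using that[of t'] c[of A] c[of B] t' by auto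
qed

lemma count_above_eventually_0: obtains t where "count_above A t = 0" "count_above B t = 0" 
proof -
  define t where "t = Max (insert 0 (set_mset (A + B)))"
  have "{#x \<in># C. t < x#} = {#x \<in># C. False#}" if "C \<subseteq># A + B" for C
    using Max_ge[of "insert 0 (set_mset (A + B))"] mset_subset_eqD[OF that]
    by (intro filter_mset_cong) (auto simp: t_def not_less)
  from this[of A] this[of B] show ?thesis using that[of t] by (simp add: count_above_def)
qed

lemma count_above_eventually_size: obtains t where "count_above A t = size A" "count_above B t = size B"
proof -
  define t where "t = Min (insert 0 (set_mset (A + B))) - 1"
  have "{#x \<in># C. t < x#} = C" if "C \<subseteq># A + B" for C
  proof -
    have "t < x" if x: "x \<in># C" for x
    proof -
      have "Min (insert 0 (set_mset (A + B))) \<le> x"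
        using mset_subset_eqD[OF \<open>C \<subseteq># A + B\<close> x] by (intro Min_le) auto
      then show ?thesis by (simp add: t_def)
    qed
    then show ?thesis by (auto simp: filter_mset_eq_conv)
  qed
  from this[of A] this[of B] show ?thesis using that[of t] by (simp add: count_above_def)
qed

lemma phase_le_count_above:
  assumes "\<And>z. Im z > 0 \<Longrightarrow> a \<le> phase B z - phase A z \<and> phase B z - phase A z \<le> b"
  shows "a \<le> pi * (real (count_above B t) - real (count_above A t))"
    "pi * (real (count_above B t) - real (count_above A t)) \<le> b"
proof -
  obtain t' where t': "t' \<notin># A" "t' \<notin># B"
    "count_above A t' = count_above A t" "count_above B t' = count_above B t"
    by (rule count_above_right_limit)
  have l: "((\<lambda>y. phase B (Complex t' y) - phase A (Complex t' y)) \<longlongrightarrow>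
      pi * (real (count_above B t) - real (count_above A t))) (at_right 0)"
    using tendsto_diff[OF phase_boundary[OF t'(2)] phase_boundary[OF t'(1)]] t'(3,4)
    by (simp add: algebra_simps)
  have ev: "eventually (\<lambda>y. a \<le> phase B (Complex t' y) - phase A (Complex t' y) \<and>
      phase B (Complex t' y) - phase A (Complex t' y) \<le> b) (at_right 0)"
    using eventually_at_right_less[of 0] by eventually_elim (use assms in auto)
  show "a \<le> pi * (real (count_above B t) - real (count_above A t))"
    by (rule tendsto_lowerbound[OF l]) (use ev in \<open>auto elim: eventually_mono\<close>)
  show "pi * (real (count_above B t) - real (count_above A t)) \<le> b"
    by (rule tendsto_upperbound[OF l]) (use ev in \<open>auto elim: eventually_mono\<close>)
qed

text \<open>The core of the Hermite--Kakeya--Obreschkoff theorem: the difference of the arguments cannot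
  cross a multiple of \<open>\<pi>\<close>, and its boundary values count zeros.\<close>

lemma phase_difference:
  assumes "\<And>z. Im z > 0 \<Longrightarrow> sin (phase B z - phase A z) \<noteq> 0"
  shows "\<exists>k::int. (k = 0 \<or> k = -1) \<and>
    (\<forall>z. Im z > 0 \<longrightarrow> k * pi < phase B z - phase A z \<and> phase B z - phase A z < (k + 1) * pi) \<and>
    (\<forall>t. k \<le> int (count_above B t) - int (count_above A t) \<and>
      int (count_above B t) - int (count_above A t) \<le> k + 1) \<and>
    k \<le> int (size B) - int (size A) \<and> int (size B) - int (size A) \<le> k + 1"
proof -
  let ?H = "{z. Im z > 0}"
  let ?d = "\<lambda>z. phase B z - phase A z"
  have conn: "connected (?d ` ?H)"
    by (intro connected_continuous_image continuous_intros continuous_on_phase convex_connected convex_halfspace_Im_gt)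
  \<comment> \<open>The open strips between consecutive multiples of \<open>\<pi>\<close> are
    separated, so the strip met at \<open>\<i>\<close> contains all values.\<close>
  define k where "k = \<lfloor>?d \<i> / pi\<rfloor>"
  have av: "?d z \<noteq> of_int m * pi" if "Im z > 0" for z m
    using assms[OF that] sin_zero_iff_int2 by metis
  have k1: "k * pi < ?d \<i>" "?d \<i> < (k + 1) * pi"
  proof -
    have "k \<le> ?d \<i> / pi" "?d \<i> / pi < k + 1" unfolding k_def by linarith+
    then have "k * pi \<le> ?d \<i>" "?d \<i> < (k + 1) * pi" by (simp_all add: field_simps)
    then show "k * pi < ?d \<i>" "?d \<i> < (k + 1) * pi" using av[of \<i> k] by auto
  qed
  have k2: "k * pi < ?d z \<and> ?d z < (k + 1) * pi" if "Im z > 0" for z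
  proof (rule ccontr)
    assume c: "\<not> ?thesis"
    have z: "?d z \<in> ?d ` ?H" "?d \<i> \<in> ?d ` ?H" using that by (auto intro!: imageI)
    have no: "of_int m * pi \<notin> ?d ` ?H" for m
      using av by (metis (mono_tags, lifting) imageE mem_Collect_eq)
    from c consider "?d z \<le> k * pi" | "?d z \<ge> (k + 1) * pi" by linarith
    then show False
    proof cases
      case 1
      have "of_int k * pi \<in> {?d z..?d \<i>}" using 1 k1(1) by simp
      with connected_contains_Icc[OF conn z] no[of k] show False by blast
    next
      case 2
      have "of_int (k + 1) * pi \<in> {?d \<i>..?d z}" using 2 k1(2) by simp
      with connected_contains_Icc[OF conn z(2) z(1)] no[of "k + 1"] show False by blast
    qed
  qed
  have r: "k * pi \<le> pi * (real (count_above B t) - real (count_above A t))"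
    "pi * (real (count_above B t) - real (count_above A t)) \<le> (k + 1) * pi" for t
  proof -
    have b: "k * pi \<le> phase B z - phase A z \<and> phase B z - phase A z \<le> (k + 1) * pi" if "Im z > 0" for z
      using k2[OF that] by linarith
    show "k * pi \<le> pi * (real (count_above B t) - real (count_above A t))"
      "pi * (real (count_above B t) - real (count_above A t)) \<le> (k + 1) * pi"
      using phase_le_count_above[OF b] by blast+
  qed
  have r1: "k \<le> int (count_above B t) - int (count_above A t)" for t
  proof -
    have "pi * real_of_int k \<le> pi * (real (count_above B t) - real (count_above A t))"
      using r(1)[of t] by (simp add: mult.commute)
    then show ?thesis by (subst (asm) mult_le_cancel_left_pos) auto
  qed
  have r2: "int (count_above B t) - int (count_above A t) \<le> k + 1" for t
  proof -
    have "pi * (real (count_above B t) - real (count_above A t)) \<le> pi * real_of_int (k + 1)"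
      using r(2)[of t] by (simp add: mult.commute)
    then show ?thesis by (subst (asm) mult_le_cancel_left_pos) auto
  qed
  \<comment> \<open>To the right of all roots both counts are \<open>0\<close>, hence
    \<open>k \<le> 0 \<le> k + 1\<close>. To the left of all roots the counts are the sizes.\<close>
  obtain t0 where "count_above A t0 = 0" "count_above B t0 = 0" by (rule count_above_eventually_0)
  with r1[of t0] r2[of t0] have k0: "k = 0 \<or> k = -1" by auto
  obtain t1 where "count_above A t1 = size A" "count_above B t1 = size B"
    by (rule count_above_eventually_size)
  with r1[of t1] r2[of t1] have "k \<le> int (size B) - int (size A)" "int (size B) - int (size A) \<le> k + 1"
    by auto
  with k0 k2 r1 r2 show ?thesis by (intro exI[of _ k] conjI allI impI) simp_all
qed

subsection \<open>Interlacing\<close>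

lemma count_above_eq_size:
  assumes "\<And>x. x \<in># A \<Longrightarrow> t < x"
  shows "count_above A t = size A"
  unfolding count_above_def using assms by (metis filter_mset_True filter_mset_cong)

lemma count_above_less_size:
  assumes "count_above A t = size A" "x \<in># A"
  shows "t < x"
proof (rule ccontr)
  assume "\<not> t < x"
  then have "size (filter_mset (\<lambda>x. t < x) A) < size A"
    using assms(2) by (metis filter_mset_eq_conv mset_subset_size multiset_filter_subset subset_mset.le_neq_trans)
  then show False using assms(1) by (simp add: count_above_def)
qed

text \<open>In a sorted list the entries above \<open>t\<close> form a suffix, whose length is the
  count. This translates between positions and counts.\<close>

lemma nth_gt_iff_count_above:
  assumes "sorted xs" "i < length xs"
  shows "t < xs ! i \<longleftrightarrow> length xs - i \<le> count_above (mset xs) t"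
  using assms
proof (induction xs arbitrary: i)
  case (Cons x xs)
  have le: "count_above (mset xs) t \<le> length xs"
    unfolding count_above_def by (metis size_filter_mset_lesseq size_mset)
  show ?case
  proof (cases "t < x")
    case True
    with Cons.prems(1) have "\<forall>y\<in>set (x # xs). t < y" by auto
    then have "count_above (mset (x # xs)) t = length (x # xs)" "t < (x # xs) ! i"
      unfolding count_above_def using nth_mem[OF Cons.prems(2)]
      by (metis filter_True mset_filter size_mset, blast)
    then show ?thesis by simp
  next
    case False
    show ?thesis
    proof (cases i)
      case 0
      then show ?thesis using False le by simp
    next
      case (Suc j)
      then show ?thesis using Cons.IH[of j] Cons.prems False by simp
    qed
  qed
qed simp

lemma list_all2_le_if_count_above:
  assumes "sorted xs" "sorted ys" "length xs = length ys"
    and "\<And>t. count_above (mset xs) t \<le> count_above (mset ys) t"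
  shows "list_all2 (\<le>) xs ys"
  unfolding list_all2_conv_all_nth
proof (intro conjI allI impI)
  fix i assume i: "i < length xs"
  show "xs ! i \<le> ys ! i"
  proof (rule ccontr)
    assume "\<not> ?thesis"
    then have "length xs - i \<le> count_above (mset xs) (ys ! i)"
      using nth_gt_iff_count_above[OF assms(1) i, of "ys ! i"] by (simp add: not_le)
    with assms(3,4) have "length ys - i \<le> count_above (mset ys) (ys ! i)"
      by (metis order_trans)
    then show False using nth_gt_iff_count_above[OF assms(2), of i "ys ! i"] i assms(3) by simp
  qed
qed (use assms in simp)

text \<open>Interlacing in consecutive degrees, with the larger multiset having the outermost
  elements. The form by counts is the one that \<open>phase_difference\<close> yields, and it needs
  no ordering of the roots.\<close>

definition nests :: "real multiset \<Rightarrow> real multiset \<Rightarrow> bool" where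
  "nests A B \<longleftrightarrow> size B = Suc (size A) \<and>
     (\<forall>t. count_above A t \<le> count_above B t \<and> count_above B t \<le> Suc (count_above A t))"

lemma nests_add_mset: "nests A (add_mset x A)"
  by (auto simp: nests_def)

lemma nests_imp_vec_interlace:
  assumes s: "sorted xs" "sorted ys" and n: "nests (mset xs) (mset ys)"
  shows "vec_interlace xs ys"
proof -
  have len: "length ys = Suc (length xs)" using n by (simp add: nests_def)
  have ct: "count_above (mset xs) t \<le> count_above (mset ys) t"
    "count_above (mset ys) t \<le> Suc (count_above (mset xs) t)" for t
    using n by (auto simp: nests_def)
  have 1: "ys ! i \<le> xs ! i" if i: "i < length xs" for i
  proof (rule ccontr)
    assume "\<not> ?thesis"
    then have "length ys - i \<le> count_above (mset ys) (xs ! i)"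
      using nth_gt_iff_count_above[OF s(2), of i "xs ! i"] i len by simp
    then have "length xs - i \<le> count_above (mset xs) (xs ! i)"
      using ct(2)[of "xs ! i"] len i by linarith
    then show False using nth_gt_iff_count_above[OF s(1) i, of "xs ! i"] by simp
  qed
  have 2: "xs ! i \<le> ys ! Suc i" if i: "i < length xs" for i
  proof (rule ccontr)
    assume "\<not> ?thesis"
    then have "length xs - i \<le> count_above (mset xs) (ys ! Suc i)"
      using nth_gt_iff_count_above[OF s(1) i, of "ys ! Suc i"] by (simp add: not_le)
    then have "length ys - Suc i \<le> count_above (mset ys) (ys ! Suc i)"
      using ct(1)[of "ys ! Suc i"] len by linarith
    then show False using nth_gt_iff_count_above[OF s(2), of "Suc i" "ys ! Suc i"] i len by simp
  qed
  show ?thesis using len 1 2 by (auto simp: vec_interlace_def alternates_def)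
qed

lemma vec_interlace_Nil: "vec_interlace [] ys \<longleftrightarrow> (\<exists>y. ys = [y])"
  by (auto simp: vec_interlace_def alternates_def length_Suc_conv)

lemma vec_interlace_Cons:
  "vec_interlace (x # xs) (y # y' # ys) \<longleftrightarrow> y \<le> x \<and> x \<le> y' \<and> vec_interlace xs (y' # ys)"
proof
  assume v: "vec_interlace (x # xs) (y # y' # ys)"
  then have l: "length ys = length xs"
    and 1: "\<And>i. i < Suc (length xs) \<Longrightarrow> (y # y' # ys) ! i \<le> (x # xs) ! i"
    and 2: "\<And>i. Suc i < Suc (Suc (length ys)) \<Longrightarrow> (x # xs) ! i \<le> (y # y' # ys) ! Suc i"
    by (auto simp: vec_interlace_def alternates_def)
  show "y \<le> x \<and> x \<le> y' \<and> vec_interlace xs (y' # ys)"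
    using l 1[of 0] 2[of 0] 1[of "Suc _"] 2[of "Suc _"]
    by (auto simp: vec_interlace_def alternates_def)
next
  assume v: "y \<le> x \<and> x \<le> y' \<and> vec_interlace xs (y' # ys)"
  then show "vec_interlace (x # xs) (y # y' # ys)"
    by (auto simp: vec_interlace_def alternates_def nth_Cons split: nat.splits)
qed

text \<open>The difference telescopes in two ways: it is the argument from the first
  \<open>y\<close> plus the nonnegative terms from the pairs
  \<open>x\<^sub>i \<le> y\<^sub>i\<^sub>+\<^sub>1\<close>, and the argument from the last
  \<open>y\<close> minus those from the pairs \<open>y\<^sub>i \<le> x\<^sub>i\<close>.\<close>

lemma phase_vec_interlace:
  assumes "vec_interlace xs ys" "Im z > 0"
  shows "arg_from (hd ys) z \<le> phase (mset ys) z - phase (mset xs) z"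
    "phase (mset ys) z - phase (mset xs) z \<le> arg_from (last ys) z"
  using assms
proof (induction xs arbitrary: ys)
  case Nil
  { case 1 then show ?case by (auto simp: vec_interlace_Nil) }
  { case 2 then show ?case by (auto simp: vec_interlace_Nil) }
next
  case (Cons x xs)
  have *: "arg_from (hd ys) z \<le> phase (mset ys) z - phase (mset (x # xs)) z \<and>
      phase (mset ys) z - phase (mset (x # xs)) z \<le> arg_from (last ys) z"
    if v: "vec_interlace (x # xs) ys" for ys
  proof -
    from v have "length ys = Suc (Suc (length xs))" by (simp add: vec_interlace_def)
    then obtain y y' ys' where ys: "ys = y # y' # ys'" by (metis length_Suc_conv)
    from v have "y \<le> x" "x \<le> y'" and v': "vec_interlace xs (y' # ys')"
      by (auto simp: ys vec_interlace_Cons)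
    then have "arg_from y z \<le> arg_from x z" "arg_from x z \<le> arg_from y' z"
      using arg_from_mono[OF assms(2)] by auto
    with Cons.IH[OF v' assms(2)] show ?thesis by (simp add: ys)
  qed
  { case 1 then show ?case using * by blast }
  { case 2 then show ?case using * by blast }
qed

lemma vec_interlace_phase:
  assumes "vec_interlace xs ys" "Im z > 0"
  shows "0 < phase (mset ys) z - phase (mset xs) z" "phase (mset ys) z - phase (mset xs) z < pi"
  using phase_vec_interlace[OF assms] arg_from_bounds[OF assms(2), of "hd ys"]
    arg_from_bounds[OF assms(2), of "last ys"] by linarith+

lemma nests_phase:
  assumes "nests A B" "Im z > 0"
  shows "0 < phase B z - phase A z" "phase B z - phase A z < pi"
  using vec_interlace_phase[OF nests_imp_vec_interlace
      [of "sorted_list_of_multiset A" "sorted_list_of_multiset B"] assms(2)] assms(1)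
  by auto

text \<open>The phase difference lies in \<open>(0, \<pi>)\<close>, so the count inequalities come
  from \<open>phase_difference\<close>; the excess of one in length selects
  \<open>k = 0\<close>.\<close>

lemma vec_interlace_imp_nests:
  assumes "vec_interlace xs ys"
  shows "nests (mset xs) (mset ys)"
proof -
  have sn: "sin (phase (mset ys) z - phase (mset xs) z) \<noteq> 0" if "Im z > 0" for z
    using sin_gt_zero[OF vec_interlace_phase[OF assms that]] by simp
  obtain k :: int where k: "k = 0 \<or> k = -1"
    "\<forall>t. k \<le> int (count_above (mset ys) t) - int (count_above (mset xs) t) \<and>
      int (count_above (mset ys) t) - int (count_above (mset xs) t) \<le> k + 1"
    "int (size (mset ys)) - int (size (mset xs)) \<le> k + 1"
    using phase_difference[OF sn] by blast
  have len: "length ys = Suc (length xs)" using assms by (simp add: vec_interlace_def)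
  with k(1,3) have "k = 0" by auto
  have "count_above (mset xs) t \<le> count_above (mset ys) t \<and>
      count_above (mset ys) t \<le> Suc (count_above (mset xs) t)" for t
    using spec[OF k(2), of t] \<open>k = 0\<close> by linarith
  then show ?thesis using len by (simp add: nests_def)
qed

text \<open>\<open>Im (f(x + \<i>\<epsilon>) g(x - \<i>\<epsilon>))\<close> vanishes at
  \<open>\<epsilon> = 0\<close> and has the Wronskian as its derivative there. A positive derivative
  would make it positive for small \<open>\<epsilon> > 0\<close>, while the phases make it
  negative.\<close>

lemma nests_Wronskian:
  assumes "nests A B"
  shows "poly (pderiv (rpoly A) * rpoly B - rpoly A * pderiv (rpoly B)) x \<le> 0" (is "?W \<le> 0")
proof (rule ccontr)
  assume W: "\<not> ?W \<le> 0"
  let ?f = "rpoly A" and ?g = "rpoly B"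
  let ?u = "\<lambda>\<epsilon>. poly (cp ?f) (of_real x + \<i> * of_real \<epsilon>) * poly (cp ?g) (of_real x - \<i> * of_real \<epsilon>)"
  have "(?u has_vector_derivative
      (\<i> * poly (pderiv (cp ?f)) (of_real x) * poly (cp ?g) (of_real x)
       + poly (cp ?f) (of_real x) * (- \<i> * poly (pderiv (cp ?g)) (of_real x)))) (at 0)"
  proof -
    have lin: "((\<lambda>\<epsilon>. of_real x + \<i> * of_real \<epsilon>) has_vector_derivative \<i>) (at 0)"
      "((\<lambda>\<epsilon>. of_real x - \<i> * of_real \<epsilon>) has_vector_derivative - \<i>) (at 0)"
      unfolding has_vector_derivative_def
      by (auto intro!: derivative_eq_intros simp: scaleR_conv_of_real)
    have 1: "((\<lambda>\<epsilon>. poly (cp ?f) (of_real x + \<i> * of_real \<epsilon>)) has_vector_derivative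
        \<i> * poly (pderiv (cp ?f)) (of_real x)) (at 0)"
      using field_vector_diff_chain_at[of "\<lambda>\<epsilon>. of_real x + \<i> * of_real \<epsilon>" \<i> 0 "poly (cp ?f)"
          "poly (pderiv (cp ?f)) (of_real x)"] poly_DERIV[of "cp ?f" "of_real x"] lin(1)
      by (simp add: o_def)
    have 2: "((\<lambda>\<epsilon>. poly (cp ?g) (of_real x - \<i> * of_real \<epsilon>)) has_vector_derivative
        - \<i> * poly (pderiv (cp ?g)) (of_real x)) (at 0)"
      using field_vector_diff_chain_at[of "\<lambda>\<epsilon>. of_real x - \<i> * of_real \<epsilon>" "- \<i>" 0 "poly (cp ?g)"
          "poly (pderiv (cp ?g)) (of_real x)"] poly_DERIV[of "cp ?g" "of_real x"] lin(2)
      by (simp add: o_def)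
    show ?thesis
      using has_vector_derivative_mult[OF 1 2] by (simp add: add.commute)
  qed
  then have "((\<lambda>\<epsilon>. Im (?u \<epsilon>)) has_real_derivative
      Im (\<i> * poly (pderiv (cp ?f)) (of_real x) * poly (cp ?g) (of_real x)
       + poly (cp ?f) (of_real x) * (- \<i> * poly (pderiv (cp ?g)) (of_real x)))) (at 0)"
    unfolding has_real_derivative_iff_has_vector_derivative
    by (rule bounded_linear.has_vector_derivative[OF bounded_linear_Im])
  moreover have "Im (\<i> * poly (pderiv (cp ?f)) (of_real x) * poly (cp ?g) (of_real x)
       + poly (cp ?f) (of_real x) * (- \<i> * poly (pderiv (cp ?g)) (of_real x))) = ?W"
    by (simp flip: cp_pderiv)
  ultimately have d: "((\<lambda>\<epsilon>. Im (?u \<epsilon>)) has_real_derivative ?W) (at 0)" by simp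
  obtain e where e: "e > 0" "\<And>h. h > 0 \<Longrightarrow> h < e \<Longrightarrow> Im (?u 0) < Im (?u (0 + h))"
    using DERIV_pos_inc_right[OF d] W by auto
  have pos: "Im (?u (e / 2)) > 0"
    using e(2)[of "e / 2"] e(1) by simp
  let ?z = "Complex x (e / 2)"
  have z: "Im ?z > 0" using e by simp
  have "cnj (poly (cp ?g) ?z) = poly (cp ?g) (cnj ?z)" by (rule poly_cp_cnj[symmetric])
  then have "Im (?u (e / 2)) = Im (poly (cp ?f) ?z * cnj (poly (cp ?g) ?z))"
    by (simp add: Complex_eq)
  also obtain \<rho> where "\<rho> > 0" "Im (poly (cp ?f) ?z * cnj (poly (cp ?g) ?z)) = \<rho> * sin (phase A ?z - phase B ?z)"
    using Im_rpoly_mult_cnj[OF z] by metis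
  moreover have "sin (phase B ?z - phase A ?z) > 0"
    using nests_phase[OF assms z] by (intro sin_gt_zero)
  then have "sin (phase A ?z - phase B ?z) < 0"
    using sin_minus[of "phase B ?z - phase A ?z"] by simp
  ultimately have "Im (?u (e / 2)) < 0" by (simp add: mult_pos_neg)
  with pos show False by simp
qed

subsection \<open>Pencils of real-rooted polynomials\<close>

text \<open>The zero combination is allowed, since \<open>T\<close> may annihilate members of a
  pencil or make them dependent.\<close>

definition pencil :: "real poly \<Rightarrow> real poly \<Rightarrow> bool" where
  "pencil u v \<longleftrightarrow> (\<forall>a b. smult a u + smult b v = 0 \<or> hyperbolic (smult a u + smult b v))"

lemma pencilD: "pencil u v \<Longrightarrow> smult a u + smult b v \<noteq> 0 \<Longrightarrow> hyperbolic (smult a u + smult b v)"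
  by (auto simp: pencil_def)

lemma pencil_hyperbolic:
  assumes "pencil u v"
  shows "u \<noteq> 0 \<Longrightarrow> hyperbolic u" "v \<noteq> 0 \<Longrightarrow> hyperbolic v"
  using pencilD[OF assms, of 1 0] pencilD[OF assms, of 0 1] by auto

lemma pencil_smult: "pencil u v \<Longrightarrow> pencil (smult c u) (smult d v)"
  by (auto simp: pencil_def)

text \<open>At a common nonreal zero of a combination, \<open>f(z)\<close> and \<open>g(z)\<close>
  would be proportional over the reals, so \<open>Im (g(z) * cnj (f(z)))\<close> would vanish; the
  phase difference in \<open>(0, \<pi>)\<close> makes it positive.\<close>

lemma nests_imp_pencil:
  assumes "nests A B"
  shows "pencil (rpoly A) (rpoly B)"
  unfolding pencil_def
proof (intro allI)
  fix a b :: real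
  let ?h = "smult a (rpoly A) + smult b (rpoly B)"
  have nz: "poly (cp ?h) z \<noteq> 0" if z: "Im z > 0" and ab: "a \<noteq> 0 \<or> b \<noteq> 0" for z
  proof
    assume h0: "poly (cp ?h) z = 0"
    let ?f = "poly (cp (rpoly A)) z" and ?g = "poly (cp (rpoly B)) z"
    have f0: "?f \<noteq> 0" using z by (auto simp: cp_rpoly)
    have e: "of_real a * ?f + of_real b * ?g = 0" using h0 by (simp add: cp_add cp_smult)
    have "b \<noteq> 0" using e f0 ab by auto
    obtain \<rho> where \<rho>: "\<rho> > 0" "Im (?g * cnj ?f) = \<rho> * sin (phase B z - phase A z)"
      using Im_rpoly_mult_cnj[OF z] by metis
    have "sin (phase B z - phase A z) > 0" using nests_phase[OF assms z] by (intro sin_gt_zero)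
    then have pos: "Im (?g * cnj ?f) > 0" using \<rho> by simp
    have "of_real b * ?g = - (of_real a * ?f)" using e by (simp add: eq_neg_iff_add_eq_0 add.commute)
    then have "of_real b * (?g * cnj ?f) = - (of_real a * (?f * cnj ?f))"
      by (metis mult.assoc mult_minus_left)
    also have "\<dots> = of_real (- a * ((Re ?f)\<^sup>2 + (Im ?f)\<^sup>2))"
      by (simp only: complex_mult_cnj) simp
    finally have "Im (of_real b * (?g * cnj ?f)) = 0"
      by (simp only: Im_complex_of_real)
    moreover have "Im (of_real b * w) = b * Im w" for w by simp
    ultimately have "b * Im (?g * cnj ?f) = 0" by metis
    then show False using pos \<open>b \<noteq> 0\<close> by simp
  qed
  show "?h = 0 \<or> hyperbolic ?h"
  proof (cases "a = 0 \<and> b = 0")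
    case False
    then have "?h \<noteq> 0" using nz[of \<i>] by fastforce
    with False nz show ?thesis by (auto simp: hyperbolic_upper_half)
  qed simp
qed

text \<open>A vanishing sine means \<open>g(z) = s f(z)\<close> with \<open>s\<close> real. Then
  \<open>g - s f\<close> is a member of the pencil with a nonreal zero, hence \<open>0\<close>, and
  \<open>f\<close> and \<open>g\<close> have the same roots.\<close>

lemma pencil_sin_nonzero:
  assumes "pencil (rpoly A) (rpoly B)" "A \<noteq> B" and z: "Im z > 0"
  shows "sin (phase B z - phase A z) \<noteq> 0"
proof
  assume s0: "sin (phase B z - phase A z) = 0"
  let ?f = "poly (cp (rpoly A)) z" and ?g = "poly (cp (rpoly B)) z"
  have f0: "?f \<noteq> 0" using z by (auto simp: cp_rpoly)
  obtain \<rho> where "Im (?g * cnj ?f) = \<rho> * sin (phase B z - phase A z)"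
    using Im_rpoly_mult_cnj[OF z] by blast
  then have "Im (?g * cnj ?f) = 0" unfolding s0 by simp
  then have "Im (?g / ?f) = 0"
    unfolding complex_div_cnj[of ?g ?f] of_real_power[symmetric] Im_divide_of_real by simp
  then have s: "?g / ?f = of_real (Re (?g / ?f))" by (simp add: complex_eq_iff)
  define s where "s = Re (?g / ?f)"
  have s: "?g = of_real s * ?f" using s f0 unfolding s_def[symmetric] by (simp add: field_simps)
  let ?h = "smult (- s) (rpoly A) + smult 1 (rpoly B)"
  have "poly (cp ?h) z = 0" by (simp add: cp_diff cp_smult s)
  then have "\<not> hyperbolic ?h" using z by (auto simp: hyperbolic_upper_half)
  then have "?h = 0" using pencilD[OF assms(1)] by blast
  then have e: "rpoly B = smult s (rpoly A)" by simp
  then have "s \<noteq> 0" by auto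
  then have "proots (rpoly B) = proots (rpoly A)" using e by simp
  then show False using assms(2) by simp
qed

lemma hyperbolicE:
  assumes "hyperbolic p"
  obtains c where "c \<noteq> 0" "p = smult c (rpoly (proots p))" "rpoly (proots p) = smult (inverse c) p"
proof -
  obtain c A where cA: "c \<noteq> 0" "p = smult c (rpoly A)"
    using hyperbolic_factor[OF assms] hyperbolic_nonzero[OF assms] leading_coeff_0_iff by metis
  then show ?thesis using that[of c] by simp
qed

lemma pencil_rpoly_proots:
  assumes "pencil u v" "u \<noteq> 0" "v \<noteq> 0"
  shows "pencil (rpoly (proots u)) (rpoly (proots v))"
proof -
  obtain c d where c: "rpoly (proots u) = smult c u" and d: "rpoly (proots v) = smult d v"
    using hyperbolicE[OF pencil_hyperbolic(1)[OF assms(1,2)]]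
      hyperbolicE[OF pencil_hyperbolic(2)[OF assms(1,3)]] by metis
  show ?thesis unfolding c d by (rule pencil_smult[OF assms(1)])
qed

lemma pencil_difference:
  assumes p: "pencil u v" and nz: "u \<noteq> 0" "v \<noteq> 0" "proots u \<noteq> proots v"
  shows "\<exists>k::int. (k = 0 \<or> k = -1) \<and>
    (\<forall>z. Im z > 0 \<longrightarrow> k * pi < phase (proots v) z - phase (proots u) z \<and>
      phase (proots v) z - phase (proots u) z < (k + 1) * pi) \<and>
    (\<forall>t. k \<le> int (count_above (proots v) t) - int (count_above (proots u) t) \<and>
      int (count_above (proots v) t) - int (count_above (proots u) t) \<le> k + 1) \<and>
    k \<le> int (degree v) - int (degree u) \<and> int (degree v) - int (degree u) \<le> k + 1"
proof -
  have sz: "size (proots u) = degree u" "size (proots v) = degree v"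
    using pencil_hyperbolic[OF p] nz by (auto simp: size_proots_hyperbolic)
  have "sin (phase (proots v) z - phase (proots u) z) \<noteq> 0" if "Im z > 0" for z
    by (rule pencil_sin_nonzero[OF pencil_rpoly_proots[OF p nz(1,2)] nz(3) that])
  from phase_difference[OF this] show ?thesis unfolding sz .
qed

lemma pencil_degree_le:
  assumes p: "pencil u v" and nz: "u \<noteq> 0" "v \<noteq> 0"
  shows "degree v \<le> Suc (degree u)"
proof (cases "proots u = proots v")
  case True
  then show ?thesis using pencil_hyperbolic[OF p] nz size_proots_hyperbolic by (metis le_SucI order_refl)
next
  case False
  then obtain k :: int where "k = 0 \<or> k = -1" "int (degree v) - int (degree u) \<le> k + 1"
    using pencil_difference[OF p nz] by blast
  then show ?thesis by linarith
qed

lemma pencil_nests: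
  assumes p: "pencil u v" and nz: "u \<noteq> 0" and d: "degree v = Suc (degree u)"
  shows "nests (proots u) (proots v)"
proof -
  have nz': "v \<noteq> 0" using d by auto
  have sz: "size (proots u) = degree u" "size (proots v) = degree v"
    using pencil_hyperbolic[OF p] nz nz' by (auto simp: size_proots_hyperbolic)
  have ne: "proots u \<noteq> proots v" using sz d by auto
  obtain k :: int where k: "k = 0 \<or> k = -1"
    "\<forall>t. k \<le> int (count_above (proots v) t) - int (count_above (proots u) t) \<and>
      int (count_above (proots v) t) - int (count_above (proots u) t) \<le> k + 1"
    "int (degree v) - int (degree u) \<le> k + 1"
    using pencil_difference[OF p nz nz' ne] by blast
  then have "k = 0" using d by linarith
  have "count_above (proots u) t \<le> count_above (proots v) t \<and>
      count_above (proots v) t \<le> Suc (count_above (proots u) t)" for t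
    using spec[OF k(2), of t] \<open>k = 0\<close> by linarith
  then show ?thesis using sz d by (simp add: nests_def)
qed

text \<open>The jump of the count at \<open>t\<close> is the multiplicity of \<open>t\<close>; one
  point \<open>s\<close> serves both multisets.\<close>

lemma count_above_left_limit:
  obtains s where "count_above A s = count_above A t + count A t"
    "count_above B s = count_above B t + count B t"
proof -
  define m where "m = Max (insert (t - 1) {x \<in> set_mset (A + B). x < t})"
  have m1: "m < t" unfolding m_def by (subst Max_less_iff) auto
  have m2: "x \<le> m" if "x \<in># A + B" "x < t" for x
    unfolding m_def using that by (intro Max_ge) auto
  have c: "count_above C m = count_above C t + count C t" if "C \<subseteq># A + B" for C
  proof -
    have *: "m < x \<longleftrightarrow> t < x \<or> x = t" if "x \<in># C" for x
      using m2[OF mset_subset_eqD[OF \<open>C \<subseteq># A + B\<close> that]] m1 by linarith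
    have "filter_mset (\<lambda>x. m < x) C = filter_mset (\<lambda>x. t < x) C + filter_mset (\<lambda>x. x = t) C"
      by (rule multiset_eqI) (use * in \<open>auto simp: not_in_iff[symmetric]\<close>)
    then show ?thesis by (simp add: count_above_def filter_eq_replicate_mset)
  qed
  from c[of A] c[of B] show ?thesis using that[of m] by simp
qed

text \<open>The difference of the counts takes only the values \<open>k\<close> and
  \<open>k + 1\<close> on both sides of \<open>t\<close>, so the jumps at \<open>t\<close>, which
  are the multiplicities, differ by at most one.\<close>

lemma pencil_order_le:
  assumes p: "pencil u v" and nz: "u \<noteq> 0" "v \<noteq> 0"
  shows "order t v \<le> Suc (order t u)"
proof (cases "proots u = proots v")
  case True
  then show ?thesis using nz by (metis count_proots le_SucI order_refl)
next
  case False
  obtain k :: int where k: "k = 0 \<or> k = -1"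
    "\<forall>t. k \<le> int (count_above (proots v) t) - int (count_above (proots u) t) \<and>
      int (count_above (proots v) t) - int (count_above (proots u) t) \<le> k + 1"
    "int (degree v) - int (degree u) \<le> k + 1"
    using pencil_difference[OF p nz False] by blast
  obtain s where "count_above (proots u) s = count_above (proots u) t + order t u"
    "count_above (proots v) s = count_above (proots v) t + order t v"
    using count_above_left_limit[of "proots u" t "proots v"] nz by (metis count_proots)
  with spec[OF k(2), of s] spec[OF k(2), of t] show ?thesis by linarith
qed

section \<open>The logarithmic derivative and the Hermite--Poulain theorem\<close>

lemma poly_pderiv_rpoly:
  fixes z :: "'a::field"
  shows "z \<notin># A \<Longrightarrow> poly (pderiv (rpoly A)) z = (\<Sum>x\<in>#A. 1 / (z - x)) * poly (rpoly A) z"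
proof (induction A)
  case (add x A)
  then have nz: "z - x \<noteq> 0" by auto
  have "pderiv (rpoly (add_mset x A)) = rpoly A + [:- x, 1:] * pderiv (rpoly A)"
    by (simp only: rpoly_add_mset pderiv_mult) (simp add: pderiv_pCons)
  moreover have "poly (pderiv (rpoly A)) z = (\<Sum>x\<in>#A. 1 / (z - x)) * poly (rpoly A) z"
    using add by simp
  ultimately have "poly (pderiv (rpoly (add_mset x A))) z =
      poly (rpoly A) z + (z - x) * ((\<Sum>x\<in>#A. 1 / (z - x)) * poly (rpoly A) z)"
    by (simp only: poly_add poly_mult) simp
  also have "\<dots> = (\<Sum>x\<in>#add_mset x A. 1 / (z - x)) * ((z - x) * poly (rpoly A) z)"
    using nz by (simp add: field_simps)
  also have "(z - x) * poly (rpoly A) z = poly (rpoly (add_mset x A)) z"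
    by (simp only: poly_rpoly image_mset_add_mset prod_mset.add_mset)
  finally show ?case .
qed simp

lemma Im_sum_inverse_neg:
  assumes "Im z > 0" "A \<noteq> {#}"
  shows "Im (\<Sum>x\<in>#image_mset of_real A. 1 / (z - x)) < 0"
  using assms(2)
proof (induction A rule: multiset_induct)
  case (add x A)
  have "Im (1 / (z - of_real x)) < 0"
    using assms(1) by (auto simp: Im_divide divide_less_0_iff sum_power2_gt_zero_iff)
  with add show ?case by (cases "A = {#}") auto
qed simp

text \<open>In the upper half plane \<open>u' / u\<close> is a sum of terms
  \<open>1 / (z - x)\<close> with negative imaginary part, so it cannot equal the real number
  \<alpha>.\<close>

lemma Hermite_Poulain:
  assumes "hyperbolic u"
  shows "pderiv u - smult \<alpha> u = 0 \<or> hyperbolic (pderiv u - smult \<alpha> u)"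
proof -
  define c A where "c = lead_coeff u" and "A = proots u"
  have u: "u = smult c (rpoly A)" unfolding c_def A_def by (rule hyperbolic_factor[OF assms])
  have c0: "c \<noteq> 0" using assms by (simp add: c_def hyperbolic_nonzero)
  show ?thesis
  proof (cases "A = {#}")
    case True
    then have "u = [:c:]" by (simp add: u)
    then have "pderiv u - smult \<alpha> u = smult (- \<alpha>) u" by (simp add: smult_minus_left)
    then show ?thesis using assms hyperbolic_smult_iff[of "- \<alpha>" u] by (metis neg_equal_0_iff_equal smult_0_left)
  next
    case False
    have "poly (cp (pderiv u - smult \<alpha> u)) z \<noteq> 0" if z: "Im z > 0" for z
    proof -
      define s where "s = (\<Sum>x\<in>#image_mset of_real A. 1 / (z - x))"
      have "z \<notin># image_mset of_real A" using z by auto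
      then have s: "poly (cp (pderiv (rpoly A))) z = s * poly (cp (rpoly A)) z" "Im s < 0"
        using Im_sum_inverse_neg[OF z False] by (auto simp: s_def cp_pderiv cp_rpoly poly_pderiv_rpoly)
      have "poly (cp (pderiv u - smult \<alpha> u)) z = of_real c * (s - of_real \<alpha>) * poly (cp (rpoly A)) z"
        by (simp add: u cp_diff cp_smult pderiv_smult s(1) algebra_simps)
      moreover have "s - of_real \<alpha> \<noteq> 0" using s(2) by (auto simp: complex_eq_iff)
      moreover have "poly (cp (rpoly A)) z \<noteq> 0" using z by (auto simp: cp_rpoly)
      ultimately show ?thesis using c0 by simp
    qed
    then show ?thesis by (auto simp: hyperbolic_upper_half)
  qed
qed

subsection \<open>The symbol of a hyperbolicity preserver\<close>

text \<open>The falling factorial. Truncated subtraction yields a factor \<open>0\<close> once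
  \<open>m < k\<close>, as differentiating a power too often requires.\<close>

definition falling :: "nat \<Rightarrow> nat \<Rightarrow> nat" where
  "falling m k = (\<Prod>i<k. m - i)"

lemma falling_pos: "k \<le> m \<Longrightarrow> falling m k > 0"
  by (auto simp: falling_def)

lemma falling_eq_0: "m < k \<Longrightarrow> falling m k = 0"
  unfolding falling_def by (intro prod_zero) auto

lemma falling_0 [simp]: "falling m 0 = 1"
  by (simp add: falling_def)

lemma higher_pderiv_linear_power:
  "(pderiv ^^ k) ([:- c, 1:] ^ m) = smult (of_nat (falling m k)) ([:- c :: 'a::idom, 1:] ^ (m - k))"
  by (induction k) (simp_all add: falling_def pderiv_smult pderiv_power pderiv_pCons mult.commute)

lemma falling_div_power_tendsto: "(\<lambda>m. real (falling m k) / real m ^ k) \<longlonglongrightarrow> 1"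
proof -
  have "(\<lambda>m. \<Prod>i<k. real (m - i) / real m) \<longlonglongrightarrow> (\<Prod>i<k. 1)"
  proof (rule tendsto_prod)
    fix i
    have "(\<lambda>m. 1 - real i / real m) \<longlonglongrightarrow> 1 - 0"
      by (intro tendsto_intros lim_const_over_n)
    moreover have "eventually (\<lambda>m. 1 - real i / real m = real (m - i) / real m) sequentially"
      using eventually_gt_at_top[of i] by eventually_elim (simp add: of_nat_diff diff_divide_distrib)
    ultimately show "(\<lambda>m. real (m - i) / real m) \<longlonglongrightarrow> 1"
      by (auto elim: Lim_transform_eventually)
  qed
  then show ?thesis by (simp add: falling_def prod_dividef)
qed

lemma falling_div_power_tendsto':
  assumes "k \<le> N"
  shows "(\<lambda>m. real (falling m k) / real m ^ N) \<longlonglongrightarrow> (if k = N then 1 else 0)"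
proof -
  have "(\<lambda>m. real (falling m k) / real m ^ k * (1 / real m) ^ (N - k)) \<longlonglongrightarrow> 1 * 0 ^ (N - k)"
    by (intro tendsto_mult falling_div_power_tendsto tendsto_power lim_1_over_n)
  moreover have "real (falling m k) / real m ^ k * (1 / real m) ^ (N - k) = real (falling m k) / real m ^ N" for m
    using assms by (simp add: power_divide power_add[symmetric])
  moreover have "1 * 0 ^ (N - k) = (if k = N then 1 else (0::real))"
    using assms by (auto simp: power_0_left)
  ultimately show ?thesis by (simp only:)
qed

lemma smult_sum_right: "smult c (sum f A) = (\<Sum>x\<in>A. smult c (f x))"
  by (induction A rule: infinite_finite_induct) (simp_all add: smult_add_right)

lemma diff_op_add: "diff_op Q M N (f + g) = diff_op Q M N f + diff_op Q M N g"
  by (simp add: diff_op_def higher_pderiv_add distrib_left sum.distrib)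

lemma diff_op_smult: "diff_op Q M N (smult c f) = smult c (diff_op Q M N f)"
  by (simp add: diff_op_def higher_pderiv_smult smult_sum_right)

lemma diff_op_minus: "diff_op Q M N (- f) = - diff_op Q M N f"
  using diff_op_smult[of Q M N "-1" f] by simp

lemma diff_op_diff: "diff_op Q M N (f - g) = diff_op Q M N f - diff_op Q M N g"
  using diff_op_add[of Q M N f "- g"] by (simp add: diff_op_minus)

lemma diff_op_0 [simp]: "diff_op Q M N 0 = 0"
  by (simp add: diff_op_def)

definition cdiff_op :: "(nat \<Rightarrow> real poly) \<Rightarrow> nat \<Rightarrow> complex poly \<Rightarrow> complex poly" where
  "cdiff_op Q N f = (\<Sum>k=0..N. cp (Q k) * (pderiv ^^ k) f)"

lemma cp_diff_op: "cp (diff_op Q 0 N f) = cdiff_op Q N (cp f)"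
  by (simp add: diff_op_def cdiff_op_def cp_sum cp_mult cp_higher_pderiv)

lemma cdiff_op_add: "cdiff_op Q N (f + g) = cdiff_op Q N f + cdiff_op Q N g"
  by (simp add: cdiff_op_def higher_pderiv_add distrib_left sum.distrib)

lemma cdiff_op_smult: "cdiff_op Q N (smult c f) = smult c (cdiff_op Q N f)"
  by (simp add: cdiff_op_def higher_pderiv_smult smult_sum_right)

lemma diff_op_linear_power:
  "diff_op Q M N ([:- c, 1:] ^ m) = (\<Sum>k=M..N. smult (of_nat (falling m k)) (Q k * [:- c, 1:] ^ (m - k)))"
  by (simp add: diff_op_def higher_pderiv_linear_power)

lemma cdiff_op_linear_power:
  "cdiff_op Q N ([:- c, 1:] ^ m) = (\<Sum>k=0..N. smult (of_nat (falling m k)) (cp (Q k) * [:- c, 1:] ^ (m - k)))"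
  by (simp add: cdiff_op_def higher_pderiv_linear_power)

lemma cdiff_op_linear_power_factor:
  assumes "N \<le> m"
  shows "cdiff_op Q N ([:- c, 1:] ^ m) = [:- c, 1:] ^ (m - N) *
    (\<Sum>k=0..N. smult (of_nat (falling m k)) (cp (Q k) * [:- c, 1:] ^ (N - k)))"
  unfolding cdiff_op_linear_power sum_distrib_left
proof (rule sum.cong)
  fix k assume "k \<in> {0..N}"
  then have "[:- c, 1:] ^ (m - k) = [:- c, 1:] ^ (m - N) * [:- c, 1:] ^ (N - k)"
    using assms by (simp flip: power_add)
  then show "smult (of_nat (falling m k)) (cp (Q k) * [:- c, 1:] ^ (m - k)) =
      [:- c, 1:] ^ (m - N) * smult (of_nat (falling m k)) (cp (Q k) * [:- c, 1:] ^ (N - k))"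
    by (simp only: mult_smult_right ac_simps)
qed simp

lemma poly_cdiff_op_linear_power:
  "poly (cdiff_op Q N ([:- c, 1:] ^ m)) x = (\<Sum>k=0..N. of_nat (falling m k) * poly (cp (Q k)) x * (x - c) ^ (m - k))"
  by (simp add: cdiff_op_linear_power poly_sum mult.assoc)

lemma degree_sum_smult_mult_le:
  fixes p q :: "nat \<Rightarrow> 'a::idom poly"
  assumes "\<And>k. k \<le> N \<Longrightarrow> degree (p k) \<le> D" "\<And>k. degree (q k) \<le> N"
  shows "degree (\<Sum>k=0..N. smult (a k) (p k * q k)) \<le> D + N"
proof (rule degree_sum_le)
  fix k assume "k \<in> {0..N}"
  then have "degree (p k * q k) \<le> D + N"
    using assms(1)[of k] assms(2)[of k] degree_mult_le[of "p k" "q k"] by simp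
  then show "degree (smult (a k) (p k * q k)) \<le> D + N"
    using degree_smult_le order_trans by blast
qed simp

text \<open>No condition on degrees is imposed, because the locale is also instantiated for the
  operators \<open>D^i T\<close>, whose order and Fuchs index change with \<open>i\<close>.\<close>

locale hyp_op =
  fixes Q :: "nat \<Rightarrow> real poly" and N :: nat
  assumes pres: "hyperbolicity_preserver (diff_op Q 0 N)" and QN: "Q N \<noteq> 0"
begin

abbreviation "T \<equiv> diff_op Q 0 N"

lemma T_hyperbolic: "hyperbolic f \<Longrightarrow> T f \<noteq> 0 \<Longrightarrow> hyperbolic (T f)"
  using pres by (auto simp: hyperbolicity_preserver_def)

lemma T_pencil: "pencil u v \<Longrightarrow> pencil (T u) (T v)"
  unfolding pencil_def by (metis T_hyperbolic diff_op_add diff_op_smult diff_op_0)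

text \<open>Up to a constant and a power of \<open>z\<close>, the image of \<open>z^m\<close> is
  \<open>P m\<close>, and \<open>P m\<close> tends to \<open>Q N\<close> since
  \<open>falling m k\<close> grows only like \<open>m^k\<close>.\<close>

lemma leading_hyperbolic: "hyperbolic (Q N)"
proof -
  define D where "D = Max (degree ` Q ` {0..N})"
  have D: "degree (Q k) \<le> D" if "k \<le> N" for k
    unfolding D_def using that by (intro Max_ge) auto
  define P where "P m = (\<Sum>k=0..N. smult (real (falling m k) / real m ^ N) (Q k * monom 1 (N - k)))" for m
  have z: "poly (cp (Q N)) z \<noteq> 0" if "Im z > 0" for z
  proof (rule Hurwitz_poly[where S = "{z. Im z > 0}" and P = "\<lambda>m. cp (P m)" and d = "D + N"])
    show "open {z. Im z > 0}" by (rule open_halfspace_Im_gt)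
    show "connected {z. Im z > 0}" by (intro convex_connected convex_halfspace_Im_gt)
    show "z \<in> {z. Im z > 0}" using that by simp
    show "cp (Q N) \<noteq> 0" using QN by simp
    show "degree (cp (P m)) \<le> D + N" for m
      unfolding P_def degree_cp
      by (rule degree_sum_smult_mult_le, erule D, rule order_trans[OF degree_monom_le], simp)
    show "(\<lambda>m. coeff (cp (P m)) i) \<longlonglongrightarrow> coeff (cp (Q N)) i" for i
    proof -
      have "(\<lambda>m. \<Sum>k=0..N. real (falling m k) / real m ^ N * coeff (Q k * monom 1 (N - k)) i) \<longlonglongrightarrow>
          (\<Sum>k=0..N. (if k = N then 1 else 0) * coeff (Q k * monom 1 (N - k)) i)"
        by (intro tendsto_sum tendsto_mult tendsto_const falling_div_power_tendsto') auto
      also have "(\<Sum>k=0..N. (if k = N then 1 else 0) * coeff (Q k * monom 1 (N - k)) i)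
          = (\<Sum>k=0..N. (if k = N then coeff (Q N) i else 0))"
        by (intro sum.cong) (auto simp: monom_0)
      also have "\<dots> = coeff (Q N) i" by simp
      finally have "(\<lambda>m. coeff (P m) i) \<longlonglongrightarrow> coeff (Q N) i"
        unfolding P_def by (simp add: coeff_sum)
      then show ?thesis unfolding coeff_cp by (rule tendsto_of_real)
    qed
    show "\<forall>\<^sub>F m in sequentially. cp (P m) = 0 \<or> (\<forall>z\<in>{z. Im z > 0}. poly (cp (P m)) z \<noteq> 0)"
      using eventually_gt_at_top[of N]
    proof eventually_elim
      case (elim m)
      have "T ([:- 0, 1:] ^ m) = smult (real m ^ N) (monom 1 (m - N) * P m)"
        unfolding diff_op_linear_power P_def sum_distrib_left smult_sum_right
      proof (rule sum.cong)
        fix k assume k: "k \<in> {0..N}"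
        then have "[:- 0, 1:] ^ (m - k) = monom (1::real) (m - N) * monom 1 (N - k)"
          using elim by (simp add: monom_altdef flip: power_add)
        then show "smult (real (falling m k)) (Q k * [:- 0, 1:] ^ (m - k)) =
          smult (real m ^ N) (monom 1 (m - N) * smult (real (falling m k) / real m ^ N) (Q k * monom 1 (N - k)))"
          using elim by (simp add: ac_simps)
      qed simp
      note TX = this
      have "hyperbolic ([:- 0, 1:] ^ m)"
        unfolding rpoly_replicate[symmetric] by simp
      note hyp = T_hyperbolic[OF this, unfolded TX]
      have "P m = 0 \<or> hyperbolic (P m)"
      proof (cases "P m = 0")
        case False
        then have "hyperbolic (smult (real m ^ N) (monom 1 (m - N) * P m))"
          using elim by (intro hyp) (simp add: monom_eq_0_iff)
        then have "hyperbolic (monom 1 (m - N) * P m)" by simp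
        then show ?thesis using hyperbolic_dvd dvd_triv_right by blast
      qed simp
      then show ?case by (auto simp: hyperbolic_upper_half)
    qed
  qed
  then show ?thesis using QN by (auto simp: hyperbolic_upper_half)
qed

text \<open>A zero satisfies \<open>|z - c| = |z - cnj c|\<close>, so it lies on the perpendicular
  bisector of \<open>c\<close> and \<open>cnj c\<close>, the real axis. The value at
  \<open>c\<close> shows that the combination is not \<open>0\<close>.\<close>

lemma real_combination:
  assumes c: "Im c \<noteq> 0" and m: "m > 0" and \<kappa>: "\<kappa> \<noteq> 0"
  obtains h where "hyperbolic h"
    "cp h = smult \<kappa> ([:- c, 1:] ^ m) + smult (cnj \<kappa>) ([:- cnj c, 1:] ^ m)"
proof -
  let ?\<phi> = "[:- c, 1:] ^ m"
  have cnj_eq: "[:- cnj c, 1:] ^ m = map_poly cnj ?\<phi>"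
    by (subst poly_eq_poly_eq_iff[symmetric], rule ext) simp
  define h where "h = map_poly (\<lambda>a. 2 * Re (\<kappa> * a)) ?\<phi>"
  have e: "cp h = smult \<kappa> ?\<phi> + smult (cnj \<kappa>) ([:- cnj c, 1:] ^ m)"
    unfolding cnj_eq h_def
    by (rule poly_eqI) (simp add: coeff_map_poly complex_eq_iff)
  have ev: "poly (cp h) z = \<kappa> * (z - c) ^ m + cnj \<kappa> * (z - cnj c) ^ m" for z
    by (simp add: e)
  have "c - cnj c \<noteq> 0" using c by (simp add: complex_eq_iff)
  then have "cnj \<kappa> * (c - cnj c) ^ m \<noteq> 0" using \<kappa> by simp
  then have "poly (cp h) c \<noteq> 0" unfolding ev using m by (simp add: power_0_left)
  then have h0: "h \<noteq> 0" by auto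
  have "z \<in> \<real>" if "poly (cp h) z = 0" for z
  proof -
    have "\<kappa> * (z - c) ^ m = - (cnj \<kappa> * (z - cnj c) ^ m)"
      using that by (simp add: ev eq_neg_iff_add_eq_0)
    then have "cmod (\<kappa> * (z - c) ^ m) = cmod (cnj \<kappa> * (z - cnj c) ^ m)"
      by (metis norm_minus_cancel)
    then have "cmod (z - c) ^ m = cmod (z - cnj c) ^ m"
      unfolding norm_mult norm_power complex_mod_cnj using \<kappa> by (metis mult_left_cancel norm_eq_zero)
    then have "cmod (z - c) = cmod (z - cnj c)"
      by (rule power_eq_imp_eq_base[OF _ norm_ge_zero norm_ge_zero m])
    then have "(cmod (z - c))\<^sup>2 = (cmod (z - cnj c))\<^sup>2" by simp
    then have "Im z * Im c = 0" unfolding cmod_power2 by (simp add: power2_eq_square algebra_simps)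
    then show ?thesis using c by (simp add: complex_is_Real_iff)
  qed
  then have "hyperbolic h" using h0 by (simp add: hyperbolic_def)
  then show ?thesis using e by (rule that)
qed

text \<open>For real \<open>x\<close> the numbers \<open>T((z - c)^m)(x)\<close> and \<open>T((z - cnj c)^m)(x)\<close> are conjugate. In the
  upper half plane their absolute values never agree, and at \<open>x = c\<close> the former vanishes since
  \<open>T\<close> has finite order; so the latter has no zero there.\<close>

lemma T_linear_power_nonzero:
  "\<exists>m0\<ge>N. \<forall>m\<ge>m0. \<forall>c x. Im x > 0 \<longrightarrow> Im c < 0 \<longrightarrow> poly (cdiff_op Q N ([:- c, 1:] ^ m)) x \<noteq> 0"
proof -
  define D where "D = Max (degree ` Q ` {0..N})"
  have D: "degree (Q k) \<le> D" if "k \<le> N" for k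
    unfolding D_def using that by (intro Max_ge) auto
  define R where "R m c = (\<Sum>k=0..N. smult (of_nat (falling m k)) (cp (Q k) * [:- c, 1:] ^ (N - k)))" for m c
  have degR: "degree (R m c) \<le> D + N" for m c
    unfolding R_def by (rule degree_sum_smult_mult_le) (simp_all add: D degree_power_eq)
  have Rc: "R m c \<noteq> 0" if "N \<le> m" "Im c \<noteq> 0" for m c
  proof
    assume "R m c = 0"
    then have "0 = poly (R m c) c" by simp
    also have "\<dots> = (\<Sum>k=0..N. if k = N then of_nat (falling m N) * poly (cp (Q N)) c else 0)"
      unfolding R_def poly_sum by (intro sum.cong) auto
    finally have "poly (cp (Q N)) c = 0" using falling_pos[OF that(1)] by simp
    then show False using leading_hyperbolic that(2) by (auto simp: hyperbolic_def complex_is_Real_iff)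
  qed
  \<comment> \<open>The bound on \<open>m\<close> gives
    \<open>m - N > D + N \<ge> degree (R m c)\<close>, so the factor \<open>R m c\<close> cannot
    absorb the power \<open>m - N\<close> of the other linear factor.\<close>
  have main: "poly (cdiff_op Q N ([:- cnj c, 1:] ^ m)) x \<noteq> 0"
    if m: "m > D + 2 * N" and x: "Im x > 0" and c: "Im c > 0" for m c x
  proof -
    let ?F = "cdiff_op Q N ([:- c, 1:] ^ m)" and ?G = "cdiff_op Q N ([:- cnj c, 1:] ^ m)"
    have Ff: "?F = [:- c, 1:] ^ (m - N) * R m c" and Gf: "?G = [:- cnj c, 1:] ^ (m - N) * R m (cnj c)"
      unfolding R_def using m by (intro cdiff_op_linear_power_factor; simp)+
    have ne: "cmod (poly ?F y) \<noteq> cmod (poly ?G y)" if y: "Im y > 0" for y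
    proof
      assume eq: "cmod (poly ?F y) = cmod (poly ?G y)"
      \<comment> \<open>If \<open>F(y) \<noteq> 0\<close>, equal absolute values make
        \<open>- G(y) / F(y)\<close> unimodular. A square root \<kappa> of it satisfies
        \<open>\<kappa>^2 F + G = 0\<close>, which is the claim after multiplication by
        \<open>cnj \<kappa>\<close>.\<close>
      obtain \<kappa> where \<kappa>: "\<kappa> \<noteq> 0" "\<kappa> * poly ?F y + cnj \<kappa> * poly ?G y = 0"
      proof (cases "poly ?F y = 0")
        case True
        then show ?thesis using that[of 1] eq by simp
      next
        case False
        define u where "u = - poly ?G y / poly ?F y"
        have u: "cmod u = 1" using False unfolding u_def norm_divide norm_minus_cancel eq[symmetric] by simp
        define \<kappa> where "\<kappa> = csqrt u"
        have k2: "\<kappa> * \<kappa> = u" by (metis \<kappa>_def power2_csqrt power2_eq_square)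
        then have "cmod \<kappa> * cmod \<kappa> = 1" using u by (metis norm_mult)
        then have "\<kappa> * cnj \<kappa> = 1" by (simp add: complex_norm_square[symmetric] power2_eq_square flip: of_real_mult)
        have k0: "\<kappa> \<noteq> 0" using \<open>\<kappa> * cnj \<kappa> = 1\<close> by auto
        have "\<kappa> * (\<kappa> * poly ?F y + cnj \<kappa> * poly ?G y) = (\<kappa> * \<kappa>) * poly ?F y + (\<kappa> * cnj \<kappa>) * poly ?G y"
          by (simp add: algebra_simps)
        also have "\<dots> = 0" unfolding k2 \<open>\<kappa> * cnj \<kappa> = 1\<close> using False by (simp add: u_def)
        finally show ?thesis using that[of \<kappa>] k0 by simp
      qed
      obtain h where h: "hyperbolic h"
        "cp h = smult \<kappa> ([:- c, 1:] ^ m) + smult (cnj \<kappa>) ([:- cnj c, 1:] ^ m)"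
        using real_combination[of c m \<kappa>] c m \<kappa>(1) by auto
      have Th: "cp (T h) = smult \<kappa> ?F + smult (cnj \<kappa>) ?G"
        by (simp add: cp_diff_op h(2) cdiff_op_add cdiff_op_smult)
      then have "poly (cp (T h)) y = 0" using \<kappa>(2) by simp
      then have "\<not> hyperbolic (T h)" using y by (auto simp: hyperbolic_upper_half)
      then have "T h = 0" using T_hyperbolic[OF h(1)] by blast
      \<comment> \<open>The case \<open>T h = 0\<close> remains: then \<open>F\<close> would be
        divisible by the high power of \<open>z - cnj c\<close> contained in
        \<open>G\<close>.\<close>
      then have "smult \<kappa> ?F = smult (- cnj \<kappa>) ?G" using Th by (simp add: eq_neg_iff_add_eq_0)
      then have "[:- cnj c, 1:] ^ (m - N) dvd smult \<kappa> ?F" unfolding Gf by (metis dvd_smult dvd_triv_left)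
      then have "[:- cnj c, 1:] ^ (m - N) dvd ?F" using \<kappa>(1) by (simp add: dvd_smult_iff)
      moreover have F0: "?F \<noteq> 0" unfolding Ff using Rc[of m c] m c by simp
      ultimately have "m - N \<le> order (cnj c) ?F" by (simp add: order_divides)
      also have "\<dots> = order (cnj c) ([:- c, 1:] ^ (m - N)) + order (cnj c) (R m c)"
        using F0 unfolding Ff by (rule order_mult)
      also have "order (cnj c) ([:- c, 1:] ^ (m - N)) = 0"
      proof (rule order_0I)
        have "cnj c \<noteq> c" using c by (auto simp: complex_eq_iff)
        then show "poly ([:- c, 1:] ^ (m - N)) (cnj c) \<noteq> 0" by simp
      qed
      also have "order (cnj c) (R m c) \<le> degree (R m c)"
        using Rc[of m c] m c by (intro order_degree) auto
      finally show False using degR[of m c] m by simp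
    qed
    let ?d = "\<lambda>y. cmod (poly ?F y) - cmod (poly ?G y)"
    have "connected (?d ` {y. Im y > 0})"
      by (intro connected_continuous_image continuous_intros convex_connected convex_halfspace_Im_gt)
    moreover have "0 \<notin> ?d ` {y. Im y > 0}" using ne by auto
    moreover have "?d c \<in> ?d ` {y. Im y > 0}" "?d x \<in> ?d ` {y. Im y > 0}" using c x by auto
    moreover have "poly ?F c = 0" unfolding Ff using m by simp
    then have "?d c \<le> 0" by simp
    ultimately have "\<not> 0 \<le> ?d x"
      using connected_contains_Icc[of "?d ` {y. Im y > 0}" "?d c" "?d x"] by (meson atLeastAtMost_iff subsetD)
    then show ?thesis by auto
  qed
  show ?thesis
  proof (intro exI[of _ "Suc (D + 2 * N)"] conjI allI impI)
    fix m c x assume "m \<ge> Suc (D + 2 * N)" "Im x > 0" "Im c < 0"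
    then show "poly (cdiff_op Q N ([:- c, 1:] ^ m)) x \<noteq> 0"
      using main[of m x "cnj c"] by simp
  qed simp
qed

definition symbol :: "complex \<Rightarrow> complex poly" where
  "symbol x = (\<Sum>k=0..N. monom (poly (cp (Q k)) x) k)"

lemma poly_symbol: "poly (symbol x) w = (\<Sum>k=0..N. poly (cp (Q k)) x * w ^ k)"
  by (simp add: symbol_def poly_sum poly_monom)

lemma coeff_symbol: "coeff (symbol x) k = (if k \<le> N then poly (cp (Q k)) x else 0)"
  by (auto simp: symbol_def coeff_sum)

lemma degree_symbol_le: "degree (symbol x) \<le> N"
  by (rule degree_le) (auto simp: coeff_symbol)

text \<open>With \<open>x - c = m / v\<close> the value of \<open>T((z - c)^m)\<close> at
  \<open>x\<close> is \<open>(m / v)^m P m (v)\<close>, and the \<open>P m\<close> tend to the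
  symbol at \<open>x\<close>. Hurwitz's theorem on a disc around \<open>w\<close> transfers the
  absence of zeros.\<close>

lemma symbol_stable:
  assumes x: "Im x > 0" and w: "Im w < 0"
  shows "poly (symbol x) w \<noteq> 0"
proof -
  obtain m0 where m0: "N \<le> m0"
    "\<forall>m\<ge>m0. \<forall>c x. Im x > 0 \<longrightarrow> Im c < 0 \<longrightarrow> poly (cdiff_op Q N ([:- c, 1:] ^ m)) x \<noteq> 0"
    using T_linear_power_nonzero by blast
  define P where "P m = (\<Sum>k=0..N. monom (of_real (real (falling m k) / real m ^ k) * poly (cp (Q k)) x) k)" for m
  define \<delta> where "\<delta> = - Im w / 2"
  define \<rho> where "\<rho> = cmod w + \<delta>"
  have \<delta>: "\<delta> > 0" using w by (simp add: \<delta>_def)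
  have \<rho>: "\<rho> > 0" using \<delta> by (simp add: \<rho>_def add_nonneg_pos)
  show ?thesis
  proof (rule Hurwitz_poly[where S = "ball w \<delta>" and P = P and d = N])
    show "w \<in> ball w \<delta>" using \<delta> by simp
    have "coeff (symbol x) N \<noteq> 0"
      using leading_hyperbolic x by (auto simp: coeff_symbol hyperbolic_upper_half)
    then show "symbol x \<noteq> 0" by auto
    have cP: "coeff (P m) i = (if i \<le> N then of_real (real (falling m i) / real m ^ i) * poly (cp (Q i)) x else 0)" for m i
      by (auto simp: P_def coeff_sum)
    show "degree (P m) \<le> N" for m
      by (rule degree_le) (auto simp: cP)
    show "(\<lambda>m. coeff (P m) i) \<longlonglongrightarrow> coeff (symbol x) i" for i
    proof (cases "i \<le> N")
      case True
      have "(\<lambda>m. of_real (real (falling m i) / real m ^ i) * poly (cp (Q i)) x) \<longlonglongrightarrow> of_real 1 * poly (cp (Q i)) x"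
        by (intro tendsto_mult tendsto_of_real falling_div_power_tendsto tendsto_const)
      then show ?thesis using True by (simp add: cP coeff_symbol)
    qed (simp add: cP coeff_symbol)
    \<comment> \<open>On the disc \<open>Im v < - \<delta>\<close> and
      \<open>|v| \<le> \<rho>\<close>, so \<open>Im (m / v) \<ge> m \<delta> / \<rho>^2\<close>.
      Beyond \<open>m1\<close> this exceeds \<open>Im x\<close> and puts
      \<open>c = x - m / v\<close> into the lower half plane.\<close>
    obtain m1 where m1: "real m1 > Im x * \<rho>\<^sup>2 / \<delta>" using reals_Archimedean2 by blast
    show "\<forall>\<^sub>F m in sequentially. P m = 0 \<or> (\<forall>v\<in>ball w \<delta>. poly (P m) v \<noteq> 0)"
      using eventually_ge_at_top[of "Suc (max m0 m1)"]
    proof eventually_elim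
      case (elim m)
      have "poly (P m) v \<noteq> 0" if v: "v \<in> ball w \<delta>" for v
      proof -
        have d: "cmod (w - v) < \<delta>" using v by (simp add: dist_norm)
        have "\<bar>Im (w - v)\<bar> < \<delta>" using d abs_Im_le_cmod[of "w - v"] by linarith
        then have iv: "Im v < - \<delta>" by (simp add: \<delta>_def)
        have cv: "cmod v \<le> \<rho>" using d norm_triangle_ineq2[of v w] by (simp add: \<rho>_def norm_minus_commute)
        have v0: "v \<noteq> 0" using iv \<delta> by auto
        define c where "c = x - of_nat m / v"
        have mpos: "m > 0" using elim by simp
        have "Im (of_nat m / v) = real m * (- Im v) / (cmod v)\<^sup>2"
          by (simp add: Im_divide cmod_power2)
        also have "\<dots> \<ge> real m * \<delta> / \<rho>\<^sup>2"
        proof (rule frac_le)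
          show "real m * \<delta> \<le> real m * (- Im v)" using iv by (intro mult_left_mono) auto
          show "0 \<le> real m * (- Im v)" using iv \<delta> by (intro mult_nonneg_nonneg) auto
        qed (use v0 cv in \<open>auto intro: power_mono\<close>)
        finally have "Im (of_nat m / v) \<ge> real m * \<delta> / \<rho>\<^sup>2" .
        moreover have "real m * \<delta> / \<rho>\<^sup>2 > Im x"
        proof -
          have "real m > Im x * \<rho>\<^sup>2 / \<delta>" using m1 elim by simp
          then show ?thesis using \<delta> \<rho> by (simp add: field_simps)
        qed
        ultimately have "Im c < 0" by (simp add: c_def)
        then have "poly (cdiff_op Q N ([:- c, 1:] ^ m)) x \<noteq> 0"
          using m0(2) x elim by simp
        moreover have "poly (cdiff_op Q N ([:- c, 1:] ^ m)) x = (of_nat m / v) ^ m * poly (P m) v"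
          unfolding poly_cdiff_op_linear_power P_def poly_sum sum_distrib_left
        proof (rule sum.cong)
          fix k assume "k \<in> {0..N}"
          then have km: "k \<le> m" using m0(1) elim by simp
          have "(of_nat m / v) ^ m = (of_nat m / v) ^ (m - k) * (of_nat m / v) ^ k"
            using km by (simp flip: power_add)
          then show "of_nat (falling m k) * poly (cp (Q k)) x * (x - c) ^ (m - k) = (of_nat m / v) ^ m *
              poly (monom (complex_of_real (real (falling m k) / real m ^ k) * poly (cp (Q k)) x) k) v"
            using v0 mpos by (simp add: c_def poly_monom power_divide field_simps)
        qed simp
        ultimately show ?thesis by auto
      qed
      then show ?case by blast
    qed
  qed auto
qed

text \<open>The real point \<theta> is approached from the upper half plane, where the symbols have
  no zeros \<open>w\<close> in the lower half plane.\<close>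

lemma symbol_real_hyperbolic:
  defines "P \<equiv> (\<lambda>\<theta>. \<Sum>k=0..N. monom (poly (Q k) \<theta>) k)"
  shows "P \<theta> = 0 \<or> hyperbolic (P \<theta>)"
proof (cases "P \<theta> = 0")
  case False
  have P_symb: "cp (P \<theta>) = symbol (of_real \<theta>)"
    by (rule poly_eqI) (auto simp: P_def coeff_symbol coeff_sum)
  have nz: "poly (symbol (of_real \<theta>)) w \<noteq> 0" if "Im w < 0" for w
  proof (rule Hurwitz_poly[where S = "{w. Im w < 0}" and d = N and
        P = "\<lambda>j. symbol (of_real \<theta> + \<i> * of_real (1 / real (Suc j)))"])
    show "open {w. Im w < 0}" by (rule open_halfspace_Im_lt)
    show "connected {w. Im w < 0}" by (intro convex_connected convex_halfspace_Im_lt)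
    show "w \<in> {w. Im w < 0}" using that by simp
    show "symbol (of_real \<theta>) \<noteq> 0" using False P_symb by (metis cp_eq_0_iff)
    show "degree (symbol (of_real \<theta> + \<i> * of_real (1 / real (Suc j)))) \<le> N" for j
      by (rule degree_symbol_le)
    show "(\<lambda>j. coeff (symbol (of_real \<theta> + \<i> * of_real (1 / real (Suc j)))) i) \<longlonglongrightarrow> coeff (symbol (of_real \<theta>)) i" for i
    proof -
      have "(\<lambda>j. complex_of_real \<theta> + \<i> * of_real (1 / real (Suc j))) \<longlonglongrightarrow> of_real \<theta> + \<i> * of_real 0"
        by (intro tendsto_intros LIMSEQ_Suc[OF lim_1_over_n])
      then have "(\<lambda>j. poly (cp (Q i)) (complex_of_real \<theta> + \<i> * of_real (1 / real (Suc j)))) \<longlonglongrightarrow> poly (cp (Q i)) (of_real \<theta> + \<i> * of_real 0)"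
        by (intro tendsto_poly)
      then show ?thesis by (simp add: coeff_symbol)
    qed
    show "\<forall>\<^sub>F j in sequentially. symbol (of_real \<theta> + \<i> * of_real (1 / real (Suc j))) = 0 \<or>
        (\<forall>w\<in>{w. Im w < 0}. poly (symbol (of_real \<theta> + \<i> * of_real (1 / real (Suc j)))) w \<noteq> 0)"
      by (intro always_eventually allI disjI2 ballI symbol_stable) auto
  qed
  have "poly (cp (P \<theta>)) w \<noteq> 0" if "Im w > 0" for w
  proof -
    have "poly (cp (P \<theta>)) (cnj w) \<noteq> 0" unfolding P_symb using nz[of "cnj w"] that by simp
    then show ?thesis by (metis complex_cnj_zero poly_cp_cnj)
  qed
  then show ?thesis using False by (auto simp: hyperbolic_upper_half)
qed simp

text \<open>The substitution \<open>x = S z\<close>, \<open>w = v / S\<close> with \<open>S\<close>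
  tending to infinity extracts the top homogeneous part \<open>z^r q(z w)\<close> of the symbol. It
  inherits stability, and every \<open>y\<close> outside the nonpositive reals is a product
  \<open>z w\<close> with \<open>Im z > 0 > Im w\<close>.\<close>

lemma leading_coeffs_zeros:
  fixes r :: nat
  defines "q \<equiv> \<Sum>k=0..N. monom (coeff (Q k) (k + r)) k"
  assumes deg: "\<And>k. k \<le> N \<Longrightarrow> degree (Q k) \<le> k + r" and qN: "coeff (Q N) (N + r) \<noteq> 0"
    and y: "poly (cp q) y = 0"
  shows "y \<in> \<real>\<^sub>\<le>\<^sub>0"
proof (rule ccontr)
  assume ny: "y \<notin> \<real>\<^sub>\<le>\<^sub>0"
  \<comment> \<open>The principal root has \<open>Re s > 0\<close>, so \<open>\<i> s\<close> and
    \<open>- \<i> s\<close> lie in the upper and the lower half plane; their product is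
    \<open>s^2 = y\<close>.\<close>
  define s where "s = csqrt y"
  have y0: "y \<noteq> 0" using ny by auto
  have ss: "s * s = y" by (metis s_def power2_csqrt power2_eq_square)
  have "Re s \<noteq> 0"
  proof
    assume "Re s = 0"
    then have "y = of_real (- ((Im s)\<^sup>2))" using ss by (simp add: complex_eq_iff power2_eq_square flip: ss)
    then show False using ny by (simp only: nonpos_Reals_of_real_iff) simp
  qed
  then have Res: "Re s > 0" using csqrt_principal[of y] s_def by auto
  define z w where "z = \<i> * s" and "w = - \<i> * s"
  have z: "Im z > 0" and w: "Im w < 0" and zw: "z * w = y"
    using Res ss by (auto simp: z_def w_def algebra_simps)
  have z0: "z \<noteq> 0" using z by auto
  define G where "G = (\<Sum>k=0..N. monom (of_real (coeff (Q k) (k + r)) * z ^ (k + r)) k)"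
  define P where "P j = (\<Sum>k=0..N. monom (poly (cp (Q k)) (of_nat (Suc j) * z) / of_nat (Suc j) ^ (k + r)) k)" for j
  have "poly G w \<noteq> 0"
  proof (rule Hurwitz_poly[where S = "{w. Im w < 0}" and d = N and P = P])
    show "open {w. Im w < 0}" by (rule open_halfspace_Im_lt)
    show "connected {w. Im w < 0}" by (intro convex_connected convex_halfspace_Im_lt)
    show "w \<in> {w. Im w < 0}" using w by simp
    have "coeff G N \<noteq> 0" using qN z0 by (simp add: G_def coeff_sum)
    then show "G \<noteq> 0" by auto
    have cP: "coeff (P j) i = (if i \<le> N then poly (cp (Q i)) (of_nat (Suc j) * z) / of_nat (Suc j) ^ (i + r) else 0)" for i j
      by (auto simp: P_def coeff_sum)
    have cG: "coeff G i = (if i \<le> N then of_real (coeff (Q i) (i + r)) * z ^ (i + r) else 0)" for i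
      by (auto simp: G_def coeff_sum)
    show "degree (P j) \<le> N" for j by (rule degree_le) (auto simp: cP)
    show "(\<lambda>j. coeff (P j) i) \<longlonglongrightarrow> coeff G i" for i
    proof (cases "i \<le> N")
      case True
      have e: "poly (cp (Q i)) (of_nat (Suc j) * z) / of_nat (Suc j) ^ (i + r)
          = (\<Sum>l\<le>i + r. of_real (coeff (Q i) l) * z ^ l * (1 / of_nat (Suc j)) ^ (i + r - l))" for j
      proof -
        have "poly (cp (Q i)) u = (\<Sum>l\<le>i + r. of_real (coeff (Q i) l) * u ^ l)" for u
          unfolding poly_altdef using deg[OF True]
          by (intro sum.mono_neutral_cong_left) (auto simp: coeff_eq_0)
        then have "poly (cp (Q i)) (of_nat (Suc j) * z) / of_nat (Suc j) ^ (i + r)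
           = (\<Sum>l\<le>i + r. of_real (coeff (Q i) l) * (of_nat (Suc j) * z) ^ l / of_nat (Suc j) ^ (i + r))"
          by (simp add: sum_divide_distrib)
        also have "\<dots> = (\<Sum>l\<le>i + r. of_real (coeff (Q i) l) * z ^ l * (1 / of_nat (Suc j)) ^ (i + r - l))"
        proof (rule sum.cong)
          fix l assume l: "l \<in> {..i + r}"
          define S :: complex where "S = of_nat (Suc j)"
          have S0: "S \<noteq> 0" unfolding S_def by (simp only: of_nat_eq_0_iff)
          have "S ^ (i + r) = S ^ l * S ^ (i + r - l)" using l by (simp flip: power_add)
          then show "of_real (coeff (Q i) l) * (of_nat (Suc j) * z) ^ l / of_nat (Suc j) ^ (i + r)
              = of_real (coeff (Q i) l) * z ^ l * (1 / of_nat (Suc j)) ^ (i + r - l)"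
            unfolding S_def[symmetric] using S0 by (simp add: power_mult_distrib power_divide)
        qed simp
        finally show ?thesis .
      qed
      have l1: "(\<lambda>j. 1 / of_nat (Suc j) :: complex) \<longlonglongrightarrow> 0"
        using LIMSEQ_Suc[OF lim_1_over_n[where 'a = complex]] by simp
      have "(\<lambda>j. \<Sum>l\<le>i + r. of_real (coeff (Q i) l) * z ^ l * (1 / of_nat (Suc j)) ^ (i + r - l))
          \<longlonglongrightarrow> (\<Sum>l\<le>i + r. of_real (coeff (Q i) l) * z ^ l * 0 ^ (i + r - l))"
        by (intro tendsto_sum tendsto_mult tendsto_const tendsto_power l1)
      also have "(\<Sum>l\<le>i + r. of_real (coeff (Q i) l) * z ^ l * 0 ^ (i + r - l))
          = (\<Sum>l\<le>i + r. if l = i + r then of_real (coeff (Q i) (i + r)) * z ^ (i + r) else 0)"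
        by (intro sum.cong) (auto simp: power_0_left)
      also have "\<dots> = of_real (coeff (Q i) (i + r)) * z ^ (i + r)" by simp
      finally show ?thesis using True by (simp only: cP cG e if_True)
    qed (simp add: cP cG)
    show "\<forall>\<^sub>F j in sequentially. P j = 0 \<or> (\<forall>v\<in>{w. Im w < 0}. poly (P j) v \<noteq> 0)"
    proof (intro always_eventually allI disjI2 ballI)
      fix j v assume v: "v \<in> {w. Im w < 0}"
      define S :: complex where "S = of_nat (Suc j)"
      have S0: "S \<noteq> 0" unfolding S_def by (simp only: of_nat_eq_0_iff)
      have S: "S = of_real (real (Suc j))" by (simp add: S_def)
      have "poly (symbol (S * z)) (v / S) \<noteq> 0"
      proof (rule symbol_stable)
        show "Im (S * z) > 0" unfolding S using z by simp
        have "Im (v / S) = Im v / real (Suc j)" unfolding S by (rule Im_divide_of_real)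
        then show "Im (v / S) < 0" using v by (simp add: divide_neg_pos)
      qed
      moreover have "poly (P j) v = poly (symbol (S * z)) (v / S) / S ^ r"
        unfolding P_def poly_symbol poly_sum sum_divide_distrib S_def[symmetric]
        by (intro sum.cong) (auto simp: poly_monom power_add power_divide field_simps)
      ultimately show "poly (P j) v \<noteq> 0" using S0 by simp
    qed
  qed
  moreover have "poly G w = z ^ r * poly (cp q) y"
    unfolding G_def q_def poly_sum cp_sum sum_distrib_left
    by (intro sum.cong) (auto simp: poly_monom map_poly_monom power_add power_mult_distrib zw[symmetric])
  ultimately show False using y by simp
qed

end

subsection \<open>Non-degenerate operators\<close>

lemma coeff_mult_top:
  fixes p q :: "'a::idom poly"
  assumes "degree p \<le> a" "degree q \<le> b"
  shows "coeff (p * q) (a + b) = coeff p a * coeff q b"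
proof (cases "degree p = a \<and> degree q = b")
  case True
  then show ?thesis using coeff_mult_degree_sum[of p q] by simp
next
  case False
  then have "degree p + degree q < a + b" using assms by auto
  then have "coeff (p * q) (a + b) = 0"
    using degree_mult_le[of p q] by (intro coeff_eq_0) simp
  moreover have "coeff p a = 0 \<or> coeff q b = 0"
    using False assms by (auto intro: coeff_eq_0)
  ultimately show ?thesis by auto
qed

lemma coeff_higher_pderiv_top:
  fixes f :: "real poly"
  shows "k \<le> n \<Longrightarrow> coeff ((pderiv ^^ k) f) (n - k) = falling n k * coeff f n"
proof (induction k)
  case (Suc k)
  then have "Suc (n - Suc k) = n - k" by simp
  then have "coeff ((pderiv ^^ Suc k) f) (n - Suc k) = real (n - k) * coeff ((pderiv ^^ k) f) (n - k)"
    by (simp add: coeff_pderiv)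
  also have "\<dots> = real (n - k) * (falling n k * coeff f n)" using Suc by simp
  finally show ?case by (simp add: falling_def)
qed simp

text \<open>A factor \<open>z - x\<close> with \<open>x < 0\<close> has two positive coefficients
  and extends the range of positive coefficients upwards by one; a factor \<open>z\<close> shifts
  the range.\<close>

lemma rpoly_nonpos_coeffs:
  assumes "\<forall>x\<in>#A. x \<le> (0::real)"
  shows "0 \<le> coeff (rpoly A) k \<and> (0 < coeff (rpoly A) k \<longleftrightarrow> count A 0 \<le> k \<and> k \<le> size A)"
  using assms
proof (induction A arbitrary: k)
  case empty
  then show ?case by (cases k) auto
next
  case (add x A)
  then have IH: "0 \<le> coeff (rpoly A) k \<and> (0 < coeff (rpoly A) k \<longleftrightarrow> count A 0 \<le> k \<and> k \<le> size A)" for k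
    by auto
  have c: "coeff (rpoly (add_mset x A)) k = - x * coeff (rpoly A) k + (case k of 0 \<Rightarrow> 0 | Suc j \<Rightarrow> coeff (rpoly A) j)"
    by (simp add: coeff_pCons split: nat.splits)
  have x: "x \<le> 0" using add.prems by simp
  show ?case
  proof (cases "x = 0")
    case True
    then show ?thesis unfolding c using IH by (cases k) auto
  next
    case False
    with x have x': "0 < - x" by simp
    have 1: "0 \<le> - x * coeff (rpoly A) k" "0 < - x * coeff (rpoly A) k \<longleftrightarrow> count A 0 \<le> k \<and> k \<le> size A"
      using IH[of k] x' by (auto simp: mult_nonpos_nonneg mult_less_0_iff)
    show ?thesis
    proof (cases k)
      case 0
      then show ?thesis unfolding c using 1 False by auto
    next
      case (Suc j)
      have cc: "count (add_mset x A) 0 = count A 0" using False by simp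
      have sz: "size (add_mset x A) = Suc (size A)" by simp
      have le: "count A 0 \<le> size A" by (rule count_le_size)
      define u v where "u = - x * coeff (rpoly A) (Suc j)" and "v = coeff (rpoly A) j"
      have uv: "coeff (rpoly (add_mset x A)) (Suc j) = u + v"
        using c Suc by (simp add: u_def v_def)
      have u: "0 \<le> u" "0 < u \<longleftrightarrow> count A 0 \<le> Suc j \<and> Suc j \<le> size A"
        using 1 unfolding Suc u_def by auto
      have v: "0 \<le> v" "0 < v \<longleftrightarrow> count A 0 \<le> j \<and> j \<le> size A"
        using IH[of j] unfolding v_def by auto
      have "0 < u + v \<longleftrightarrow> 0 < u \<or> 0 < v" using u(1) v(1) by auto
      then show ?thesis unfolding Suc uv cc sz using u v le by auto
    qed
  qed
qed

locale nd_op = hyp_op +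
  fixes M r :: nat
  assumes MN: "M \<le> N" and Q0: "\<And>k. k < M \<Longrightarrow> Q k = 0" and QM: "Q M \<noteq> 0"
    and degQ: "\<And>k. k \<le> N \<Longrightarrow> degree (Q k) \<le> k + r" and degQN: "degree (Q N) = N + r"
begin

text \<open>\<open>T\<close> maps \<open>z^n\<close> to \<open>top_factor n z^(n + r)\<close> plus terms of lower degree.\<close>

definition top_coeff :: "nat \<Rightarrow> real" where
  "top_coeff k = coeff (Q k) (k + r)"

definition top_factor :: "nat \<Rightarrow> real" where
  "top_factor n = (\<Sum>k=0..N. top_coeff k * falling n k)"

lemma top_coeff_N: "top_coeff N \<noteq> 0"
  using QN degQN by (simp add: top_coeff_def flip: degQN)

lemma T_top:
  assumes "degree f \<le> n"
  shows "degree (T f) \<le> n + r" "coeff (T f) (n + r) = top_factor n * coeff f n"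
proof -
  have 1: "degree (Q k * (pderiv ^^ k) f) \<le> n + r \<and> coeff (Q k * (pderiv ^^ k) f) (n + r) = top_coeff k * falling n k * coeff f n"
    if k: "k \<le> N" for k
  proof (cases "k \<le> n")
    case True
    have d: "degree ((pderiv ^^ k) f) \<le> n - k" using assms by (simp add: degree_higher_pderiv)
    have nr: "n + r = (k + r) + (n - k)" using True by simp
    have "coeff (Q k * (pderiv ^^ k) f) (n + r) = coeff (Q k) (k + r) * coeff ((pderiv ^^ k) f) (n - k)"
      unfolding nr by (rule coeff_mult_top[OF degQ[OF k] d])
    then have "coeff (Q k * (pderiv ^^ k) f) (n + r) = top_coeff k * falling n k * coeff f n"
      by (simp only: coeff_higher_pderiv_top[OF True] top_coeff_def mult.assoc)
    moreover have "degree (Q k * (pderiv ^^ k) f) \<le> n + r"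
      using degree_mult_le[of "Q k" "(pderiv ^^ k) f"] degQ[OF k] d nr by linarith
    ultimately show ?thesis by simp
  next
    case False
    then have "degree f < k" using assms by simp
    then have "(pderiv ^^ k) f = 0"
      by (intro poly_eqI) (simp add: coeff_higher_pderiv coeff_eq_0)
    then show ?thesis using False by (simp add: falling_eq_0)
  qed
  show "degree (T f) \<le> n + r"
    unfolding diff_op_def by (intro degree_sum_le) (use 1 in auto)
  have "coeff (T f) (n + r) = (\<Sum>k=0..N. top_coeff k * falling n k * coeff f n)"
    unfolding diff_op_def coeff_sum by (intro sum.cong) (use 1 in auto)
  then show "coeff (T f) (n + r) = top_factor n * coeff f n"
    by (simp add: top_factor_def sum_distrib_right)
qed

text \<open>The polynomial with coefficients \<open>top_coeff k\<close> has only nonpositive roots,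
  so after \<open>d\<close> zero coefficients, \<open>d\<close> being the multiplicity of the root
  \<open>0\<close>, all the others share one sign.\<close>

lemma top_coeff_zero_iff:
  obtains d where "d \<le> N" "\<And>k. k \<le> N \<Longrightarrow> d \<le> k \<Longrightarrow> top_coeff k * top_coeff N > 0" "\<And>k. k < d \<Longrightarrow> top_coeff k = 0"
proof -
  define q where "q = (\<Sum>k=0..N. monom (coeff (Q k) (k + r)) k)"
  have cq: "coeff q k = (if k \<le> N then top_coeff k else 0)" for k
    by (auto simp: q_def coeff_sum top_coeff_def)
  have "degree q \<le> N" by (rule degree_le) (simp add: cq)
  moreover have "coeff q N \<noteq> 0" using top_coeff_N by (simp add: cq)
  ultimately have dq: "degree q = N" "q \<noteq> 0" by (auto simp: le_degree le_antisym)
  have z: "y \<in> \<real>\<^sub>\<le>\<^sub>0" if "poly (cp q) y = 0" for y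
    by (rule leading_coeffs_zeros[where r = r]) (use degQ top_coeff_N that in \<open>auto simp: q_def top_coeff_def\<close>)
  then have hq: "hyperbolic q" using dq nonpos_Reals_subset_Reals by (auto simp: hyperbolic_def)
  define A where "A = proots q"
  have A: "size A = N" using size_proots_hyperbolic[OF hq] dq by (simp add: A_def)
  have "\<forall>x\<in>#A. x \<le> 0"
  proof
    fix x assume "x \<in># A"
    then have "poly (cp q) (of_real x) = 0" using dq by (simp add: A_def)
    from z[OF this] show "x \<le> 0" by simp
  qed
  note A0 = rpoly_nonpos_coeffs[OF this]
  have "lead_coeff q = top_coeff N" using dq by (simp add: cq)
  with hyperbolic_factor[OF hq] have qf: "q = smult (top_coeff N) (rpoly A)" by (simp add: A_def)
  have l: "top_coeff k = top_coeff N * coeff (rpoly A) k" if "k \<le> N" for k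
    using arg_cong[OF qf, of "\<lambda>p. coeff p k"] that by (simp add: cq)
  show ?thesis
  proof (rule that[of "count A 0"])
    show le: "count A 0 \<le> N" using count_le_size[of A 0] A by simp
    show "top_coeff k * top_coeff N > 0" if "k \<le> N" "count A 0 \<le> k" for k
    proof -
      have "0 < coeff (rpoly A) k" using A0[of k] that A by simp
      moreover have "top_coeff k * top_coeff N = (top_coeff N)\<^sup>2 * coeff (rpoly A) k" using l[OF that(1)] by (simp add: power2_eq_square)
      ultimately show ?thesis using top_coeff_N by simp
    qed
    show "top_coeff k = 0" if "k < count A 0" for k
      using l[of k] that le A0[of k] by simp
  qed
qed

lemma T_low_degree: "degree f < M \<Longrightarrow> T f = 0"
  unfolding diff_op_def
proof (intro sum.neutral ballI)
  fix k assume "degree f < M"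
  show "Q k * (pderiv ^^ k) f = 0"
  proof (cases "k < M")
    case False
    then have "(pderiv ^^ k) f = 0" using \<open>degree f < M\<close>
      by (intro poly_eqI) (simp add: coeff_higher_pderiv coeff_eq_0)
    then show ?thesis by simp
  qed (simp add: Q0)
qed

text \<open>\<open>rpoly A\<close> is the difference of two monic polynomials with one more root,
  \<open>0\<close> or \<open>1\<close>. If \<open>T\<close> annihilated all monic real-rooted
  polynomials of degree \<open>n\<close>, descent would reach \<open>z^M\<close>, whose image is
  \<open>M! Q M\<close>.\<close>

lemma T_nonzero_exists:
  assumes "M \<le> n"
  obtains A where "size A = n" "T (rpoly A) \<noteq> 0"
proof -
  have "\<exists>A. size A = n \<and> T (rpoly A) \<noteq> 0"
  proof (rule ccontr)
    assume c: "\<not> ?thesis"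
    have "T (rpoly A) = 0" if "size A + j = n" for A j
      using that
    proof (induction j arbitrary: A)
      case (Suc j)
      have "rpoly A = rpoly (add_mset 0 A) - rpoly (add_mset 1 A)" by simp
      then have "T (rpoly A) = T (rpoly (add_mset 0 A)) - T (rpoly (add_mset 1 A))"
        by (simp only: diff_op_diff)
      also have "\<dots> = 0" using Suc.IH[of "add_mset 0 A"] Suc.IH[of "add_mset 1 A"] Suc.prems by (simp del: rpoly_add_mset)
      finally show ?case .
    qed (use c in auto)
    from this[of "replicate_mset M 0" "n - M"] assms have "T ([:- 0, 1:] ^ M) = 0"
      by (simp add: rpoly_replicate)
    moreover have "T ([:- 0, 1:] ^ M) = (\<Sum>k=0..N. if k = M then smult (falling M M) (Q M) else 0)"
      unfolding diff_op_linear_power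
    proof (intro sum.cong refl)
      fix k
      show "smult (real (falling M k)) (Q k * [:- 0, 1:] ^ (M - k)) = (if k = M then smult (falling M M) (Q M) else 0)"
        using Q0[of k] falling_eq_0[of M k] by (cases k M rule: linorder_cases) auto
    qed
    ultimately show False using QM MN falling_pos[of M M] by simp
  qed
  then show ?thesis using that by blast
qed

text \<open>It remains to show \<open>d \<le> M\<close>. Otherwise in degree
  \<open>n = d - 1\<close> the top term of every image vanishes, while in degree \<open>d\<close> it
  does not. The images of two nesting polynomials of these degrees would then differ in degree by at
  least two, which a pencil forbids.\<close>

lemma top_coeff_sign:
  assumes "M \<le> k" "k \<le> N"
  shows "top_coeff k * top_coeff N > 0"
proof -
  obtain d where d: "d \<le> N" "\<And>k. k \<le> N \<Longrightarrow> d \<le> k \<Longrightarrow> top_coeff k * top_coeff N > 0" "\<And>k. k < d \<Longrightarrow> top_coeff k = 0"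
    using top_coeff_zero_iff by metis
  have "d \<le> M"
  proof (rule ccontr)
    assume "\<not> d \<le> M"
    define n where "n = d - 1"
    have n: "M \<le> n" "Suc n = d" using \<open>\<not> d \<le> M\<close> by (auto simp: n_def)
    obtain A where A: "size A = n" "T (rpoly A) \<noteq> 0" using T_nonzero_exists[OF n(1)] by metis
    have lam0: "top_factor n = 0"
      unfolding top_factor_def
    proof (intro sum.neutral ballI)
      fix k show "top_coeff k * real (falling n k) = 0"
        using d(3)[of k] falling_eq_0[of n k] n by (cases "k < d") auto
    qed
    have "top_factor d = (\<Sum>k=0..N. if k = d then top_coeff d * falling d d else 0)"
      unfolding top_factor_def
    proof (intro sum.cong refl)
      fix k show "top_coeff k * real (falling d k) = (if k = d then top_coeff d * falling d d else 0)"
        using d(3)[of k] falling_eq_0[of d k] by (cases k d rule: linorder_cases) auto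
    qed
    then have "top_factor d = top_coeff d * falling d d" using d(1) by simp
    then have lamd: "top_factor d \<noteq> 0" using d(2)[of d] d(1) falling_pos[of d d] by auto
    have "degree (T (rpoly A)) \<le> n + r" "coeff (T (rpoly A)) (n + r) = 0"
      using T_top[of "rpoly A" n] A lam0 by auto
    then have dA: "degree (T (rpoly A)) < n + r \<or> n + r = 0"
      using A(2) by (metis leading_coeff_0_iff le_neq_implies_less)
    moreover have "n + r \<noteq> 0"
    proof
      assume "n + r = 0"
      with \<open>degree (T (rpoly A)) \<le> n + r\<close> have "degree (T (rpoly A)) = n + r" by simp
      with \<open>coeff (T (rpoly A)) (n + r) = 0\<close> A(2) show False by (metis leading_coeff_0_iff)
    qed
    ultimately have dA: "degree (T (rpoly A)) < n + r" by blast
    have cB: "coeff (T (rpoly (add_mset 0 A))) (d + r) \<noteq> 0"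
      using T_top(2)[of "rpoly (add_mset 0 A)" d] A n lamd lead_coeff_rpoly[of "add_mset 0 A"]
      by (simp del: rpoly_add_mset lead_coeff_rpoly)
    then have "d + r \<le> degree (T (rpoly (add_mset 0 A)))" by (rule le_degree)
    moreover have "pencil (T (rpoly A)) (T (rpoly (add_mset 0 A)))"
      by (intro T_pencil nests_imp_pencil nests_add_mset)
    then have "degree (T (rpoly (add_mset 0 A))) \<le> Suc (degree (T (rpoly A)))"
      using A(2) cB by (intro pencil_degree_le) auto
    ultimately show False using dA n by simp
  qed
  then show ?thesis using d(2) assms by simp
qed

lemma top_factor_sign:
  assumes "M \<le> n"
  shows "top_factor n * top_coeff N > 0"
proof -
  have nn: "0 \<le> top_coeff k * top_coeff N * falling n k" if "k \<in> {0..N}" for k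
    using top_coeff_sign[of k] Q0[of k] that by (cases "k < M") (auto simp: top_coeff_def)
  have "0 < top_coeff M * top_coeff N * falling n M" using top_coeff_sign[of M] MN falling_pos[OF assms] by simp
  then have "0 < (\<Sum>k=0..N. top_coeff k * top_coeff N * falling n k)"
    using nn MN by (intro sum_pos2[of _ M]) auto
  also have "\<dots> = top_factor n * top_coeff N" by (simp add: top_factor_def sum_distrib_right sum_distrib_left algebra_simps)
  finally show ?thesis .
qed

lemma top_factor_nonzero: "M \<le> n \<Longrightarrow> top_factor n \<noteq> 0"
  using top_factor_sign[of n] by auto

section \<open>Monotone dependence of the zeros of the image on the roots\<close>

definition Z :: "real multiset \<Rightarrow> real multiset" where
  "Z A = proots (T (rpoly A))"

lemma T_rpoly:
  assumes "M \<le> size A"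
  shows "T (rpoly A) = smult (top_factor (size A)) (rpoly (Z A))" "size (Z A) = size A + r"
    "hyperbolic (T (rpoly A))"
proof -
  have c: "degree (T (rpoly A)) \<le> size A + r" "coeff (T (rpoly A)) (size A + r) = top_factor (size A)"
    using T_top[of "rpoly A" "size A"] by auto
  then have nz: "T (rpoly A) \<noteq> 0" using top_factor_nonzero[OF assms] by auto
  then show h: "hyperbolic (T (rpoly A))" by (intro T_hyperbolic) auto
  have d: "degree (T (rpoly A)) = size A + r"
    using c top_factor_nonzero[OF assms] by (intro le_antisym le_degree) auto
  then show "size (Z A) = size A + r" using size_proots_hyperbolic[OF h] by (simp add: Z_def)
  show "T (rpoly A) = smult (top_factor (size A)) (rpoly (Z A))"
    using hyperbolic_factor[OF h] unfolding d c(2) Z_def .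
qed

lemma nests_Z:
  assumes "M \<le> size A" "nests A B"
  shows "nests (Z A) (Z B)"
proof -
  have B: "size B = Suc (size A)" using assms by (simp add: nests_def)
  have "pencil (T (rpoly A)) (T (rpoly B))"
    by (intro T_pencil nests_imp_pencil assms)
  then show ?thesis
    unfolding Z_def using T_rpoly[of A] T_rpoly[of B] assms(1) B top_factor_nonzero[of "size A"] top_factor_nonzero[of "size B"]
    by (intro pencil_nests) (auto simp: T_rpoly(1))
qed

text \<open>Moving the root from \<open>x\<close> to \<open>y\<close> subtracts
  \<open>(y - x) * rpoly A\<close>, so both polynomials lie in the pencil of \<open>rpoly A\<close>
  and \<open>rpoly A1\<close>. Their images therefore have zeros displaced to one side only. If
  \<open>size A < M\<close>, the subtracted term is annihilated and nothing moves.\<close>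

lemma count_above_Z_step:
  assumes M: "M \<le> Suc (size A)" and xy: "x \<le> y"
  shows "count_above (Z (add_mset x A)) t \<le> count_above (Z (add_mset y A)) t"
proof (cases "size A < M \<or> x = y \<or> Z (add_mset x A) = Z (add_mset y A)")
  case True
  have "rpoly (add_mset x A) - rpoly (add_mset y A) = smult (y - x) (rpoly A)"
    by (simp add: algebra_simps smult_diff_left)
  then have "T (rpoly (add_mset x A)) - T (rpoly (add_mset y A)) = smult (y - x) (T (rpoly A))"
    by (metis diff_op_diff diff_op_smult)
  then have "size A < M \<Longrightarrow> Z (add_mset x A) = Z (add_mset y A)"
    using T_low_degree[of "rpoly A"] by (simp add: Z_def)
  then show ?thesis using True by auto
next
  case False
  then have s: "y - x > 0" and MA: "M \<le> size A" and ne: "Z (add_mset x A) \<noteq> Z (add_mset y A)"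
    using xy by auto
  define A1 A2 where "A1 = add_mset x A" and "A2 = add_mset y A"
  have sz: "size A1 = Suc (size A)" "size A2 = Suc (size A)" by (auto simp: A1_def A2_def)
  have r12: "rpoly A2 = rpoly A1 - smult (y - x) (rpoly A)"
    by (simp add: A1_def A2_def algebra_simps smult_diff_left)
  define l m where "l = top_factor (Suc (size A))" and "m = top_factor (size A)"
  have lm: "l * m > 0"
  proof -
    have "(l * top_coeff N) * (m * top_coeff N) > 0"
      unfolding l_def m_def using MA by (intro mult_pos_pos top_factor_sign) auto
    then have "(l * m) * (top_coeff N)\<^sup>2 > 0" by (simp add: power2_eq_square algebra_simps)
    then show ?thesis by (simp add: zero_less_mult_iff)
  qed
  have TA: "T (rpoly A) = smult m (rpoly (Z A))" and TA1: "T (rpoly A1) = smult l (rpoly (Z A1))"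
    and TA2: "T (rpoly A2) = smult l (rpoly (Z A2))"
    using T_rpoly(1)[of A] T_rpoly(1)[of A1] T_rpoly(1)[of A2] MA by (auto simp: sz l_def m_def)
  have "T (rpoly A2) = T (rpoly A1) - smult (y - x) (T (rpoly A))"
    unfolding r12 by (simp add: diff_op_diff diff_op_smult)
  then have eq: "smult l (rpoly (Z A2)) = smult l (rpoly (Z A1)) - smult ((y - x) * m) (rpoly (Z A))"
    by (simp add: TA TA1 TA2)
  have p1: "pencil (rpoly A) (rpoly A1)"
    unfolding A1_def by (intro nests_imp_pencil nests_add_mset)
  have "pencil (rpoly A1) (rpoly A2)"
    unfolding pencil_def
  proof (intro allI)
    fix a b
    have "smult a (rpoly A1) + smult b (rpoly A2) = smult (- b * (y - x)) (rpoly A) + smult (a + b) (rpoly A1)"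
      unfolding r12 by (simp add: smult_diff_right smult_add_left)
    then show "smult a (rpoly A1) + smult b (rpoly A2) = 0 \<or> hyperbolic (smult a (rpoly A1) + smult b (rpoly A2))"
      using p1 unfolding pencil_def by metis
  qed
  then have p12: "pencil (T (rpoly A1)) (T (rpoly A2))" by (rule T_pencil)
  have nz: "T (rpoly A1) \<noteq> 0" "T (rpoly A2) \<noteq> 0"
    using T_rpoly(3)[of A1] T_rpoly(3)[of A2] MA sz by (auto simp: hyperbolic_nonzero)
  obtain k :: int where k: "k = 0 \<or> k = -1"
    "\<forall>z. Im z > 0 \<longrightarrow> k * pi < phase (Z A2) z - phase (Z A1) z \<and> phase (Z A2) z - phase (Z A1) z < (k + 1) * pi"
    "\<forall>t. k \<le> int (count_above (Z A2) t) - int (count_above (Z A1) t) \<and>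
       int (count_above (Z A2) t) - int (count_above (Z A1) t) \<le> k + 1"
    using pencil_difference[OF p12 nz] ne unfolding Z_def[symmetric] A1_def[symmetric] A2_def[symmetric] by blast
  \<comment> \<open>The side is decided by evaluating at \<open>\<i>\<close>:
    \<open>l * Im (P2 * cnj P1) = (y - x) * m * Im (P1 * cnj P)\<close>, where
    \<open>l * m > 0\<close> and the last factor is positive by nesting.\<close>
  have "k \<noteq> -1"
  proof
    assume km: "k = -1"
    have i: "Im \<i> > 0" by simp
    let ?P = "poly (cp (rpoly (Z A))) \<i>" and ?P1 = "poly (cp (rpoly (Z A1))) \<i>" and ?P2 = "poly (cp (rpoly (Z A2))) \<i>"
    have d: "- pi < phase (Z A2) \<i> - phase (Z A1) \<i>" "phase (Z A2) \<i> - phase (Z A1) \<i> < 0"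
      using spec[OF k(2), of \<i>] km by auto
    obtain \<rho>1 where \<rho>1: "\<rho>1 > 0" "Im (?P2 * cnj ?P1) = \<rho>1 * sin (phase (Z A2) \<i> - phase (Z A1) \<i>)"
      using Im_rpoly_mult_cnj[OF i] by metis
    have "sin (phase (Z A2) \<i> - phase (Z A1) \<i>) < 0"
      using d sin_gt_zero[of "phase (Z A1) \<i> - phase (Z A2) \<i>"] sin_minus[of "phase (Z A1) \<i> - phase (Z A2) \<i>"] by simp
    then have neg: "Im (?P2 * cnj ?P1) < 0" using \<rho>1 by (simp add: mult_pos_neg)
    obtain \<rho>2 where \<rho>2: "\<rho>2 > 0" "Im (?P1 * cnj ?P) = \<rho>2 * sin (phase (Z A1) \<i> - phase (Z A) \<i>)"
      using Im_rpoly_mult_cnj[OF i] by metis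
    have nA: "nests (Z A) (Z A1)" unfolding A1_def by (intro nests_Z MA nests_add_mset)
    have "sin (phase (Z A1) \<i> - phase (Z A) \<i>) > 0"
      using nests_phase[OF nA i] by (intro sin_gt_zero)
    then have pos: "Im (?P1 * cnj ?P) > 0" using \<rho>2 by simp
    have "of_real l * ?P2 = of_real l * ?P1 - of_real ((y - x) * m) * ?P"
      using arg_cong[OF eq, of "\<lambda>p. poly (cp p) \<i>"] by (simp add: cp_smult cp_diff)
    then have "l * Re ?P2 = l * Re ?P1 - (y - x) * m * Re ?P" "l * Im ?P2 = l * Im ?P1 - (y - x) * m * Im ?P"
      by (simp_all add: complex_eq_iff)
    then have "(l * Re ?P2) * Im ?P1 = (l * Re ?P1 - (y - x) * m * Re ?P) * Im ?P1"
      "(l * Im ?P2) * Re ?P1 = (l * Im ?P1 - (y - x) * m * Im ?P) * Re ?P1" by simp_all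
    then have "l * (Im ?P2 * Re ?P1 - Re ?P2 * Im ?P1) = (y - x) * m * (Im ?P1 * Re ?P - Re ?P1 * Im ?P)"
      by (simp add: algebra_simps)
    moreover have im: "Im (u * cnj v) = Im u * Re v - Re u * Im v" for u v by simp
    ultimately have "l * Im (?P2 * cnj ?P1) = (y - x) * m * Im (?P1 * cnj ?P)" by (simp only: im)
    then have "l * (l * Im (?P2 * cnj ?P1)) = l * ((y - x) * m * Im (?P1 * cnj ?P))" by (rule arg_cong)
    also have "\<dots> = (y - x) * ((l * m) * Im (?P1 * cnj ?P))" by (simp only: ac_simps)
    also have "\<dots> > 0" by (rule mult_pos_pos[OF s mult_pos_pos[OF lm pos]])
    finally have "0 < (l * l) * Im (?P2 * cnj ?P1)" by (simp only: mult.assoc)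
    moreover have "0 < l * l" using lm by (metis mult_eq_0_iff not_real_square_gt_zero less_irrefl)
    ultimately show False using neg by (metis mult_pos_neg not_less_iff_gr_or_eq)
  qed
  then have "k = 0" using k(1) by simp
  then show ?thesis using spec[OF k(3), of t] unfolding A1_def A2_def by linarith
qed

text \<open>Roots are moved one at a time; \<open>U\<close> collects those already moved.\<close>

lemma count_above_Z_mono:
  assumes "list_all2 (\<le>) xs ys" "M \<le> length xs"
  shows "count_above (Z (mset xs)) t \<le> count_above (Z (mset ys)) t"
proof -
  have "count_above (Z (U + mset xs)) t \<le> count_above (Z (U + mset ys)) t"
    if "list_all2 (\<le>) xs ys" "M \<le> size U + length xs" for U
    using that
  proof (induction xs ys arbitrary: U rule: list_all2_induct)
    case (Cons x xs y ys)
    have "count_above (Z (U + mset (x # xs))) t = count_above (Z (add_mset x (U + mset xs))) t" by simp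
    also have "\<dots> \<le> count_above (Z (add_mset y (U + mset xs))) t"
      using Cons by (intro count_above_Z_step) auto
    also have "\<dots> = count_above (Z (add_mset y U + mset xs)) t" by simp
    also have "\<dots> \<le> count_above (Z (add_mset y U + mset ys)) t"
      using Cons.prems by (intro Cons.IH) simp
    finally show ?case by simp
  qed simp
  from this[of "{#}"] assms show ?thesis by simp
qed

end

subsection \<open>Zeros of the images of powers of linear polynomials\<close>

lemma sign_at_top:
  assumes "p \<noteq> (0 :: real poly)"
  shows "eventually (\<lambda>x. 0 < lead_coeff p * poly p x) at_top"
proof -
  have "lead_coeff (smult (lead_coeff p) p) > 0"
    using assms by (metis lead_coeff_smult leading_coeff_0_iff not_real_square_gt_zero)
  from poly_pinfty_gt_lc[OF this] obtain n where
    "\<forall>x\<ge>n. lead_coeff (smult (lead_coeff p) p) \<le> poly (smult (lead_coeff p) p) x" by blast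
  then have "0 < lead_coeff p * poly p x" if "x \<ge> n" for x
    using \<open>lead_coeff (smult (lead_coeff p) p) > 0\<close> that by (metis order_less_le_trans poly_smult)
  then show ?thesis unfolding eventually_at_top_linorder by blast
qed

text \<open>This also holds for a polynomial without zeros, whatever value
  \<open>smallest_zero\<close> then has.\<close>

lemma smallest_zero_less:
  assumes "p \<noteq> 0" "x < smallest_zero p"
  shows "poly p x \<noteq> 0"
proof
  assume "poly p x = 0"
  then have "smallest_zero p \<le> x"
    unfolding smallest_zero_def using poly_roots_finite[OF assms(1)] by (intro Min_le) auto
  with assms(2) show False by simp
qed

context nd_op
begin

abbreviation "Zpow n c \<equiv> Z (replicate_mset n c)"

lemma T_linear_power:
  "poly (T ([:- c, 1:] ^ n)) x = (\<Sum>k=0..N. falling n k * poly (Q k) x * (x - c) ^ (n - k))"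
  by (simp add: diff_op_linear_power poly_sum mult.assoc)

lemma Zpow_iff:
  assumes "M \<le> n"
  shows "x \<in># Zpow n c \<longleftrightarrow> poly (T ([:- c, 1:] ^ n)) x = 0"
proof -
  have "T ([:- c, 1:] ^ n) \<noteq> 0"
    using T_rpoly(3)[of "replicate_mset n c"] assms by (auto simp: rpoly_replicate hyperbolic_nonzero)
  then show ?thesis by (simp add: Z_def rpoly_replicate)
qed

lemma degree_Q:
  assumes "M \<le> k" "k \<le> N"
  shows "degree (Q k) = k + r \<and> lead_coeff (Q k) = top_coeff k"
proof -
  have "coeff (Q k) (k + r) \<noteq> 0" using top_coeff_sign[OF assms] by (auto simp: top_coeff_def)
  then have "degree (Q k) = k + r" using degQ[OF assms(2)] by (intro le_antisym le_degree)
  then show ?thesis by (simp add: top_coeff_def)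
qed

lemma Q_sign_at_top: "eventually (\<lambda>x. \<forall>k\<in>{M..N}. 0 < top_coeff N * poly (Q k) x) at_top"
proof (rule eventually_ball_finite)
  show "\<forall>k\<in>{M..N}. \<forall>\<^sub>F x in at_top. 0 < top_coeff N * poly (Q k) x"
  proof
    fix k assume k: "k \<in> {M..N}"
    then have "Q k \<noteq> 0" "lead_coeff (Q k) = top_coeff k" "top_coeff k * top_coeff N > 0"
      using top_coeff_sign[of k] degree_Q[of k] by (auto simp: top_coeff_def)
    with sign_at_top[of "Q k"] have "eventually (\<lambda>x. 0 < top_coeff k * poly (Q k) x) at_top" by simp
    then show "\<forall>\<^sub>F x in at_top. 0 < top_coeff N * poly (Q k) x"
      by eventually_elim (use \<open>top_coeff k * top_coeff N > 0\<close> in \<open>auto simp: zero_less_mult_iff\<close>)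
  qed
qed simp

lemma Q_sign_at_bot: "eventually (\<lambda>x. \<forall>k\<in>{M..N}. 0 < (- 1) ^ (k + r) * top_coeff N * poly (Q k) (- x)) at_top"
proof (rule eventually_ball_finite)
  show "\<forall>k\<in>{M..N}. \<forall>\<^sub>F x in at_top. 0 < (- 1) ^ (k + r) * top_coeff N * poly (Q k) (- x)"
  proof
    fix k assume k: "k \<in> {M..N}"
    then have Qk: "Q k \<noteq> 0" "lead_coeff (Q k) = top_coeff k" "degree (Q k) = k + r" "top_coeff k * top_coeff N > 0"
      using top_coeff_sign[of k] degree_Q[of k] by (auto simp: top_coeff_def)
    let ?p = "pcompose (Q k) [:0, - 1:]"
    have "lead_coeff ?p = lead_coeff (Q k) * lead_coeff [:0, - 1 :: real:] ^ degree (Q k)"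
      by (rule lead_coeff_comp) simp
    from this[unfolded Qk(2), unfolded Qk(3)] have l: "lead_coeff ?p = top_coeff k * (- 1) ^ (k + r)"
      by simp
    then have "?p \<noteq> 0" using Qk by auto
    from sign_at_top[OF this] have "eventually (\<lambda>x. 0 < top_coeff k * (- 1) ^ (k + r) * poly (Q k) (- x)) at_top"
      unfolding l by (simp add: poly_pcompose)
    then show "\<forall>\<^sub>F x in at_top. 0 < (- 1) ^ (k + r) * top_coeff N * poly (Q k) (- x)"
    proof eventually_elim
      case (elim x)
      have "0 < (top_coeff k * (- 1) ^ (k + r) * poly (Q k) (- x)) * (top_coeff k * top_coeff N)"
        using elim Qk(4) by (rule mult_pos_pos)
      also have "\<dots> = (top_coeff k)\<^sup>2 * ((- 1) ^ (k + r) * top_coeff N * poly (Q k) (- x))"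
        by (simp add: power2_eq_square)
      finally show ?case by (simp add: zero_less_mult_iff)
    qed
  qed
qed simp

lemma Zpow_sign:
  assumes n: "M \<le> n" and pos: "\<And>k. k \<in> {M..N} \<Longrightarrow> k \<le> n \<Longrightarrow> 0 < s * (poly (Q k) x * (x - c) ^ (n - k))"
  shows "x \<notin># Zpow n c"
proof -
  have e: "s * (falling n k * poly (Q k) x * (x - c) ^ (n - k)) =
      falling n k * (s * (poly (Q k) x * (x - c) ^ (n - k)))" for k
    by (simp only: ac_simps)
  have "0 < (\<Sum>k=0..N. s * (falling n k * poly (Q k) x * (x - c) ^ (n - k)))"
  proof (rule sum_pos2[of _ M])
    show "0 < s * (falling n M * poly (Q M) x * (x - c) ^ (n - M))"
      unfolding e using falling_pos[OF n] pos[of M] MN n by simp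
    show "0 \<le> s * (falling n k * poly (Q k) x * (x - c) ^ (n - k))" if "k \<in> {0..N}" for k
    proof (cases "M \<le> k \<and> k \<le> n")
      case True
      then show ?thesis unfolding e using pos[of k] that by simp
    next
      case False
      then show ?thesis using Q0[of k] falling_eq_0[of n k] by (cases "k < M") auto
    qed
  qed (use MN in auto)
  also have "\<dots> = s * poly (T ([:- c, 1:] ^ n)) x"
    by (simp add: T_linear_power sum_distrib_left)
  finally show ?thesis unfolding Zpow_iff[OF n] by auto
qed

lemma Zpow_le_eventually:
  assumes n: "M \<le> n"
  obtains c1 where "\<And>c x. c1 \<le> c \<Longrightarrow> x \<in># Zpow n c \<Longrightarrow> x \<le> c"
proof -
  obtain c1 where c1: "\<And>x k. c1 \<le> x \<Longrightarrow> k \<in> {M..N} \<Longrightarrow> 0 < top_coeff N * poly (Q k) x"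
    using Q_sign_at_top unfolding eventually_at_top_linorder by blast
  have "x \<notin># Zpow n c" if "c1 \<le> c" "c < x" for c x
  proof (rule Zpow_sign[OF n])
    fix k assume "k \<in> {M..N}"
    then have "0 < (top_coeff N * poly (Q k) x) * (x - c) ^ (n - k)"
      using that by (intro mult_pos_pos[OF c1]) auto
    then show "0 < top_coeff N * (poly (Q k) x * (x - c) ^ (n - k))" by (simp only: mult.assoc)
  qed
  then show ?thesis using that by (meson not_le)
qed

lemma Zpow_ge_eventually:
  assumes n: "M \<le> n"
  obtains c0 where "\<And>c x. c \<le> c0 \<Longrightarrow> x \<in># Zpow n c \<Longrightarrow> c \<le> x"
proof -
  obtain c1 where c1: "\<And>x k. c1 \<le> x \<Longrightarrow> k \<in> {M..N} \<Longrightarrow> 0 < (- 1) ^ (k + r) * top_coeff N * poly (Q k) (- x)"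
    using Q_sign_at_bot unfolding eventually_at_top_linorder by blast
  have "x \<notin># Zpow n c" if "c \<le> - c1" "x < c" for c x
  proof (rule Zpow_sign[OF n])
    fix k assume k: "k \<in> {M..N}" "k \<le> n"
    have "0 < (- 1) ^ (k + r) * top_coeff N * poly (Q k) x"
      using c1[of "- x" k] that k by simp
    moreover have "0 < (c - x) ^ (n - k)" using that by simp
    ultimately have "0 < ((- 1) ^ (k + r) * top_coeff N * poly (Q k) x) * (c - x) ^ (n - k)"
      by (rule mult_pos_pos)
    also have "(c - x) ^ (n - k) = ((- 1) * (x - c)) ^ (n - k)" by simp
    also have "\<dots> = (- 1) ^ (n - k) * (x - c) ^ (n - k)" by (rule power_mult_distrib)
    also have "(- 1) ^ (k + r) * top_coeff N * poly (Q k) x * ((- 1) ^ (n - k) * (x - c) ^ (n - k)) =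
        ((- 1) ^ (k + r) * (- 1) ^ (n - k)) * top_coeff N * (poly (Q k) x * (x - c) ^ (n - k))"
      by (simp only: ac_simps)
    \<comment> \<open>The sign \<open>(- 1) ^ (k + r)\<close> of \<open>Q k\<close> far to the left
      and the sign \<open>(- 1) ^ (n - k)\<close> of the power combine to one sign independent of
      \<open>k\<close>.\<close>
    finally show "0 < ((- 1) ^ (n + r) * top_coeff N) * (poly (Q k) x * (x - c) ^ (n - k))"
      using k by (simp add: power_add[symmetric] add.commute)
  qed
  then show ?thesis using that[of "- c1"] by (meson not_le)
qed

text \<open>After division by \<open>(z - c)^(n - e)\<close> only the term with \<open>k = e\<close>
  survives at \<open>c\<close>, and it is a nonzero multiple of the value of \<open>Q e\<close>
  there.\<close>

lemma count_Zpow: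
  assumes n: "M \<le> n" and c: "poly (Q (min n N)) c \<noteq> 0"
  shows "count (Zpow n c) c = n - min n N"
proof -
  define e where "e = min n N"
  define R where "R = (\<Sum>k=0..e. smult (falling n k) (Q k * [:- c, 1:] ^ (e - k)))"
  have "T ([:- c, 1:] ^ n) = (\<Sum>k=0..e. smult (falling n k) (Q k * [:- c, 1:] ^ (n - k)))"
    unfolding diff_op_linear_power
    by (intro sum.mono_neutral_right) (auto simp: e_def falling_eq_0)
  also have "\<dots> = [:- c, 1:] ^ (n - e) * R"
    unfolding R_def sum_distrib_left
  proof (intro sum.cong refl)
    fix k assume "k \<in> {0..e}"
    then have "[:- c, 1:] ^ (n - k) = [:- c, 1:] ^ (n - e) * [:- c, 1:] ^ (e - k)"
      by (simp add: e_def flip: power_add)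
    then show "smult (real (falling n k)) (Q k * [:- c, 1:] ^ (n - k)) = [:- c, 1:] ^ (n - e) * smult (real (falling n k)) (Q k * [:- c, 1:] ^ (e - k))"
      by (simp only: mult_smult_right ac_simps)
  qed
  finally have T: "T ([:- c, 1:] ^ n) = [:- c, 1:] ^ (n - e) * R" .
  have "poly R c = (\<Sum>k=0..e. if k = e then falling n e * poly (Q e) c else 0)"
    unfolding R_def poly_sum by (intro sum.cong) auto
  then have Rc: "poly R c \<noteq> 0" using c falling_pos[of e n] by (simp add: e_def)
  then have "[:- c, 1:] ^ (n - e) * R \<noteq> 0" by auto
  moreover from this have "order c ([:- c, 1:] ^ (n - e) * R) = (n - e) + 0"
    using Rc by (simp add: order_mult order_power_n_n order_0I del: mult_pCons_left)
  ultimately show ?thesis unfolding Z_def rpoly_replicate T by (simp add: e_def)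
qed

lemma size_Zpow: "M \<le> n \<Longrightarrow> size (Zpow n c) = n + r"
  using T_rpoly(2)[of "replicate_mset n c"] by simp

lemma count_above_Zpow_mono:
  assumes "M \<le> n" "c \<le> d"
  shows "count_above (Zpow n c) t \<le> count_above (Zpow n d) t"
  using count_above_Z_mono[of "replicate n c" "replicate n d" t] assms
  by (auto simp: list_all2_conv_all_nth)

text \<open>A zero \<open>x < s\<close> is refuted by some \<open>c\<close> between \<open>x\<close>
  and \<open>s\<close>: all zeros for \<open>c\<close> exceed \<open>x\<close>, and passing from
  \<open>c\<close> to \<open>s\<close> only moves zeros to the right.\<close>

lemma Zpow_ge_if_approx:
  assumes n: "M \<le> n" and s: "\<And>y. y < s \<Longrightarrow> \<exists>c. y < c \<and> c \<le> s \<and> (\<forall>x\<in>#Zpow n c. c \<le> x)"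
  shows "\<forall>x\<in>#Zpow n s. s \<le> x"
proof (rule ballI, rule ccontr)
  fix x assume x: "x \<in># Zpow n s" and "\<not> s \<le> x"
  then obtain c where c: "x < c" "c \<le> s" "\<forall>x\<in>#Zpow n c. c \<le> x" using s[of x] by auto
  have "count_above (Zpow n c) x = size (Zpow n c)"
    using c by (intro count_above_eq_size) force
  then have "n + r \<le> count_above (Zpow n s) x"
    using count_above_Zpow_mono[OF n c(2), of x] size_Zpow[OF n] by simp
  moreover have "count_above (Zpow n s) x \<le> n + r"
    using size_filter_mset_lesseq[of "\<lambda>y. x < y" "Zpow n s"] size_Zpow[OF n, of s]
    by (simp add: count_above_def)
  ultimately have "count_above (Zpow n s) x = size (Zpow n s)" using size_Zpow[OF n] by simp
  then show False using count_above_less_size[OF _ x] by blast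
qed

text \<open>The set of \<open>c\<close> below which no zero of \<open>T((z - c)^n)\<close> lies contains all sufficiently small \<open>c\<close>.
  It is closed on the right by monotonicity, and it can only end at a zero of \<open>Q (min n N)\<close>:
  elsewhere \<open>c\<close> is a zero of minimal possible multiplicity, which leaves room to increase \<open>c\<close>.\<close>

lemma Zpow_ge:
  assumes n: "M \<le> n" and nz: "\<And>x. x \<le> c1 \<Longrightarrow> poly (Q (min n N)) x \<noteq> 0"
  shows "\<forall>x\<in>#Zpow n c1. c1 \<le> x"
proof -
  define e where "e = min n N"
  define G where "G = {c. c \<le> c1 \<and> (\<forall>x\<in>#Zpow n c. c \<le> x)}"
  define s where "s = Sup G"
  obtain c0 where c0: "\<And>c x. c \<le> c0 \<Longrightarrow> x \<in># Zpow n c \<Longrightarrow> c \<le> x"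
    using Zpow_ge_eventually[OF n] by metis
  have G: "min c0 c1 \<in> G" using c0 by (auto simp: G_def)
  have bdd: "bdd_above G" by (auto simp: G_def intro: bdd_aboveI[of _ c1])
  have sc1: "s \<le> c1" unfolding s_def using G by (intro cSup_least) (blast, simp add: G_def)
  have gs: "\<forall>x\<in>#Zpow n s. s \<le> x"
  proof (rule Zpow_ge_if_approx[OF n])
    fix y assume "y < s"
    then obtain c where "c \<in> G" "y < c" unfolding s_def using less_cSup_iff[OF _ bdd] G by blast
    moreover have "c \<le> s" unfolding s_def by (rule cSup_upper[OF \<open>c \<in> G\<close> bdd])
    ultimately show "\<exists>c. y < c \<and> c \<le> s \<and> (\<forall>x\<in>#Zpow n c. c \<le> x)" by (auto simp: G_def)
  qed
  have "s = c1"
  proof (rule ccontr)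
    assume "s \<noteq> c1"
    with sc1 have slt: "s < c1" by simp
    obtain t where t: "s < t" "count_above (Zpow n s) t = count_above (Zpow n s) s"
      using count_above_right_limit[of "Zpow n s" "Zpow n s" s] by metis
    have part: "size A = count_above A u + size (filter_mset (\<lambda>x. x \<le> u) A)" for A u
      unfolding count_above_def using multiset_partition[of A "\<lambda>x. u < x"]
      by (metis (mono_tags, lifting) filter_mset_cong linorder_not_less size_union)
    have "filter_mset (\<lambda>x. x \<le> s) (Zpow n s) = filter_mset (\<lambda>x. x = s) (Zpow n s)"
      using gs by (intro filter_mset_cong) (auto intro: antisym)
    then have "size (filter_mset (\<lambda>x. x \<le> s) (Zpow n s)) = n - e"
      using count_Zpow[OF n nz[of s]] slt by (simp add: filter_eq_replicate_mset e_def)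
    \<comment> \<open>The \<open>n - e\<close> copies of \<open>s\<close> are the only zeros up to
      \<open>t\<close>; all the others lie beyond \<open>t\<close>.\<close>
    then have cs: "count_above (Zpow n s) t + (n - e) = n + r"
      using part[of "Zpow n s" s] size_Zpow[OF n, of s] t(2) by simp
    define c where "c = min t c1"
    have c: "s < c" "c \<le> c1" "c \<le> t" using t slt by (auto simp: c_def)
    have sz: "size (filter_mset (\<lambda>x. x \<le> t) (Zpow n c)) \<le> n - e"
      using part[of "Zpow n c" t] size_Zpow[OF n, of c] cs count_above_Zpow_mono[OF n, of s c t] c by simp
    have "c \<le> x" if x: "x \<in># Zpow n c" for x
    proof (rule ccontr)
      assume xc: "\<not> c \<le> x"
      \<comment> \<open>By monotonicity at most \<open>n - e\<close> zeros for \<open>c\<close> are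
        \<open>\<le> t\<close>. The zero \<open>c\<close> itself uses them all up, so a zero
        \<open>x < c\<close> would be one too many.\<close>
      have "add_mset x (replicate_mset (n - e) c) \<subseteq># filter_mset (\<lambda>x. x \<le> t) (Zpow n c)"
      proof (rule mset_subset_eqI)
        fix a show "count (add_mset x (replicate_mset (n - e) c)) a \<le> count (filter_mset (\<lambda>x. x \<le> t) (Zpow n c)) a"
          using count_Zpow[OF n nz[OF c(2)]] c xc x by (auto simp: e_def Suc_le_eq)
      qed
      from size_mset_mono[OF this] sz show False by simp
    qed
    then have "c \<in> G" using c by (auto simp: G_def)
    then have "c \<le> s" unfolding s_def using bdd by (rule cSup_upper)
    with c show False by simp
  qed
  with gs show ?thesis by simp
qed

lemma Q_min_nonzero: "M \<le> n \<Longrightarrow> Q (min n N) \<noteq> 0"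
  using top_coeff_sign[of "min n N"] MN by (auto simp: top_coeff_def)

text \<open>At the smallest zero itself \<open>Q (min n N)\<close> may vanish, so this value is
  reached from below through \<open>Zpow_ge_if_approx\<close>.\<close>

lemma Zpow_smallest_zero:
  assumes n: "M \<le> n" "0 < n" and c: "c \<le> smallest_zero (Q (min n N))"
  shows "\<forall>x\<in>#Zpow n c. c \<le> x"
proof -
  have H: "\<forall>x\<in>#Zpow n d. d \<le> x" if "d < smallest_zero (Q (min n N))" for d
    by (rule Zpow_ge[OF n(1)]) (use smallest_zero_less[OF Q_min_nonzero[OF n(1)]] that in force)
  have "\<exists>d. y < d \<and> d \<le> c \<and> (\<forall>x\<in>#Zpow n d. d \<le> x)" if "y < c" for y
  proof (intro exI conjI)
    show "\<forall>x\<in>#Zpow n ((y + c) / 2). (y + c) / 2 \<le> x" by (rule H, rule order_less_le_trans[OF _ c]) (use that in simp)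
  qed (use that in auto)
  then show ?thesis by (rule Zpow_ge_if_approx[OF n(1)])
qed

text \<open>For \<open>n \<le> N\<close> the multiplicity \<open>n - min n N\<close> of the zero
  \<open>c\<close> is \<open>0\<close>, which makes the inequality strict.\<close>

lemma Zpow_gt:
  assumes n: "M \<le> n" "0 < n" "n \<le> N" and c: "c < smallest_zero (Q (min n N))"
  shows "\<forall>x\<in>#Zpow n c. c < x"
proof -
  have "count (Zpow n c) c = n - min n N"
    by (rule count_Zpow[OF n(1) smallest_zero_less[OF Q_min_nonzero[OF n(1)] c]])
  then have "c \<notin># Zpow n c" using n by (simp add: count_eq_zero_iff)
  then show ?thesis using Zpow_smallest_zero[OF n(1,2), of c] c by (metis less_eq_real_def)
qed

end

subsection \<open>Restriction of lists to index sets\<close>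

lemma list_all2_nths: "list_all2 P xs ys \<Longrightarrow> list_all2 P (nths xs I) (nths ys I)"
proof (induction xs ys arbitrary: I rule: list_all2_induct)
  case (Cons x xs y ys)
  then show ?case by (auto simp: nths_Cons)
qed simp

lemma restrict_vec_snoc:
  "restrict_vec (xs @ [x]) S = restrict_vec xs S @ (if Suc (length xs) \<in> S then [x] else [])"
  by (auto simp: restrict_vec_def nths_append)

lemma mset_restrict_vec:
  "mset (restrict_vec xs S) = {# xs ! (i - 1). i \<in># mset_set (S \<inter> {1..length xs}) #}"
proof (induction xs rule: rev_induct)
  case Nil
  then show ?case by (simp add: restrict_vec_def)
next
  case (snoc x xs)
  have c: "image_mset (\<lambda>i. (xs @ [x]) ! (i - 1)) (mset_set (S \<inter> {1..length xs}))
      = image_mset (\<lambda>i. xs ! (i - 1)) (mset_set (S \<inter> {1..length xs}))"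
    by (rule image_mset_cong) (auto simp: nth_append)
  show ?case
  proof (cases "Suc (length xs) \<in> S")
    case True
    then have "S \<inter> {1..length (xs @ [x])} = insert (Suc (length xs)) (S \<inter> {1..length xs})" by auto
    then have "mset_set (S \<inter> {1..length (xs @ [x])}) = add_mset (Suc (length xs)) (mset_set (S \<inter> {1..length xs}))"
      by simp
    then show ?thesis using True by (simp add: restrict_vec_snoc snoc c[simplified])
  next
    case False
    then have "S \<inter> {1..length (xs @ [x])} = S \<inter> {1..length xs}"
      by (auto simp: le_Suc_eq)
    then show ?thesis using False by (simp add: restrict_vec_snoc snoc c[simplified])
  qed
qed

lemma length_restrict_vec:
  assumes "S \<subseteq> {1..length xs}"
  shows "length (restrict_vec xs S) = card S"
  using arg_cong[OF mset_restrict_vec[of xs S], of size] assms by (simp add: Int_absorb2)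

lemma restrict_vec_conv_map:
  "restrict_vec xs S = map ((!) xs) (nths [0..<length xs] {i. Suc i \<in> S})"
  unfolding restrict_vec_def by (metis map_nth nths_map)

lemma mset_nths_subset: "mset (nths xs I) \<subseteq># mset xs"
proof (induction xs arbitrary: I)
  case (Cons x xs)
  have "mset (nths xs J) \<subseteq># add_mset x (mset xs)" for J
    using Cons.IH[of J] by (metis add_mset_add_single mset_subset_eq_add_left subset_mset.trans)
  with Cons.IH show ?case by (simp add: nths_Cons)
qed simp

lemma sorted_restrict_vec: "sorted xs \<Longrightarrow> sorted (restrict_vec xs S)"
  unfolding restrict_vec_def by (rule sorted_nths)

lemma hyperbolic_monic: "hyperbolic f \<Longrightarrow> lead_coeff f = 1 \<Longrightarrow> f = rpoly (proots f)"
  by (metis hyperbolic_factor smult_1_left)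

text \<open>The zero pattern prescribes the root multiset of the second factor, and being monic it
  is then determined; cancelling it determines the first factor.\<close>

lemma pattern_factorization_rpoly:
  assumes p: "hyperbolic p" "degree p = n + r" and B: "B \<subseteq> {1..n + r}" "card B = n"
  shows "snd (pattern_factorization r n ({1..n + r} - B) B p) = rpoly (mset (restrict_vec (zeros p) B))"
proof -
  define A where "A = {1..n + r} - B"
  define zs where "zs = zeros p"
  define F where "F = mset (restrict_vec zs B)"
  define V where "V = mset (restrict_vec zs A)"
  define c where "c = lead_coeff p"
  have c0: "c \<noteq> 0" unfolding c_def using hyperbolic_nonzero[OF p(1)] by (simp only: leading_coeff_0_iff not_False_eq_True)
  have len: "length zs = n + r"
    using size_proots_hyperbolic[OF p(1)] p(2) by (simp add: zs_def zeros_def flip: size_mset)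
  have mzs: "mset zs = proots p" by (simp add: zs_def zeros_def)
  have fin: "finite A" "finite B" using B(1) finite_subset by (auto simp: A_def)
  have AB: "A \<union> B = {1..n + r}" "A \<inter> B = {}" using B by (auto simp: A_def)
  have cA: "card A = r" using B fin(2) by (simp add: A_def card_Diff_subset)
  have FV: "F = {# zs ! (i - 1). i \<in># mset_set B #}" "V = {# zs ! (i - 1). i \<in># mset_set A #}"
    using AB(1) B(1) by (auto simp: F_def V_def mset_restrict_vec len Int_absorb2 A_def)
  have "V + F = {# zs ! (i - 1). i \<in># mset_set (A \<union> B) #}"
    unfolding FV mset_set_Union[OF fin AB(2)] by simp
  also have "\<dots> = mset (restrict_vec zs {1..length zs})"
    by (simp add: AB len mset_restrict_vec)
  also have "restrict_vec zs {1..length zs} = zs"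
    unfolding restrict_vec_def by (rule nths_all) auto
  finally have VF: "V + F = proots p" by (simp add: mzs)
  have sz: "size F = n" "size V = r" using B cA by (simp_all add: FV)
  define v where "v = smult c (rpoly V)"
  have pvf: "p = v * rpoly F"
    using hyperbolic_factor[OF p(1)] unfolding v_def c_def VF[symmetric] rpoly_union by simp
  have zp: "zero_pattern r n A B v (rpoly F)"
    unfolding zero_pattern_def pvf[symmetric] zs_def[symmetric]
    using AB cA B c0 sz by (auto simp: v_def FV)
  have "pattern_factorization r n A B p = (v, rpoly F)"
    unfolding pattern_factorization_def
  proof (rule the_equality)
    show "case (v, rpoly F) of (v, f) \<Rightarrow> p = v * f \<and> lead_coeff f = 1 \<and> zero_pattern r n A B v f"
      using pvf zp by simp
    fix vf assume a: "case vf of (v, f) \<Rightarrow> p = v * f \<and> lead_coeff f = 1 \<and> zero_pattern r n A B v f"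
    obtain v' f' where vf: "vf = (v', f')" by (cases vf)
    with a have f': "p = v' * f'" "lead_coeff f' = 1" "zero_pattern r n A B v' f'" by auto
    have "proots f' = F" using f'(3) unfolding zero_pattern_def f'(1)[symmetric] zs_def[symmetric] FV by simp
    moreover have "hyperbolic f'" using f'(3) by (simp add: zero_pattern_def)
    ultimately have "f' = rpoly F" using hyperbolic_monic f'(2) by metis
    moreover from this have "v' = v" using f'(1) pvf by (metis mult_right_cancel rpoly_nonzero)
    ultimately show "vf = (v, rpoly F)" by (simp add: vf)
  qed
  then show ?thesis by (simp add: A_def F_def zs_def)
qed

subsection \<open>Limits of monotone sequences of root lists\<close>

lemma monotone_lists_converge:
  fixes X :: "nat \<Rightarrow> real list"
  assumes "\<And>i. list_all2 (\<le>) (X i) (X (Suc i))" "\<And>i. list_all2 (\<le>) (X i) U"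
  shows "\<exists>L. length L = length U \<and> (\<forall>j<length U. (\<lambda>i. X i ! j) \<longlonglongrightarrow> L ! j) \<and>
    (\<forall>i. list_all2 (\<le>) (X i) L)"
proof -
  have len: "length (X i) = length U" for i using assms(2) by (rule list_all2_lengthD)
  have inc: "incseq (\<lambda>i. X i ! j)" if "j < length U" for j
    using assms(1) that len by (intro incseq_SucI) (auto simp: list_all2_conv_all_nth)
  have conv: "(\<lambda>i. X i ! j) \<longlonglongrightarrow> lim (\<lambda>i. X i ! j)" if j: "j < length U" for j
  proof -
    have "X i ! j \<le> U ! j" for i using assms(2)[of i] j len by (auto simp: list_all2_conv_all_nth)
    then have "\<exists>L. (\<lambda>i. X i ! j) \<longlonglongrightarrow> L"
      using incseq_convergent[OF inc[OF j], of "U ! j"] by blast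
    then show ?thesis using convergent_LIMSEQ_iff convergent_def by metis
  qed
  define L where "L = map (\<lambda>j. lim (\<lambda>i. X i ! j)) [0..<length U]"
  have L: "length L = length U" "\<And>j. j < length U \<Longrightarrow> (\<lambda>i. X i ! j) \<longlonglongrightarrow> L ! j"
    using conv by (auto simp: L_def)
  have "list_all2 (\<le>) (X i) L" for i
    unfolding list_all2_conv_all_nth using L len incseq_le[OF inc L(2)] by auto
  with L show ?thesis by (intro exI[of _ L]) simp
qed

lemma rpoly_mset_conv_prod: "rpoly (mset xs) = (\<Prod>j<length xs. [:- xs ! j, 1:])"
  by (induction xs) (simp_all add: prod.lessThan_Suc_shift del: prod.lessThan_Suc mult_pCons_left)

lemma tendsto_coeff_rpoly:
  fixes X :: "nat \<Rightarrow> real list"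
  assumes "\<And>i. length (X i) = length L" "\<And>j. j < length L \<Longrightarrow> (\<lambda>i. X i ! j) \<longlonglongrightarrow> L ! j"
  shows "(\<lambda>i. coeff (rpoly (mset (X i))) k) \<longlonglongrightarrow> coeff (rpoly (mset L)) k"
proof -
  have "(\<lambda>i. coeff (\<Prod>j<m. [:- X i ! j, 1:]) k) \<longlonglongrightarrow> coeff (\<Prod>j<m. [:- L ! j, 1:]) k"
    if "m \<le> length L" for m
    using that
  proof (induction m arbitrary: k)
    case (Suc m)
    have e: "coeff (p * [:- a, 1:]) k = - a * coeff p k + (case k of 0 \<Rightarrow> 0 | Suc l \<Rightarrow> coeff p l)" for p and a :: real
      by (subst mult.commute) (simp add: coeff_pCons split: nat.splits)
    show ?case
    proof (cases k)
      case 0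
      then show ?thesis unfolding prod.lessThan_Suc e using Suc assms(2)[of m]
        by (auto intro!: tendsto_intros)
    next
      case (Suc l)
      then show ?thesis unfolding prod.lessThan_Suc e using Suc.IH Suc.prems assms(2)[of m]
        by (auto intro!: tendsto_intros)
    qed
  qed simp
  from this[of "length L"] show ?thesis by (simp add: rpoly_mset_conv_prod assms(1))
qed

context nd_op
begin

text \<open>Each coefficient of \<open>T f\<close> is a fixed linear form in finitely many
  coefficients of \<open>f\<close>, so coefficientwise limits pass through \<open>T\<close>.\<close>

lemma coeff_T_sum:
  assumes "degree f \<le> n"
  shows "coeff (T f) k = (\<Sum>j\<le>n. coeff f j * coeff (T (monom 1 j)) k)"
proof -
  have "f = (\<Sum>j\<le>n. smult (coeff f j) (monom 1 j))"
    using poly_as_sum_of_monoms'[OF assms] by (simp add: smult_monom)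
  moreover have "T (\<Sum>j\<in>J. smult (a j) (g j)) = (\<Sum>j\<in>J. smult (a j) (T (g j)))" for a g and J :: "nat set"
    by (induction J rule: infinite_finite_induct) (simp_all add: diff_op_add diff_op_smult)
  ultimately have "T f = (\<Sum>j\<le>n. smult (coeff f j) (T (monom 1 j)))" by metis
  then show ?thesis by (simp add: coeff_sum)
qed

section \<open>The iteration on sorted root lists and its limit\<close>

definition Zlist :: "real list \<Rightarrow> real list" where
  "Zlist xs = sorted_list_of_multiset (Z (mset xs))"

definition step :: "nat set \<Rightarrow> real list \<Rightarrow> real list" where
  "step B xs = restrict_vec (Zlist xs) B"

text \<open>The root lists of the iterates, with the starting point \<open>c\<close> left free so
  that two degrees can be started at the same point.\<close>

primrec iter :: "nat \<Rightarrow> nat set \<Rightarrow> real \<Rightarrow> nat \<Rightarrow> real list" where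
  "iter n B c 0 = replicate n c"
| "iter n B c (Suc i) = step B (iter n B c i)"

lemma length_Zlist: "M \<le> length xs \<Longrightarrow> length (Zlist xs) = length xs + r"
  using T_rpoly(2)[of "mset xs"] by (simp add: Zlist_def flip: size_mset)

lemma sorted_Zlist: "sorted (Zlist xs)"
  by (simp add: Zlist_def)

lemma mset_Zlist: "mset (Zlist xs) = Z (mset xs)"
  by (simp add: Zlist_def)

lemma Zlist_mono:
  assumes "list_all2 (\<le>) xs ys" "M \<le> length xs"
  shows "list_all2 (\<le>) (Zlist xs) (Zlist ys)"
  using assms list_all2_lengthD[OF assms(1)] length_Zlist[of xs] length_Zlist[of ys]
    count_above_Z_mono[OF assms]
  by (intro list_all2_le_if_count_above sorted_Zlist) (simp_all add: mset_Zlist)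

lemma step_mono:
  assumes "list_all2 (\<le>) xs ys" "M \<le> length xs"
  shows "list_all2 (\<le>) (step B xs) (step B ys)"
  unfolding step_def restrict_vec_def by (intro list_all2_nths Zlist_mono assms)

lemma length_step:
  assumes "M \<le> length xs" "B \<subseteq> {1..length xs + r}"
  shows "length (step B xs) = card B"
  using assms length_restrict_vec[of B "Zlist xs"] length_Zlist[of xs] by (simp add: step_def)

lemma sorted_step: "sorted (step B xs)"
  by (simp add: step_def sorted_restrict_vec sorted_Zlist)

lemma set_step_subset: "set (step B xs) \<subseteq> set_mset (Z (mset xs))"
  using set_nths_subset[of "Zlist xs"] unfolding step_def restrict_vec_def
  by (metis mset_Zlist set_mset_mset)

context
  fixes n :: nat and B :: "nat set"
  assumes n: "M \<le> n" and B: "B \<subseteq> {1..n + r}" "card B = n"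
begin

lemma length_iter: "length (iter n B c i) = n"
  by (induction i) (use n B length_step in auto)

lemma f_iter_eq: "f_iter Q M N r n B i = rpoly (mset (iter n B (smallest_zero (Q (min n N))) i))"
proof (induction i)
  case 0
  then show ?case by (simp add: rpoly_replicate)
next
  case (Suc i)
  let ?xs = "iter n B (smallest_zero (Q (min n N))) i"
  have len: "length ?xs = n" by (rule length_iter)
  have "diff_op Q M N f = T f" for f
    unfolding diff_op_def by (rule sum.mono_neutral_left) (auto simp: Q0)
  moreover have "hyperbolic (T (rpoly (mset ?xs)))" "degree (T (rpoly (mset ?xs))) = n + r"
    using T_rpoly[of "mset ?xs"] n len top_factor_nonzero[of n] by (simp, subst T_rpoly(1)) auto
  moreover have "zeros (T (rpoly (mset ?xs))) = Zlist ?xs"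
    by (simp add: zeros_def Zlist_def Z_def)
  ultimately show ?case
    using pattern_factorization_rpoly[OF _ _ B] by (simp add: Suc step_def)
qed

lemma iteration_converges:
  assumes start: "list_all2 (\<le>) (replicate n c) (step B (replicate n c))"
  shows "\<exists>L. length L = n \<and> (\<forall>j<n. (\<lambda>i. iter n B c i ! j) \<longlonglongrightarrow> L ! j) \<and>
    step B L = L \<and> (\<forall>i. list_all2 (\<le>) (iter n B c i) L)"
proof -
  have inc: "list_all2 (\<le>) (iter n B c i) (iter n B c (Suc i))" for i
  proof (induction i)
    case 0
    then show ?case using start by simp
  next
    case (Suc i)
    have "list_all2 (\<le>) (step B (iter n B c i)) (step B (iter n B c (Suc i)))"
      by (rule step_mono[OF Suc]) (simp add: length_iter n)
    then show ?case by simp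
  qed
  obtain c1 where c1: "\<And>c x. c1 \<le> c \<Longrightarrow> x \<in># Zpow n c \<Longrightarrow> x \<le> c"
    using Zpow_le_eventually[OF n] by metis
  \<comment> \<open>To the right of \<open>c1\<close> no zero of the image of
    \<open>(z - b)^n\<close> exceeds \<open>b\<close>, so the constant list \<open>b\<close> is
    mapped below itself and bounds all iterates.\<close>
  define b where "b = max c c1"
  have bst: "list_all2 (\<le>) (step B (replicate n b)) (replicate n b)"
    unfolding list_all2_conv_all_nth
  proof (intro conjI allI impI)
    show l: "length (step B (replicate n b)) = length (replicate n b)"
      using length_step[of "replicate n b" B] n B by simp
    fix i assume "i < length (step B (replicate n b))"
    moreover from this have "step B (replicate n b) ! i \<in># Zpow n b"
      using subsetD[OF set_step_subset nth_mem, of i B "replicate n b"] by simp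
    then have "step B (replicate n b) ! i \<le> b" by (rule c1[rotated]) (simp add: b_def)
    ultimately show "step B (replicate n b) ! i \<le> replicate n b ! i" using l by simp
  qed
  have trans: "list_all2 (\<le>) xs zs" if "list_all2 (\<le>) xs ys" "list_all2 (\<le>) ys zs" for xs ys zs :: "real list"
    by (rule list_all2_trans[OF _ that]) (rule order_trans)
  have bd: "list_all2 (\<le>) (iter n B c i) (replicate n b)" for i
  proof (induction i)
    case 0
    then show ?case by (simp add: list_all2_conv_all_nth b_def)
  next
    case (Suc i)
    have "list_all2 (\<le>) (step B (iter n B c i)) (step B (replicate n b))"
      by (rule step_mono[OF Suc]) (simp add: length_iter n)
    from trans[OF this bst] show ?case by simp
  qed
  obtain L where L: "length L = n" and L': "\<forall>j<n. (\<lambda>i. iter n B c i ! j) \<longlonglongrightarrow> L ! j"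
    "\<forall>i. list_all2 (\<le>) (iter n B c i) L"
    using monotone_lists_converge[of "iter n B c", OF inc bd] unfolding length_replicate by blast
  note L = L L'[rule_format]
  \<comment> \<open>Continuity of roots is replaced by monotonicity: the full lists of zeros of the
    images converge as well, and uniqueness of the coefficient limits identifies their limit
    \<open>W\<close> with the zeros of \<open>T (rpoly (mset L))\<close>.\<close>
  have incZ: "list_all2 (\<le>) (Zlist (iter n B c i)) (Zlist (iter n B c (Suc i)))" for i
    using Zlist_mono[OF inc] length_iter n by simp
  have bdZ: "list_all2 (\<le>) (Zlist (iter n B c i)) (Zlist (replicate n b))" for i
    using Zlist_mono[OF bd] length_iter n by simp
  have lb: "length (Zlist (replicate n b)) = n + r" using length_Zlist[of "replicate n b"] n by simp
  obtain W where W: "length W = n + r" and W': "\<forall>j<n + r. (\<lambda>i. Zlist (iter n B c i) ! j) \<longlonglongrightarrow> W ! j"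
    using monotone_lists_converge[of "\<lambda>i. Zlist (iter n B c i)", OF incZ bdZ] unfolding lb by blast
  note W = W W'[rule_format]
  have lenZ: "length (Zlist (iter n B c i)) = n + r" for i
    using length_Zlist[of "iter n B c i"] length_iter n by simp
  have sW: "sorted W"
    unfolding sorted_iff_nth_mono
  proof (intro allI impI)
    fix i j assume ij: "i \<le> j" "j < length W"
    show "W ! i \<le> W ! j"
    proof (rule LIMSEQ_le)
      show "(\<lambda>k. Zlist (iter n B c k) ! i) \<longlonglongrightarrow> W ! i" "(\<lambda>k. Zlist (iter n B c k) ! j) \<longlonglongrightarrow> W ! j"
        using ij W by auto
      show "\<exists>K. \<forall>k\<ge>K. Zlist (iter n B c k) ! i \<le> Zlist (iter n B c k) ! j"
        using ij W(1) lenZ sorted_Zlist sorted_nth_mono by metis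
    qed
  qed
  have "T (rpoly (mset L)) = smult (top_factor n) (rpoly (mset W))"
  proof (rule poly_eqI)
    fix k
    have cL: "(\<lambda>i. coeff (rpoly (mset (iter n B c i))) j) \<longlonglongrightarrow> coeff (rpoly (mset L)) j" for j
      using L length_iter by (intro tendsto_coeff_rpoly) auto
    have "(\<lambda>i. coeff (T (rpoly (mset (iter n B c i)))) k) \<longlonglongrightarrow> coeff (T (rpoly (mset L))) k"
      using L(1) length_iter coeff_T_sum[of _ n k]
      by (simp, intro tendsto_sum tendsto_mult cL tendsto_const)
    moreover have "(\<lambda>i. top_factor n * coeff (rpoly (mset (Zlist (iter n B c i)))) k) \<longlonglongrightarrow> top_factor n * coeff (rpoly (mset W)) k"
      using W lenZ by (intro tendsto_mult tendsto_const tendsto_coeff_rpoly) auto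
    moreover have "coeff (T (rpoly (mset (iter n B c i)))) k = top_factor n * coeff (rpoly (mset (Zlist (iter n B c i)))) k" for i
      using T_rpoly(1)[of "mset (iter n B c i)"] n length_iter by (simp add: mset_Zlist)
    ultimately show "coeff (T (rpoly (mset L))) k = coeff (smult (top_factor n) (rpoly (mset W))) k"
      using LIMSEQ_unique by simp
  qed
  then have "Z (mset L) = mset W" using top_factor_nonzero[OF n] by (simp add: Z_def)
  then have ZW: "Zlist L = W"
    unfolding Zlist_def using sW by (simp add: sorted_sort_id)
  have "step B L = L"
  proof (rule nth_equalityI)
    show l: "length (step B L) = length L" using length_step[of L B] L(1) n B by simp
    fix j assume j: "j < length (step B L)"
    \<comment> \<open>The selected positions are the same for every list of length
      \<open>n + r\<close>, so selection commutes with entrywise limits.\<close>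
    define g where "g = nths [0..<n + r] {i. Suc i \<in> B}"
    have g: "restrict_vec ys B = map ((!) ys) g" if "length ys = n + r" for ys :: "real list"
      using restrict_vec_conv_map[of ys B] that by (simp add: g_def)
    have lg: "length g = n"
      using length_restrict_vec[of B W] B W(1) g[OF W(1)] by simp
    have jn: "j < n" using j l L(1) by simp
    have "g ! j \<in> set g" using jn lg by simp
    then have gj: "g ! j < n + r"
      using set_nths_subset[of "[0..<n + r]"] unfolding g_def by fastforce
    have "iter n B c (Suc i) ! j = Zlist (iter n B c i) ! (g ! j)" for i
      using g[OF lenZ] jn lg by (simp add: step_def)
    then have "(\<lambda>i. iter n B c (Suc i) ! j) \<longlonglongrightarrow> W ! (g ! j)" using W(2)[OF gj] by simp
    moreover have "(\<lambda>i. iter n B c (Suc i) ! j) \<longlonglongrightarrow> L ! j" using L(2)[OF jn] by (rule LIMSEQ_Suc)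
    ultimately have "W ! (g ! j) = L ! j" by (rule LIMSEQ_unique)
    then show "step B L ! j = L ! j" using g[OF W(1)] jn lg by (simp add: step_def ZW)
  qed
  with L show ?thesis by (intro exI[of _ L]) simp
qed

lemma f_lim_eq:
  assumes "length L = n" "\<And>j. j < n \<Longrightarrow> (\<lambda>i. iter n B (smallest_zero (Q (min n N))) i ! j) \<longlonglongrightarrow> L ! j"
  shows "f_lim Q M N r n B = rpoly (mset L)"
proof -
  have c: "(\<lambda>i. coeff (f_iter Q M N r n B i) k) \<longlonglongrightarrow> coeff (rpoly (mset L)) k" for k
    unfolding f_iter_eq using assms length_iter by (intro tendsto_coeff_rpoly) auto
  show ?thesis
    unfolding f_lim_def
  proof (rule the_equality)
    show "\<forall>k. (\<lambda>i. coeff (f_iter Q M N r n B i) k) \<longlonglongrightarrow> coeff (rpoly (mset L)) k" using c by blast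
    show "f = rpoly (mset L)" if "\<forall>k. (\<lambda>i. coeff (f_iter Q M N r n B i) k) \<longlonglongrightarrow> coeff f k" for f
      by (rule poly_eqI) (rule LIMSEQ_unique[OF that[rule_format] c])
  qed
qed

lemma start_increasing:
  assumes "\<forall>x\<in>#Zpow n c. c \<le> x"
  shows "list_all2 (\<le>) (replicate n c) (step B (replicate n c))"
  unfolding list_all2_conv_all_nth
proof (intro conjI allI impI)
  show l: "length (replicate n c) = length (step B (replicate n c))"
    using length_step[of "replicate n c" B] n B by simp
  fix i assume "i < length (replicate n c)"
  then have "step B (replicate n c) ! i \<in> set (step B (replicate n c))" "i < n" using l by simp_all
  then show "replicate n c ! i \<le> step B (replicate n c) ! i"
    using set_step_subset[of B "replicate n c"] assms by auto
qed

lemma iter_mono: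
  assumes "c \<le> d"
  shows "list_all2 (\<le>) (iter n B c i) (iter n B d i)"
proof (induction i)
  case 0
  then show ?case using assms by (simp add: list_all2_conv_all_nth)
next
  case (Suc i)
  then show ?case using step_mono[OF Suc] length_iter n by simp
qed

text \<open>A fixed point of \<open>step\<close> has no zero \<open>d < a\<close>: otherwise it would dominate \<open>(z - d)^n\<close>,
  whose image under \<open>T\<close> has all its zeros strictly to the right of \<open>d\<close>.\<close>

lemma limit_independent:
  assumes n0: "0 < n" "n \<le> N" and c: "c \<le> smallest_zero (Q (min n N))" (is "c \<le> ?a")
  shows "\<exists>L. length L = n \<and> step B L = L \<and> (\<forall>j<n. (\<lambda>i. iter n B c i ! j) \<longlonglongrightarrow> L ! j) \<and>
    (\<forall>j<n. (\<lambda>i. iter n B ?a i ! j) \<longlonglongrightarrow> L ! j)"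
proof -
  obtain L where L: "length L = n" and L': "\<forall>j<n. (\<lambda>i. iter n B c i ! j) \<longlonglongrightarrow> L ! j"
    and Ls: "step B L = L"
    using iteration_converges[OF start_increasing[OF Zpow_smallest_zero[OF n n0(1) c]]] by blast
  note L = L L'[rule_format] Ls
  obtain K where K: "length K = n" and K': "\<forall>j<n. (\<lambda>i. iter n B ?a i ! j) \<longlonglongrightarrow> K ! j"
    and Ks: "step B K = K"
    using iteration_converges[OF start_increasing[OF Zpow_smallest_zero[OF n n0(1) order_refl]]] by blast
  note K = K K'[rule_format]
  have LK: "L ! j \<le> K ! j" if "j < n" for j
    using iter_mono[OF c] length_iter that
    by (intro LIMSEQ_le[OF L(2)[OF that] K(2)[OF that]]) (auto simp: list_all2_conv_all_nth)
  have sL: "sorted L" using sorted_step[of B L] L(3) by simp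
  have L0: "?a \<le> L ! 0"
  proof (rule ccontr)
    assume "\<not> ?a \<le> L ! 0"
    then have d: "L ! 0 < ?a" by simp
    define d where "d = L ! 0"
    have "list_all2 (\<le>) (replicate n d) L"
      using sL L(1) by (auto simp: list_all2_conv_all_nth d_def sorted_iff_nth_mono)
    then have "count_above (Z (mset (replicate n d))) d \<le> count_above (Z (mset L)) d"
      by (rule count_above_Z_mono) (simp add: n)
    moreover have "count_above (Zpow n d) d = size (Zpow n d)"
      using Zpow_gt[OF n n0(1,2)] d by (intro count_above_eq_size) (auto simp: d_def)
    moreover have "size (Zpow n d) = n + r" "size (Z (mset L)) = n + r"
      using size_Zpow[OF n] T_rpoly(2)[of "mset L"] L(1) n by auto
    moreover have "count_above (Z (mset L)) d \<le> size (Z (mset L))"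
      unfolding count_above_def by (rule size_filter_mset_lesseq)
    ultimately have "count_above (Z (mset L)) d = size (Z (mset L))" by simp
    moreover have "d \<in># Z (mset L)"
      using set_step_subset[of B L] L(1,3) n0 nth_mem[of 0 L] by (auto simp: d_def)
    ultimately show False using count_above_less_size by blast
  qed
  \<comment> \<open>Since \<open>L\<close> dominates the start at \<open>?a\<close> and is fixed by
    the monotone map \<open>step B\<close>, it dominates all iterates from there, hence their limit
    \<open>K\<close>.\<close>
  have aL: "list_all2 (\<le>) (iter n B ?a i) L" for i
  proof (induction i)
    case 0
    have "L ! 0 \<le> L ! j" if "j < n" for j using sL L(1) that by (auto simp: sorted_iff_nth_mono)
    then show ?case using L0 L(1) by (force simp: list_all2_conv_all_nth)
  next
    case (Suc i)
    have "list_all2 (\<le>) (step B (iter n B ?a i)) (step B L)"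
      by (rule step_mono[OF Suc]) (simp add: length_iter n)
    then show ?case using L(3) by simp
  qed
  have "K ! j \<le> L ! j" if "j < n" for j
    using aL length_iter that
    by (intro LIMSEQ_le_const2[OF K(2)[OF that]]) (auto simp: list_all2_conv_all_nth)
  with LK have "L ! j = K ! j" if "j < n" for j using that by (simp add: antisym)
  then have "L = K" using L(1) K(1) by (intro nth_equalityI) auto
  then show ?thesis using L K by (intro exI[of _ L]) simp
qed

end

end

subsection \<open>Differential operators with constant coefficients\<close>

lemma higher_pderiv_diff: "(pderiv ^^ k) (f - g :: real poly) = (pderiv ^^ k) f - (pderiv ^^ k) g"
  by (induction k) (simp_all add: pderiv_diff)

lemma pderiv_sum: "pderiv (sum f A) = (\<Sum>x\<in>A. pderiv (f x))"
  using higher_pderiv_sum[of 1 f A] by simp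

definition const_op :: "real poly \<Rightarrow> real poly \<Rightarrow> real poly" where
  "const_op P f = (\<Sum>k\<le>degree P. smult (coeff P k) ((pderiv ^^ k) f))"

lemma const_op_bound:
  assumes "degree P \<le> d"
  shows "const_op P f = (\<Sum>k\<le>d. smult (coeff P k) ((pderiv ^^ k) f))"
  unfolding const_op_def using assms by (intro sum.mono_neutral_left) (auto simp: coeff_eq_0)

lemma const_op_add: "const_op (P + R) f = const_op P f + const_op R f"
proof -
  define d where "d = max (degree P) (degree R)"
  have "degree P \<le> d" "degree R \<le> d" "degree (P + R) \<le> d"
    using degree_add_le_max[of P R] by (auto simp: d_def)
  then show ?thesis by (simp add: const_op_bound[where d = d] smult_add_left sum.distrib)
qed

lemma const_op_smult: "const_op (smult c P) f = smult c (const_op P f)"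
  using const_op_bound[OF degree_smult_le[of c P], of f] by (simp add: const_op_def smult_sum_right)

lemma const_op_diff: "const_op P (f - g) = const_op P f - const_op P g"
  by (simp add: const_op_def higher_pderiv_diff smult_diff_right sum_subtractf)

lemma const_op_smult_right: "const_op P (smult c f) = smult c (const_op P f)"
  by (simp add: const_op_def higher_pderiv_smult smult_sum_right mult.commute)

lemma const_op_one [simp]: "const_op 1 f = f"
  by (simp add: const_op_def)

lemma const_op_pCons_0: "const_op (pCons 0 P) f = const_op P (pderiv f)"
proof -
  have "const_op (pCons 0 P) f = (\<Sum>k\<le>Suc (degree P). smult (coeff (pCons 0 P) k) ((pderiv ^^ k) f))"
    by (rule const_op_bound) (rule degree_pCons_le)
  also have "\<dots> = const_op P (pderiv f)"
    unfolding sum.atMost_Suc_shift const_op_def by (simp add: funpow_swap1)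
  finally show ?thesis .
qed

lemma const_op_linear_factor: "const_op ([:- \<alpha>, 1:] * P) f = const_op P (pderiv f - smult \<alpha> f)"
proof -
  have "[:- \<alpha>, 1:] * P = smult (- \<alpha>) P + pCons 0 P" by simp
  then have "const_op ([:- \<alpha>, 1:] * P) f = smult (- \<alpha>) (const_op P f) + const_op P (pderiv f)"
    by (simp only: const_op_add const_op_smult const_op_pCons_0)
  also have "\<dots> = const_op P (pderiv f - smult \<alpha> f)" by (simp add: const_op_diff const_op_smult_right)
  finally show ?thesis .
qed

lemma pencil_span:
  assumes "pencil u v"
  shows "pencil (smult a u + smult b v) (smult c u + smult d v)"
  unfolding pencil_def
proof (intro allI)
  fix s t
  have "smult s (smult a u + smult b v) + smult t (smult c u + smult d v)
      = smult (s * a + t * c) u + smult (s * b + t * d) v"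
    by (simp add: smult_add_right smult_add_left)
  then show "smult s (smult a u + smult b v) + smult t (smult c u + smult d v) = 0 \<or>
      hyperbolic (smult s (smult a u + smult b v) + smult t (smult c u + smult d v))"
    using assms unfolding pencil_def by metis
qed

lemma pencil_pderiv_diff:
  assumes "pencil u v"
  shows "pencil (pderiv u - smult \<alpha> u) (pderiv v - smult \<alpha> v)"
  unfolding pencil_def
proof (intro allI)
  fix s t
  let ?h = "smult s u + smult t v"
  have e: "smult s (pderiv u - smult \<alpha> u) + smult t (pderiv v - smult \<alpha> v) = pderiv ?h - smult \<alpha> ?h"
    by (simp add: pderiv_add pderiv_smult smult_diff_right smult_add_right mult.commute)
  show "smult s (pderiv u - smult \<alpha> u) + smult t (pderiv v - smult \<alpha> v) = 0 \<or>
      hyperbolic (smult s (pderiv u - smult \<alpha> u) + smult t (pderiv v - smult \<alpha> v))"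
    unfolding e using assms Hermite_Poulain[of ?h \<alpha>] unfolding pencil_def
    by (cases "?h = 0") auto
qed

text \<open>If the order \<open>s\<close> of \<open>u\<close> were at most \<open>m\<close>, then
  \<open>(z - \<theta>)^s\<close> would divide both \<open>u' - \<alpha> u\<close> and
  \<open>\<alpha> u\<close>, hence \<open>u'\<close>, which has order only
  \<open>s - 1\<close>.\<close>

lemma order_ge_Suc_if_pderiv_diff:
  assumes u: "u \<noteq> 0" "poly u \<theta> = 0" and m: "m \<le> order \<theta> (pderiv u - smult \<alpha> u)"
    and nz: "pderiv u - smult \<alpha> u \<noteq> (0 :: real poly)"
  shows "Suc m \<le> order \<theta> u"
proof (rule ccontr)
  assume c: "\<not> Suc m \<le> order \<theta> u"
  have "pderiv u \<noteq> 0"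
  proof
    assume "pderiv u = 0"
    then obtain c where "u = [:c:]" by (auto simp: pderiv_eq_0_iff elim: degree_eq_zeroE)
    with u show False by simp
  qed
  have o: "order \<theta> u = Suc (order \<theta> (pderiv u))" by (rule order_pderiv[OF u])
  let ?s = "order \<theta> u"
  have "[:- \<theta>, 1:] ^ ?s dvd pderiv u - smult \<alpha> u"
    using c m nz by (subst order_divides) auto
  moreover have "[:- \<theta>, 1:] ^ ?s dvd smult \<alpha> u" by (rule dvd_smult[OF order_1])
  ultimately have "[:- \<theta>, 1:] ^ ?s dvd (pderiv u - smult \<alpha> u) + smult \<alpha> u" by (rule dvd_add)
  then have "[:- \<theta>, 1:] ^ ?s dvd pderiv u" by simp
  then have "?s \<le> order \<theta> (pderiv u)" using \<open>pderiv u \<noteq> 0\<close> by (simp add: order_divides)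
  then show False using o by simp
qed

text \<open>If \<open>P(D)\<close> maps both members of a pencil to polynomials vanishing at \<open>\<theta>\<close>, then every
  factor \<open>D - \<alpha>\<close> raises the multiplicity: some member \<open>h\<close> of the pencil vanishes at \<open>\<theta>\<close>, and
  \<open>h' = \<alpha> h\<close> there makes \<open>\<theta>\<close> a double zero, which forces \<open>\<theta>\<close> to be a zero of all members.\<close>

lemma pencil_common_zero:
  assumes "pencil u v" "degree u = n" "u \<noteq> 0" "degree v = Suc n" "count A 0 \<le> n"
    and "poly (const_op (rpoly A) u) \<theta> = 0" "poly (const_op (rpoly A) v) \<theta> = 0"
  shows "Suc (size A) \<le> order \<theta> u \<and> Suc (size A) \<le> order \<theta> v"
  using assms
proof (induction A arbitrary: u v n)
  case empty
  then have "v \<noteq> 0" by auto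
  then have "order \<theta> u \<noteq> 0" "order \<theta> v \<noteq> 0" using empty order_root[of u \<theta>] order_root[of v \<theta>] by auto
  then show ?case by auto
next
  case (add \<alpha> A)
  define u1 v1 where "u1 = pderiv u - smult \<alpha> u" and "v1 = pderiv v - smult \<alpha> v"
  have v0: "v \<noteq> 0" using add.prems by auto
  have p1: "pencil u1 v1" unfolding u1_def v1_def by (rule pencil_pderiv_diff[OF add.prems(1)])
  have z1: "poly (const_op (rpoly A) u1) \<theta> = 0" "poly (const_op (rpoly A) v1) \<theta> = 0"
    using add.prems(6,7) unfolding u1_def v1_def by (simp_all only: rpoly_add_mset const_op_linear_factor)
  \<comment> \<open>Only a factor with \<open>\<alpha> = 0\<close> lowers the degrees, by one each
    time; the hypothesis on \<open>count A 0\<close> guarantees that the first polynomial never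
    becomes \<open>0\<close>.\<close>
  have deg: "\<exists>n1. degree u1 = n1 \<and> u1 \<noteq> 0 \<and> degree v1 = Suc n1 \<and> count A 0 \<le> n1"
  proof (cases "\<alpha> = 0")
    case True
    then have "n \<ge> 1" "count A 0 \<le> n - 1" using add.prems(5) by auto
    moreover have "degree u1 = n - 1" "degree v1 = n" using True add.prems(2,4)
      by (auto simp: u1_def v1_def degree_pderiv)
    moreover have "u1 \<noteq> 0" using True add.prems(2) \<open>n \<ge> 1\<close> by (auto simp: u1_def pderiv_eq_0_iff)
    ultimately show ?thesis by auto
  next
    case False
    have d: "degree (pderiv w - smult \<alpha> w) = degree w \<and> pderiv w - smult \<alpha> w \<noteq> 0" if "w \<noteq> 0" for w
    proof -
      have "coeff (pderiv w) (degree w) = 0" by (simp add: coeff_pderiv coeff_eq_0)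
      then have "coeff (pderiv w - smult \<alpha> w) (degree w) \<noteq> 0" using False that by simp
      moreover have "degree (pderiv w - smult \<alpha> w) \<le> degree w"
        using False by (intro degree_diff_le) (auto simp: degree_pderiv)
      ultimately show ?thesis by (auto intro!: le_antisym le_degree)
    qed
    show ?thesis using d[OF add.prems(3)] d[OF v0] add.prems(2,4,5) False
      unfolding u1_def[symmetric] v1_def[symmetric] by auto
  qed
  then obtain n1 where n1: "degree u1 = n1" "u1 \<noteq> 0" "degree v1 = Suc n1" "count A 0 \<le> n1" by blast
  have IH: "Suc (size A) \<le> order \<theta> u1 \<and> Suc (size A) \<le> order \<theta> v1"
    by (rule add.IH[OF p1 n1 z1])
  have v10: "v1 \<noteq> 0" using n1 by auto
  have u1z: "poly u1 \<theta> = 0" and v1z: "poly v1 \<theta> = 0"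
    using IH n1(2) v10 by (metis Suc_neq_Zero le_zero_eq order_0I)+
  have common: "poly u \<theta> = 0 \<and> poly v \<theta> = 0"
  proof (rule ccontr)
    assume c: "\<not> ?thesis"
    \<comment> \<open>The combination that vanishes at \<theta>, nonzero because the two degrees
      differ.\<close>
    define h where "h = smult (poly v \<theta>) u + smult (- poly u \<theta>) v"
    have h0: "h \<noteq> 0"
    proof
      assume "h = 0"
      then have e: "smult (poly v \<theta>) u = smult (poly u \<theta>) v" by (simp add: h_def)
      show False
      proof (cases "poly u \<theta> = 0")
        case True
        then show False using e c add.prems(3) by simp
      next
        case False
        then have "degree (smult (poly u \<theta>) v) = Suc n" using add.prems(4) by simp
        then show False using degree_smult_le[of "poly v \<theta>" u] add.prems(2) unfolding e by simp
      qed
    qed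
    have ph: "pencil (smult a u + smult b v) h" for a b
      unfolding h_def by (rule pencil_span[OF add.prems(1)])
    have "poly (pderiv u) \<theta> = \<alpha> * poly u \<theta>" "poly (pderiv v) \<theta> = \<alpha> * poly v \<theta>"
      using u1z v1z by (simp_all add: u1_def v1_def)
    then have hz: "poly h \<theta> = 0" "poly (pderiv h) \<theta> = 0"
      by (simp_all add: h_def pderiv_add pderiv_smult pderiv_diff pderiv_minus)
    have "2 \<le> order \<theta> h"
    proof (cases "pderiv h = 0")
      case True
      then obtain c where "h = [:c:]" by (auto simp: pderiv_eq_0_iff elim: degree_eq_zeroE)
      then show ?thesis using h0 hz by simp
    next
      case False
      then have "order \<theta> (pderiv h) \<noteq> 0" using hz by (simp add: order_root)
      then show ?thesis unfolding order_pderiv[OF h0 hz(1)] by simp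
    qed
    \<comment> \<open>Against a member \<open>w\<close> of order \<open>0\<close> at \<theta>, a
      member \<open>h\<close> of the same pencil can have order at most \<open>1\<close>.\<close>
    moreover obtain w where w: "pencil w h" "poly w \<theta> \<noteq> 0"
      using c ph[of 1 0] ph[of 0 1] by auto
    then have "order \<theta> w = 0" "w \<noteq> 0" using order_0I by auto
    then have "order \<theta> h \<le> 1" using pencil_order_le[OF w(1) _ h0, of \<theta>] by simp
    ultimately show False by simp
  qed
  have "Suc (Suc (size A)) \<le> order \<theta> u"
    by (rule order_ge_Suc_if_pderiv_diff[where \<alpha> = \<alpha>])
      (use add.prems(3) common IH n1(2) in \<open>simp_all add: u1_def\<close>)
  moreover have "Suc (Suc (size A)) \<le> order \<theta> v"
    by (rule order_ge_Suc_if_pderiv_diff[where \<alpha> = \<alpha>])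
      (use v0 common IH v10 in \<open>simp_all add: v1_def\<close>)
  ultimately show ?case by simp
qed

subsection \<open>Symbols of derivatives of the operator\<close>

text \<open>The coefficients of \<open>D T\<close>, by the product rule applied to
  \<open>D (Q j D^j)\<close>.\<close>

definition deriv_op :: "(nat \<Rightarrow> real poly) \<Rightarrow> nat \<Rightarrow> real poly" where
  "deriv_op Q k = pderiv (Q k) + (case k of 0 \<Rightarrow> 0 | Suc j \<Rightarrow> Q j)"

definition real_symbol :: "(nat \<Rightarrow> real poly) \<Rightarrow> nat \<Rightarrow> real \<Rightarrow> real poly" where
  "real_symbol Q N \<theta> = (\<Sum>k=0..N. monom (poly (Q k) \<theta>) k)"

lemma coeff_real_symbol: "coeff (real_symbol Q N \<theta>) k = (if k \<le> N then poly (Q k) \<theta> else 0)"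
  by (auto simp: real_symbol_def coeff_sum)

lemma degree_real_symbol_le: "degree (real_symbol Q N \<theta>) \<le> N"
  by (rule degree_le) (auto simp: coeff_real_symbol)

text \<open>Freezing the coefficients of the operator at \<theta> does not change the value at
  \<theta> itself.\<close>

lemma poly_const_op_real_symbol: "poly (const_op (real_symbol Q N \<theta>) f) \<theta> = poly (diff_op Q 0 N f) \<theta>"
  by (simp add: const_op_bound[OF degree_real_symbol_le] diff_op_def poly_sum coeff_real_symbol atLeast0AtMost)

lemma diff_op_deriv_op:
  assumes "\<And>k. N < k \<Longrightarrow> Q k = 0"
  shows "diff_op (deriv_op Q) 0 (Suc N) f = pderiv (diff_op Q 0 N f)"
proof -
  have "diff_op (deriv_op Q) 0 (Suc N) f = (\<Sum>k\<le>Suc N. pderiv (Q k) * (pderiv ^^ k) f) +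
      (\<Sum>k\<le>Suc N. (case k of 0 \<Rightarrow> 0 | Suc j \<Rightarrow> Q j) * (pderiv ^^ k) f)"
    by (simp only: diff_op_def deriv_op_def distrib_right sum.distrib atLeast0AtMost)
  also have "(\<Sum>k\<le>Suc N. (case k of 0 \<Rightarrow> 0 | Suc j \<Rightarrow> Q j) * (pderiv ^^ k) f) = (\<Sum>k\<le>N. Q k * pderiv ((pderiv ^^ k) f))"
    unfolding sum.atMost_Suc_shift by simp
  also have "(\<Sum>k\<le>Suc N. pderiv (Q k) * (pderiv ^^ k) f) = (\<Sum>k\<le>N. pderiv (Q k) * (pderiv ^^ k) f)"
    by (simp add: assms)
  finally show ?thesis
    by (simp add: diff_op_def atLeast0AtMost pderiv_sum pderiv_mult sum.distrib mult.commute add.commute)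
qed

lemma hyp_op_deriv_op:
  assumes "hyp_op Q N" "\<And>k. N < k \<Longrightarrow> Q k = 0"
  shows "hyp_op (deriv_op Q) (Suc N)"
proof
  interpret hyp_op Q N by fact
  show "deriv_op Q (Suc N) \<noteq> 0" using QN assms(2)[of "Suc N"] by (simp add: deriv_op_def)
  show "hyperbolicity_preserver (diff_op (deriv_op Q) 0 (Suc N))"
    unfolding hyperbolicity_preserver_def
  proof (intro allI impI)
    fix f assume f: "hyperbolic f"
    show "hyperbolic (diff_op (deriv_op Q) 0 (Suc N) f) \<or> diff_op (deriv_op Q) 0 (Suc N) f = 0"
      using T_hyperbolic[OF f] Hermite_Poulain[of "T f" 0]
      by (cases "T f = 0") (auto simp: diff_op_deriv_op[OF assms(2)])
  qed
qed

lemma Im_sum_inverse_nonpos: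
  assumes "\<forall>\<zeta>\<in>#A. Im \<zeta> \<le> 0"
  shows "Im (\<Sum>\<zeta>\<in>#A. 1 / (of_real \<theta> - \<zeta>)) \<le> 0"
  using assms
proof (induction A)
  case (add \<zeta> A)
  have "Im (1 / (of_real \<theta> - \<zeta>)) \<le> 0"
    using add.prems by (simp add: Im_divide divide_le_0_iff)
  with add show ?case by simp
qed simp

text \<open>For fixed \<open>w\<close> the symbol is a polynomial \<open>H\<close> in
  \<open>x\<close>, with no zeros in the upper half plane by stability. The symbol of
  \<open>D T\<close> at \<theta> is
  \<open>H'(\<theta>) + w H(\<theta>) = (s + w) H(\<theta>)\<close> with
  \<open>Im s \<le> 0\<close>, so the imaginary parts of \<open>s\<close> and \<open>w\<close>
  cannot cancel.\<close>

lemma (in hyp_op) real_symbol_deriv_growth: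
  assumes Qz: "\<And>k. N < k \<Longrightarrow> Q k = 0" and w: "Im w < 0"
  shows "- Im w * cmod (poly (cp (real_symbol Q N \<theta>)) w) \<le> cmod (poly (cp (real_symbol (deriv_op Q) (Suc N) \<theta>)) w)"
proof -
  define H where "H = (\<Sum>k\<le>N. smult (w ^ k) (cp (Q k)))"
  have Hx: "poly H x = poly (symbol x) w" for x
    by (simp add: H_def poly_symbol poly_sum atLeast0AtMost mult.commute)
  have P: "poly (cp (real_symbol Q N \<theta>)) w = poly H (of_real \<theta>)"
    by (simp add: H_def real_symbol_def cp_sum poly_sum atLeast0AtMost map_poly_monom poly_monom mult.commute)
  have "poly (cp (real_symbol (deriv_op Q) (Suc N) \<theta>)) w = (\<Sum>k\<le>Suc N. of_real (poly (deriv_op Q k) \<theta>) * w ^ k)"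
    by (simp add: real_symbol_def cp_sum poly_sum atLeast0AtMost map_poly_monom poly_monom del: sum.atMost_Suc)
  also have "\<dots> = (\<Sum>k\<le>Suc N. of_real (poly (pderiv (Q k)) \<theta>) * w ^ k) +
      (\<Sum>k\<le>Suc N. of_real (poly (case k of 0 \<Rightarrow> 0 | Suc j \<Rightarrow> Q j) \<theta>) * w ^ k)"
    by (simp only: deriv_op_def poly_add of_real_add distrib_right sum.distrib)
  also have "(\<Sum>k\<le>Suc N. of_real (poly (case k of 0 \<Rightarrow> 0 | Suc j \<Rightarrow> Q j) \<theta>) * w ^ k) = w * poly H (of_real \<theta>)"
    unfolding sum.atMost_Suc_shift by (simp add: H_def poly_sum sum_distrib_left algebra_simps)
  also have "(\<Sum>k\<le>Suc N. of_real (poly (pderiv (Q k)) \<theta>) * w ^ k) = poly (pderiv H) (of_real \<theta>)"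
    by (simp add: H_def pderiv_sum pderiv_smult poly_sum Qz mult.commute flip: cp_pderiv)
  finally have P1: "poly (cp (real_symbol (deriv_op Q) (Suc N) \<theta>)) w = poly (pderiv H) (of_real \<theta>) + w * poly H (of_real \<theta>)" .
  show ?thesis
  proof (cases "poly H (of_real \<theta>) = 0")
    case True
    then show ?thesis by (simp add: P)
  next
    case False
    then have H0: "H \<noteq> 0" by auto
    have fac: "H = smult (lead_coeff H) (rpoly (proots H))"
      unfolding rpoly_def by (rule complex_poly_decompose_multiset[symmetric])
    obtain c A where cA: "H = smult c (rpoly A)" "A = proots H" using fac by blast
    have "\<forall>\<zeta>\<in>#A. Im \<zeta> \<le> 0"
    proof
      fix \<zeta> assume "\<zeta> \<in># A"
      then have "poly H \<zeta> = 0" using H0 by (simp add: cA(2))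
      then show "Im \<zeta> \<le> 0" using symbol_stable[OF _ w, of \<zeta>] unfolding Hx by linarith
    qed
    moreover have "of_real \<theta> \<notin># A" using False H0 by (simp add: cA(2))
    ultimately obtain s where s: "poly (pderiv (rpoly A)) (of_real \<theta>) = s * poly (rpoly A) (of_real \<theta>)" "Im s \<le> 0"
      using poly_pderiv_rpoly Im_sum_inverse_nonpos by metis
    have "poly (pderiv H) (of_real \<theta>) = s * poly H (of_real \<theta>)"
      unfolding cA(1) by (simp add: pderiv_smult s(1))
    then have "poly (cp (real_symbol (deriv_op Q) (Suc N) \<theta>)) w = (s + w) * poly H (of_real \<theta>)"
      unfolding P1 by (simp add: algebra_simps)
    moreover have "- Im w \<le> cmod (s + w)"
      using abs_Im_le_cmod[of "s + w"] s(2) w by simp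
    then have "- Im w * cmod (poly H (of_real \<theta>)) \<le> cmod (s + w) * cmod (poly H (of_real \<theta>))"
      by (rule mult_right_mono) simp
    ultimately show ?thesis by (simp only: P norm_mult)
  qed
qed

text \<open>Along \<open>w = - \<i> t\<close> the bound compares \<open>R\<close> with
  \<open>w P\<close>: letting \<open>t\<close> tend to infinity compares degrees, letting
  \<open>t\<close> tend to \<open>0\<close> compares orders at \<open>0\<close>.\<close>

lemma growth_imp_degree_order:
  fixes P R :: "real poly"
  assumes P: "P \<noteq> 0" and g: "\<And>w. Im w < 0 \<Longrightarrow> - Im w * cmod (poly (cp P) w) \<le> cmod (poly (cp R) w)"
  shows "R \<noteq> 0 \<and> Suc (degree P) \<le> degree R \<and> order 0 R \<le> Suc (order 0 P)"
proof (intro conjI)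
  have g': "cmod (poly (cp (pCons 0 P)) (- \<i> * of_real t)) \<le> cmod (poly (cp R) (- \<i> * of_real t))" if "t > 0" for t
    using g[of "- \<i> * of_real t"] that by (simp add: norm_mult)
  show d: "Suc (degree P) \<le> degree R"
  proof (rule ccontr)
    assume "\<not> Suc (degree P) \<le> degree R"
    then have "degree (cp R) < degree (cp (pCons 0 P))" using P by simp
    then have l: "((\<lambda>z. poly (cp R) z / poly (cp (pCons 0 P)) z) \<longlongrightarrow> 0) at_infinity"
      by (rule poly_divide_tendsto_0_at_infinity)
    have "filterlim (\<lambda>t. - \<i> * complex_of_real t) at_infinity at_top"
      unfolding filterlim_at_infinity_conv_norm_at_top
      by (simp add: norm_mult filterlim_abs_real)
    from filterlim_compose[OF l this]
    have "((\<lambda>t. poly (cp R) (- \<i> * of_real t) / poly (cp (pCons 0 P)) (- \<i> * of_real t)) \<longlongrightarrow> 0) at_top" .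
    then have "((\<lambda>t. cmod (poly (cp R) (- \<i> * of_real t) / poly (cp (pCons 0 P)) (- \<i> * of_real t))) \<longlongrightarrow> 0) at_top"
      by (rule tendsto_norm_zero)
    moreover have "eventually (\<lambda>t. 1 \<le> cmod (poly (cp R) (- \<i> * of_real t) / poly (cp (pCons 0 P)) (- \<i> * of_real t))) at_top"
    proof -
      have "finite {z. poly (cp (pCons 0 P)) z = 0}" using P by (intro poly_roots_finite) simp
      then have "bounded {z. poly (cp (pCons 0 P)) z = 0}" by (rule finite_imp_bounded)
      then obtain b where b: "\<And>z. poly (cp (pCons 0 P)) z = 0 \<Longrightarrow> cmod z \<le> b"
        unfolding bounded_iff by blast
      show ?thesis
        using eventually_gt_at_top[of "max 0 b"]
      proof eventually_elim
        case (elim t)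
        then have "poly (cp (pCons 0 P)) (- \<i> * of_real t) \<noteq> 0"
          using b[of "- \<i> * of_real t"] by (auto simp: norm_mult)
        then show ?case using g'[of t] elim unfolding norm_divide by (subst le_divide_eq_1_pos) auto
      qed
    qed
    ultimately have "1 \<le> (0::real)"
      by (intro tendsto_lowerbound) auto
    then show False by simp
  qed
  then show R: "R \<noteq> 0" by auto
  show "order 0 R \<le> Suc (order 0 P)"
  proof (rule ccontr)
    assume c: "\<not> order 0 R \<le> Suc (order 0 P)"
    define j where "j = order 0 P"
    obtain P1 where P1: "P = [:- 0, 1:] ^ j * P1" "\<not> [:- 0, 1:] dvd P1"
      using order_decomp[OF P, of 0] unfolding j_def by blast
    have "[:- 0, 1:] ^ (j + 2) dvd R" using c R by (subst order_divides) (auto simp: j_def)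
    then obtain P2 where P2: "R = [:- 0, 1:] ^ (j + 2) * P2" by (elim dvdE)
    have nz: "poly P1 0 \<noteq> 0" using P1(2) by (simp add: poly_eq_0_iff_dvd)
    have le: "cmod (poly (cp P1) (- \<i> * of_real t)) \<le> t * cmod (poly (cp P2) (- \<i> * of_real t))" if t: "t > 0" for t
    proof -
      let ?w = "- \<i> * complex_of_real t"
      have pw: "poly (cp ([:- 0, 1:] ^ m)) ?w = ?w ^ m" for m
        by (induction m) (simp_all add: cp_mult del: mult_pCons_left)
      have "t * (t ^ j * cmod (poly (cp P1) ?w)) \<le> t ^ (j + 2) * cmod (poly (cp P2) ?w)"
        using g[of ?w] t unfolding P1(1) P2 cp_mult poly_mult pw
        by (simp add: norm_mult norm_power)
      then have "(t * t ^ j) * cmod (poly (cp P1) ?w) \<le> (t * t ^ j) * (t * cmod (poly (cp P2) ?w))"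
        by (simp add: algebra_simps)
      then show ?thesis using t by (subst (asm) mult_le_cancel_left_pos) auto
    qed
    have "((\<lambda>t. cmod (poly (cp P1) (- \<i> * of_real t))) \<longlongrightarrow> cmod (poly (cp P1) (- \<i> * of_real 0))) (at_right 0)"
      by (intro tendsto_intros)
    moreover have "((\<lambda>t. t * cmod (poly (cp P2) (- \<i> * of_real t))) \<longlongrightarrow> 0 * cmod (poly (cp P2) (- \<i> * of_real 0))) (at_right 0)"
      by (intro tendsto_intros)
    moreover have "eventually (\<lambda>t. cmod (poly (cp P1) (- \<i> * of_real t)) \<le> t * cmod (poly (cp P2) (- \<i> * of_real t))) (at_right 0)"
      using eventually_at_right_less[of 0] by eventually_elim (rule le)
    ultimately have "cmod (poly (cp P1) (- \<i> * of_real 0)) \<le> 0 * cmod (poly (cp P2) (- \<i> * of_real 0))"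
      by (intro tendsto_le[of "at_right (0::real)"]) auto
    then have "poly (cp P1) (of_real 0) = 0" by simp
    then show False using nz unfolding poly_cp_of_real by simp
  qed
qed

lemma dvd_pderiv_power:
  "[:- \<theta>, 1 :: real:] ^ s dvd p \<Longrightarrow> i < s \<Longrightarrow> poly ((pderiv ^^ i) p) \<theta> = 0"
proof (induction i arbitrary: s p)
  case 0
  then have "[:- \<theta>, 1:] dvd p" by (meson dvd_power dvd_trans)
  then show ?case by (simp add: poly_eq_0_iff_dvd)
next
  case (Suc i)
  then obtain s' where s': "s = Suc s'" by (cases s) auto
  obtain q where q: "p = [:- \<theta>, 1:] ^ Suc s' * q" using Suc.prems(1) unfolding s' by (elim dvdE)
  have "pderiv p = [:- \<theta>, 1:] ^ s' * ([:- \<theta>, 1:] * pderiv q + smult (of_nat (Suc s')) q)"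
    unfolding q pderiv_mult pderiv_power_Suc by (simp add: pderiv_pCons algebra_simps)
  then have "[:- \<theta>, 1:] ^ s' dvd pderiv p" by simp
  then have "poly ((pderiv ^^ i) (pderiv p)) \<theta> = 0" using Suc s' by auto
  then show ?case by (simp add: funpow_swap1)
qed

context nd_op
begin

text \<open>The symbols \<open>P i\<close> of \<open>D^i T\<close> at \<open>\<theta>\<close> are real-rooted, and \<open>P i (D)\<close> maps \<open>rpoly A\<close> and
  \<open>rpoly B\<close> to polynomials vanishing at \<open>\<theta>\<close> as long as \<open>i\<close> is less than the common multiplicity.
  Since their degrees increase with \<open>i\<close>, the common multiplicity would exceed itself.\<close>

lemma nests_no_common_zero:
  assumes Qz: "\<And>k. N < k \<Longrightarrow> Q k = 0" and AB: "nests A B" and M: "M \<le> size A"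
    and sub: "A \<subseteq># Z A" "B \<subseteq># Z B" and k0: "k0 \<in> {1..size A}" "poly (Q k0) \<theta> \<noteq> 0"
  shows "\<not> (\<theta> \<in># A \<and> \<theta> \<in># B)"
proof
  assume \<theta>: "\<theta> \<in># A \<and> \<theta> \<in># B"
  define n where "n = size A"
  have sB: "size B = Suc n" using AB by (simp add: nests_def n_def)
  define \<sigma> where "\<sigma> = min (count A \<theta>) (count B \<theta>)"
  have \<sigma>: "\<sigma> \<ge> 1" using \<theta> by (simp add: \<sigma>_def Suc_le_eq)
  have \<sigma>n: "\<sigma> \<le> n" using count_le_size[of A \<theta>] by (simp add: \<sigma>_def n_def)
  \<comment> \<open>\<open>C \<subseteq># Z C\<close> says that \<open>rpoly C\<close> divides its
    image, so the image inherits the multiplicity at \<theta>.\<close>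
  have dv: "[:- \<theta>, 1:] ^ \<sigma> dvd T (rpoly C)" if "C \<subseteq># Z C" "\<sigma> \<le> count C \<theta>" "M \<le> size C" for C
  proof -
    have "count C \<theta> \<le> count (Z C) \<theta>" using that(1) by (rule mset_subset_eq_count)
    moreover have "T (rpoly C) \<noteq> 0" using T_rpoly(3)[OF that(3)] by (rule hyperbolic_nonzero)
    ultimately show ?thesis using that(2) by (simp add: order_divides Z_def)
  qed
  define Qi where "Qi i = (deriv_op ^^ i) Q" for i
  have Qi_Suc: "Qi (Suc i) = deriv_op (Qi i)" for i by (simp add: Qi_def)
  have Qiz: "N + i < k \<Longrightarrow> Qi i k = 0" for i k
  proof (induction i arbitrary: k)
    case 0
    then show ?case using Qz by (simp add: Qi_def)
  next
    case (Suc i)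
    then show ?case by (auto simp: Qi_Suc deriv_op_def split: nat.splits)
  qed
  have hyp: "hyp_op (Qi i) (N + i)" for i
  proof (induction i)
    case 0
    then show ?case using hyp_op_axioms by (simp add: Qi_def)
  next
    case (Suc i)
    have "hyp_op (deriv_op (Qi i)) (Suc (N + i))"
      by (rule hyp_op_deriv_op[OF Suc]) (rule Qiz)
    then show ?case by (simp add: Qi_Suc)
  qed
  have op: "diff_op (Qi i) 0 (N + i) f = (pderiv ^^ i) (T f)" for i f
  proof (induction i)
    case 0
    then show ?case by (simp add: Qi_def)
  next
    case (Suc i)
    have "diff_op (deriv_op (Qi i)) 0 (Suc (N + i)) f = pderiv (diff_op (Qi i) 0 (N + i) f)"
      by (rule diff_op_deriv_op) (rule Qiz)
    then show ?case by (simp add: Qi_Suc Suc)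
  qed
  define P where "P i = real_symbol (Qi i) (N + i) \<theta>" for i
  have k0N: "k0 \<le> N" using k0(2) Qz[of k0] by (metis not_le poly_0)
  \<comment> \<open>The nonvanishing coefficient serves twice: it bounds the degree of
    \<open>P 0\<close> below by \<open>k0 \<ge> 1\<close> and its order at \<open>0\<close> above by
    \<open>k0 \<le> n\<close>.\<close>
  have c0: "coeff (P 0) k0 \<noteq> 0" using k0 k0N by (simp add: P_def Qi_def coeff_real_symbol)
  have P0: "P 0 \<noteq> 0" using c0 by auto
  have d0: "k0 \<le> degree (P 0)" using c0 by (rule le_degree)
  have o0: "order 0 (P 0) \<le> k0"
  proof (rule ccontr)
    assume "\<not> ?thesis"
    then have "monom 1 (Suc k0) dvd P 0"
      using P0 order_divides[of 0 "Suc k0" "P 0"] by (simp add: monom_altdef)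
    then show False using c0 by (simp add: monom_1_dvd_iff' )
  qed
  have Pi: "P i \<noteq> 0 \<and> degree (P 0) + i \<le> degree (P i) \<and> order 0 (P i) \<le> order 0 (P 0) + i" for i
  proof (induction i)
    case 0
    then show ?case using P0 by simp
  next
    case (Suc i)
    interpret i: hyp_op "Qi i" "N + i" by (rule hyp)
    have "P (Suc i) \<noteq> 0 \<and> Suc (degree (P i)) \<le> degree (P (Suc i)) \<and> order 0 (P (Suc i)) \<le> Suc (order 0 (P i))"
      unfolding P_def Qi_Suc add_Suc_right
    proof (rule growth_imp_degree_order)
      show "real_symbol (Qi i) (N + i) \<theta> \<noteq> 0" using Suc by (simp add: P_def)
      show "- Im w * cmod (poly (cp (real_symbol (Qi i) (N + i) \<theta>)) w)
          \<le> cmod (poly (cp (real_symbol (deriv_op (Qi i)) (Suc (N + i)) \<theta>)) w)" if "Im w < 0" for w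
        by (rule i.real_symbol_deriv_growth[OF _ that]) (rule Qiz)
    qed
    then show ?case using Suc by auto
  qed
  \<comment> \<open>The least number of derivatives ensuring degree at least \<sigma>. It is less
    than \<sigma> because \<open>P 0\<close> is not constant, and truncated subtraction gives
    \<open>0\<close> if the degree already suffices.\<close>
  define i where "i = \<sigma> - degree (P 0)"
  have i\<sigma>: "i < \<sigma>" using d0 k0 \<sigma> by (auto simp: i_def)
  have di: "\<sigma> \<le> degree (P i)" using Pi[of i] by (auto simp: i_def)
  \<comment> \<open>This bounds the number of factors \<open>D\<close> by the degree of
    \<open>rpoly A\<close>. For \<open>i > 0\<close> the order at \<open>0\<close> is at most
    \<open>degree (P 0) + i = \<sigma> \<le> n\<close>.\<close>
  have oi: "order 0 (P i) \<le> n"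
  proof (cases "i = 0")
    case True
    then show ?thesis using o0 k0(1) by (simp add: n_def)
  next
    case False
    have "order 0 (P 0) \<le> degree (P 0)" by (rule order_degree[OF P0])
    then show ?thesis using Pi[of i] False \<sigma>n by (auto simp: i_def)
  qed
  interpret i: hyp_op "Qi i" "N + i" by (rule hyp)
  have hP: "hyperbolic (P i)" using i.symbol_real_hyperbolic[of \<theta>] Pi[of i] unfolding P_def real_symbol_def by blast
  obtain c where c: "c \<noteq> 0" "P i = smult c (rpoly (proots (P i)))" using hyperbolicE[OF hP] by metis
  have z: "poly (const_op (rpoly (proots (P i))) (rpoly C)) \<theta> = 0"
    if "C \<subseteq># Z C" "\<sigma> \<le> count C \<theta>" "M \<le> size C" for C
  proof -
    have "poly (const_op (P i) (rpoly C)) \<theta> = 0"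
      unfolding P_def poly_const_op_real_symbol op using dv[OF that] i\<sigma> by (rule dvd_pderiv_power)
    moreover have "const_op (P i) (rpoly C) = smult c (const_op (rpoly (proots (P i))) (rpoly C))"
      by (subst c(2)) (rule const_op_smult)
    ultimately show ?thesis using c(1) by simp
  qed
  have "Suc (size (proots (P i))) \<le> order \<theta> (rpoly A) \<and> Suc (size (proots (P i))) \<le> order \<theta> (rpoly B)"
  proof (rule pencil_common_zero)
    show "pencil (rpoly A) (rpoly B)" by (rule nests_imp_pencil[OF AB])
    show "degree (rpoly A) = n" "degree (rpoly B) = Suc n" by (simp_all add: n_def sB)
    show "count (proots (P i)) 0 \<le> n" using oi Pi[of i] by simp
    show "poly (const_op (rpoly (proots (P i))) (rpoly A)) \<theta> = 0"
      by (rule z[OF sub(1) _ M]) (simp add: \<sigma>_def)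
    show "poly (const_op (rpoly (proots (P i))) (rpoly B)) \<theta> = 0"
      by (rule z[OF sub(2)]) (use M sB in \<open>simp_all add: \<sigma>_def n_def\<close>)
  qed simp
  moreover have "order \<theta> (rpoly C) = count C \<theta>" for C
    using count_proots[of "rpoly C" \<theta>] by simp
  ultimately have "Suc \<sigma> \<le> count A \<theta> \<and> Suc \<sigma> \<le> count B \<theta>"
    using di size_proots_hyperbolic[OF hP] by auto
  then show False by (auto simp: \<sigma>_def)
qed

end

subsection \<open>Interlacing of the limits\<close>

context nd_op
begin

lemma vec_interlace_step:
  assumes len: "M \<le> length xs" and B: "arrow (length xs + r) B C" and v: "vec_interlace xs ys"
  shows "vec_interlace (step B xs) (step C ys)"
proof -
  have ly: "length ys = Suc (length xs)" using v by (simp add: vec_interlace_def)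
  have "nests (Z (mset xs)) (Z (mset ys))"
    using vec_interlace_imp_nests[OF v] len by (intro nests_Z) auto
  then have "vec_interlace (Zlist xs) (Zlist ys)"
    by (intro nests_imp_vec_interlace sorted_Zlist) (simp add: mset_Zlist)
  moreover have "length (Zlist xs) = length xs + r" "length (Zlist ys) = Suc (length xs + r)"
    using length_Zlist[of xs] length_Zlist[of ys] len ly by auto
  ultimately show ?thesis
    using B unfolding arrow_def step_def by (meson sorted_Zlist)
qed

text \<open>The common start is essential: constant lists with the same entry interlace, and each
  step preserves this.\<close>

lemma vec_interlace_iter:
  assumes "M \<le> n" "B \<subseteq> {1..n + r}" "card B = n" "arrow (n + r) B C"
  shows "vec_interlace (iter n B c i) (iter (n + 1) C c i)"
proof (induction i)
  case 0
  then show ?case by (auto simp: vec_interlace_def alternates_def nth_Cons split: nat.split)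
next
  case (Suc i)
  then show ?case
    using vec_interlace_step[OF _ _ Suc] length_iter[OF assms(1-3)] assms by simp
qed

definition limit_from :: "nat \<Rightarrow> nat set \<Rightarrow> real \<Rightarrow> real list \<Rightarrow> bool" where
  "limit_from n B c L \<longleftrightarrow> length L = n \<and> step B L = L \<and> (\<forall>j<n. (\<lambda>i. iter n B c i ! j) \<longlonglongrightarrow> L ! j) \<and>
     f_lim Q M N r n B = rpoly (mset L)"

lemma limit_from_smallest_zero:
  assumes n: "M \<le> n" "0 < n" and B: "B \<subseteq> {1..n + r}" "card B = n"
  shows "\<exists>L. limit_from n B (smallest_zero (Q (min n N))) L"
proof -
  let ?a = "smallest_zero (Q (min n N))"
  obtain L where L: "length L = n" "\<forall>j<n. (\<lambda>i. iter n B ?a i ! j) \<longlonglongrightarrow> L ! j" "step B L = L"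
    using iteration_converges[OF n(1) B start_increasing[OF n(1) B Zpow_smallest_zero[OF n order_refl]]] by blast
  then show ?thesis unfolding limit_from_def using f_lim_eq[OF n(1) B L(1)] by auto
qed

lemma limit_from_le_smallest_zero:
  assumes n: "M \<le> n" "0 < n" "n \<le> N" and B: "B \<subseteq> {1..n + r}" "card B = n"
    and c: "c \<le> smallest_zero (Q (min n N))"
  shows "\<exists>L. limit_from n B c L"
proof -
  let ?a = "smallest_zero (Q (min n N))"
  obtain L where L: "length L = n" "step B L = L" "\<forall>j<n. (\<lambda>i. iter n B c i ! j) \<longlonglongrightarrow> L ! j"
    "\<forall>j<n. (\<lambda>i. iter n B ?a i ! j) \<longlonglongrightarrow> L ! j"
    using limit_independent[OF n(1) B n(2,3) c] by blast
  then show ?thesis unfolding limit_from_def using f_lim_eq[OF n(1) B L(1)] by auto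
qed

lemma limit_from_0:
  assumes "M = 0" "card B = 0" "B \<subseteq> {1..0 + r}"
  shows "limit_from 0 B c []"
proof -
  have "step B [] = []" using length_step[of "[]" B] assms by simp
  moreover have "f_lim Q M N r 0 B = rpoly (mset [])"
    using assms by (intro f_lim_eq) auto
  ultimately show ?thesis by (simp add: limit_from_def)
qed

text \<open>For \<open>n = 0\<close> the empty list fits any start; for \<open>n \<ge> N\<close>
  both prescribed starts are the same; for \<open>n < N\<close> both degrees are at most
  \<open>N\<close>, so both iterations may start at the smaller of the two zeros.\<close>

lemma common_start:
  assumes n: "M \<le> n" and B: "B \<subseteq> {1..n + r}" "card B = n" and C: "C \<subseteq> {1..n + 1 + r}" "card C = n + 1"
  shows "\<exists>c L K. limit_from n B c L \<and> limit_from (n + 1) C c K"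
proof -
  consider "n = 0" | "0 < n" "N \<le> n" | "0 < n" "n < N" by linarith
  then show ?thesis
  proof cases
    case 1
    then show ?thesis
      using limit_from_0[of B] limit_from_smallest_zero[OF _ _ C] n B by auto
  next
    case 2
    then have "min (n + 1) N = min n N" by simp
    then show ?thesis
      using limit_from_smallest_zero[OF n 2(1) B] limit_from_smallest_zero[OF _ _ C] n by force
  next
    case 3
    define c where "c = min (smallest_zero (Q (min n N))) (smallest_zero (Q (min (n + 1) N)))"
    have "\<exists>L. limit_from n B c L" using n 3 by (intro limit_from_le_smallest_zero B) (auto simp: c_def)
    moreover have "\<exists>K. limit_from (n + 1) C c K"
      using n 3 by (intro limit_from_le_smallest_zero C) (auto simp: c_def)
    ultimately show ?thesis by blast
  qed
qed

lemma step_fixed_point_subset: "step B L = L \<Longrightarrow> mset L \<subseteq># Z (mset L)"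
  using mset_nths_subset[of "Zlist L" "{i. Suc i \<in> B}"] by (simp add: step_def restrict_vec_def mset_Zlist)

lemma f_lim_interlacing:
  assumes n: "M \<le> n" and B: "B \<subseteq> {1..n + r}" "card B = n" and C: "C \<subseteq> {1..n + 1 + r}" "card C = n + 1"
    and arr: "arrow (n + r) B C"
  shows "\<exists>A A'. f_lim Q M N r n B = rpoly A \<and> f_lim Q M N r (n + 1) C = rpoly A' \<and> size A = n \<and>
    nests A A' \<and> A \<subseteq># Z A \<and> A' \<subseteq># Z A'"
proof -
  obtain c L K where "limit_from n B c L" "limit_from (n + 1) C c K"
    using common_start[OF n B C] by blast
  then have L: "length L = n" "step B L = L" "\<forall>j<n. (\<lambda>i. iter n B c i ! j) \<longlonglongrightarrow> L ! j"
      "f_lim Q M N r n B = rpoly (mset L)"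
    and K: "length K = n + 1" "step C K = K" "\<forall>j<n + 1. (\<lambda>i. iter (n + 1) C c i ! j) \<longlonglongrightarrow> K ! j"
      "f_lim Q M N r (n + 1) C = rpoly (mset K)"
    unfolding limit_from_def by auto
  have vi: "vec_interlace (iter n B c i) (iter (n + 1) C c i)" for i
    by (rule vec_interlace_iter[OF n B arr])
  have li: "length (iter n B c i) = n" for i by (rule length_iter[OF n B])
  have 1: "iter (n + 1) C c i ! j \<le> iter n B c i ! j" "iter n B c i ! j \<le> iter (n + 1) C c i ! Suc j"
    if "j < n" for i j
    using vi[of i] that li[of i] unfolding vec_interlace_def alternates_def by auto
  have "K ! j \<le> L ! j \<and> L ! j \<le> K ! Suc j" if j: "j < n" for j
  proof
    have l: "(\<lambda>i. iter n B c i ! j) \<longlonglongrightarrow> L ! j" "(\<lambda>i. iter (n + 1) C c i ! j) \<longlonglongrightarrow> K ! j"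
      "(\<lambda>i. iter (n + 1) C c i ! Suc j) \<longlonglongrightarrow> K ! Suc j"
      using L(3) K(3) j by auto
    show "K ! j \<le> L ! j" by (rule LIMSEQ_le[OF l(2,1)]) (use 1[OF j] in blast)
    show "L ! j \<le> K ! Suc j" by (rule LIMSEQ_le[OF l(1,3)]) (use 1[OF j] in blast)
  qed
  then have "vec_interlace L K" using L(1) K(1) by (auto simp: vec_interlace_def alternates_def)
  from vec_interlace_imp_nests[OF this] L K show ?thesis
    by (intro exI[of _ "mset L"] exI[of _ "mset K"]) (auto intro: step_fixed_point_subset)
qed

end

section \<open>From root multisets to proper position, coprimality and strict interlacing\<close>

lemma nests_proper_position:
  assumes "nests A B"
  shows "rpoly A \<lless> rpoly B"
proof -
  have "vec_interlace (zeros (rpoly A)) (zeros (rpoly B))"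
    by (rule nests_imp_vec_interlace) (use assms in \<open>simp_all add: zeros_def\<close>)
  then show ?thesis
    using nests_Wronskian[OF assms] by (simp add: proper_position_def interlace_def vec_interlace_def)
qed

text \<open>A common divisor is real-rooted as a divisor of \<open>f\<close>, so unless it is
  constant it has a real zero, which is common to \<open>f\<close> and \<open>g\<close>.\<close>

lemma hyperbolic_coprime:
  assumes "hyperbolic f" "\<And>x. \<not> (poly f x = 0 \<and> poly g x = 0)"
  shows "coprime f g"
proof (rule coprimeI)
  fix d assume d: "d dvd f" "d dvd g"
  have h: "hyperbolic d" using hyperbolic_dvd[OF assms(1) d(1)] .
  have "proots d = {#}"
  proof (rule ccontr)
    assume "proots d \<noteq> {#}"
    then obtain x where "x \<in># proots d" by (meson multiset_nonemptyE)
    then have "poly d x = 0" using hyperbolic_nonzero[OF h] by simp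
    then have "poly f x = 0 \<and> poly g x = 0" using d by (auto elim!: dvdE)
    then show False using assms(2) by blast
  qed
  then have "degree d = 0" using size_proots_hyperbolic[OF h] by simp
  then show "is_unit d" using hyperbolic_nonzero[OF h] by (simp add: is_unit_iff_degree)
qed

lemma nests_strictly_interlace:
  assumes n: "nests A B" and nc: "\<And>x. \<not> (x \<in># A \<and> x \<in># B)"
  shows "strictly_interlace (rpoly A) (rpoly B)"
proof -
  define xs ys where "xs = zeros (rpoly A)" and "ys = zeros (rpoly B)"
  have v: "vec_interlace xs ys"
    unfolding xs_def ys_def by (rule nests_imp_vec_interlace) (use n in \<open>simp_all add: zeros_def\<close>)
  have ne: "xs ! i \<noteq> ys ! j" if "i < length xs" "j < length ys" for i j
  proof -
    have "xs ! i \<in> set xs" "ys ! j \<in> set ys" using that by auto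
    then show ?thesis using nc[of "xs ! i"] by (auto simp: xs_def ys_def zeros_def)
  qed
  have "alternates (<) ys xs"
    unfolding alternates_def
  proof (intro conjI allI impI)
    show "length ys = length xs \<or> length ys = Suc (length xs)" using v by (simp add: vec_interlace_def)
    show "ys ! i < xs ! i" if "i < length xs" for i
      using v that ne[of i i] by (auto simp: vec_interlace_def alternates_def less_le)
    show "xs ! i < ys ! Suc i" if "Suc i < length ys" for i
      using v that ne[of i "Suc i"] by (auto simp: vec_interlace_def alternates_def less_le)
  qed
  then show ?thesis by (simp add: strictly_interlace_def xs_def ys_def)
qed

lemma nd_opI:
  assumes "M \<le> N" "Q M \<noteq> 0" "Q N \<noteq> 0" and Q0: "\<And>k. k < M \<or> k > N \<Longrightarrow> Q k = 0"
    and hp: "hyperbolicity_preserver (diff_op Q M N)" and nd: "non_degenerate Q M N"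
    and fi: "fuchs_index Q M N = int r"
  shows "nd_op Q N M r"
proof
  have "diff_op Q 0 N f = diff_op Q M N f" for f
    unfolding diff_op_def by (rule sum.mono_neutral_right) (auto simp: Q0)
  then show "hyperbolicity_preserver (diff_op Q 0 N)" using hp by (simp add: hyperbolicity_preserver_def)
  have le: "int (degree (Q k)) - int k \<le> int r" if k: "k \<in> {M..N}" "Q k \<noteq> 0" for k
  proof -
    have "{int (degree (Q k)) - int k | k. k \<in> {M..N} \<and> Q k \<noteq> 0} \<subseteq> (\<lambda>k. int (degree (Q k)) - int k) ` {M..N}"
      by auto
    then have "finite {int (degree (Q k)) - int k | k. k \<in> {M..N} \<and> Q k \<noteq> 0}"
      using finite_subset by blast
    then show ?thesis
      unfolding fi[symmetric] fuchs_index_def using k by (intro Max_ge) auto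
  qed
  show "degree (Q k) \<le> k + r" if "k \<le> N" for k
    using le[of k] that Q0[of k] by (cases "Q k = 0") force+
  show "degree (Q N) = N + r" using nd fi by (simp add: non_degenerate_def)
qed (use assms in auto)

theorem theorem4p5:
  fixes Q :: "nat \<Rightarrow> real poly" and M N r n :: nat and B C :: "nat set"
  assumes "M \<le> N"
    and "Q M \<noteq> 0" and "Q N \<noteq> 0"
    and "\<And>k. k < M \<or> k > N \<Longrightarrow> Q k = 0"
    and "hyperbolicity_preserver (diff_op Q M N)"
    and "non_degenerate Q M N"
    and "fuchs_index Q M N = int r"
    and "M \<le> n"
    and "B \<subseteq> {1..n + r}" and "card B = n"
    and "C \<subseteq> {1..n + 1 + r}" and "card C = n + 1"
    and "arrow (n + r) B C"
  shows "f_lim Q M N r n B \<lless> f_lim Q M N r (n + 1) C \<and>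
    ((\<nexists>\<theta>::real. \<forall>k\<in>{1..n}. poly (Q k) \<theta> = 0) \<longrightarrow>
       coprime (f_lim Q M N r n B) (f_lim Q M N r (n + 1) C) \<and>
       strictly_interlace (f_lim Q M N r n B) (f_lim Q M N r (n + 1) C))"
proof -
  interpret nd_op Q N M r by (rule nd_opI) (use assms in auto)
  obtain A A' where f: "f_lim Q M N r n B = rpoly A" and g: "f_lim Q M N r (n + 1) C = rpoly A'"
    and A: "size A = n" "nests A A'" "A \<subseteq># Z A" "A' \<subseteq># Z A'"
    using f_lim_interlacing[OF assms(8-13)] by blast
  have "coprime (rpoly A) (rpoly A') \<and> strictly_interlace (rpoly A) (rpoly A')"
    if np: "\<nexists>\<theta>::real. \<forall>k\<in>{1..n}. poly (Q k) \<theta> = 0"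
  proof -
    have nc: "\<not> (\<theta> \<in># A \<and> \<theta> \<in># A')" for \<theta>
    proof -
      obtain k0 where "k0 \<in> {1..n}" "poly (Q k0) \<theta> \<noteq> 0" using np by blast
      then show ?thesis
        using nests_no_common_zero[OF _ A(2) _ A(3,4), of k0 \<theta>] assms(4,8) A(1) by auto
    qed
    show ?thesis
    proof
      show "coprime (rpoly A) (rpoly A')" by (rule hyperbolic_coprime) (use nc in simp_all)
      show "strictly_interlace (rpoly A) (rpoly A')" by (rule nests_strictly_interlace[OF A(2) nc])
    qed
  qed
  with nests_proper_position[OF A(2)] show ?thesis unfolding f g by blast
qed

end
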